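(* Let $d\ge 0$ be an integer and let $G(n,p_n)$, $n\ge 2$, be a sequence of Erdős–Rényi random graphs with $p_n\in(0,1)$. Suppose there exist constants $0<\theta'\le\theta''<\infty$ and $n_0>0$, and numbers $\theta_n\in[\theta',\theta'']$, such that $p_n=\theta_n/(n-1)$ for all $n\ge n_0$. Let $S_n$ be the number of vertices of degree $d$ in $G(n,p_n)$, and let $\mu_n$ and $\sigma_n^2$ be the mean and variance of $S_n$. Then there is a positive constant $c_d=c(d,\theta',\theta'',n_0)$, depending only on $d,\theta',\theta'',n_0$, such that for all $n\ge 2$, $$d_{\mathrm{TV}}\bigl(\mathcal{L}(S_n),N^d(\mu_n,\sigma_n^2)\bigr)\le \frac{c_d}{\sqrt{n}}.$$
   Context: $G(n,p)$ is the random graph with vertex set $\{1,\dots,n\}$ in which each pair of distinct vertices is joined by an edge independently with probability $p$. $\mathcal{L}(X)$ denotes the distribution of a random variable $X$. The total variation distance is $d_{\mathrm{TV}}(\mathcal{L}(X),\mathcal{L}(Y))=\sup_{A\subset\mathbb{R}}|\mathbb{P}(X\in A)-\mathbb{P}(Y\in A)|$ (supremum over measurable $A$). Discretized normal distribution: $N^d(\mu,\sigma^2)$ is the distribution supported on $\mathbb{Z}$ with probability mass function at $z\in\mathbb{Z}$ equal to $\mathbb{P}(z-\tfrac12\le Z_{\mu,\sigma^2}<z+\tfrac12)$, where $Z_{\mu,\sigma^2}$ is a Gaussian variable with mean $\mu$ and variance $\sigma^2$ (with $Z_{\mu,0}=\mu$ in the degenerate case $\sigma^2=0$). The superscript $d$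 in $N^d$ stands for "discretized" and is unrelated to the degree $d$. *)

theory Defs
  imports "HOL-Probability.Probability"
begin

text \<open>A graph on \<open>{1..n}\<close> is represented by its set of edges, each edge being a two-element set
  of vertices.\<close>

definition vertex_pairs :: "nat \<Rightarrow> nat set set" where
  "vertex_pairs n = {e. e \<subseteq> {1..n} \<and> card e = 2}"

definition erdos_renyi :: "nat \<Rightarrow> real \<Rightarrow> nat set set pmf" where
  "erdos_renyi n p =
     map_pmf (\<lambda>X. {e \<in> vertex_pairs n. X e})
       (Pi_pmf (vertex_pairs n) False (\<lambda>_. bernoulli_pmf p))"

definition vertex_degree :: "nat set set \<Rightarrow> nat \<Rightarrow> nat" where
  "vertex_degree E v = card {e \<in> E. v \<in> e}"

definition num_of_degree :: "nat \<Rightarrow> nat \<Rightarrow> nat set set \<Rightarrow> nat" where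
  "num_of_degree d n E = card {v \<in> {1..n}. vertex_degree E v = d}"

definition law :: "'a pmf \<Rightarrow> ('a \<Rightarrow> real) \<Rightarrow> real measure" where
  "law P X = distr (measure_pmf P) borel X"

definition tv_dist :: "real measure \<Rightarrow> real measure \<Rightarrow> real" where
  "tv_dist M N = (SUP A\<in>sets borel. \<bar>measure M A - measure N A\<bar>)"

text \<open>The second parameter of \<open>gaussian\<close> and of \<open>discretized_normal\<close> is the variance,
  whereas \<^const>\<open>normal_density\<close> expects the standard deviation.\<close>

definition gaussian :: "real \<Rightarrow> real \<Rightarrow> real measure" where
  "gaussian \<mu> v =
     (if v = 0 then return borel \<mu>
      else density lborel (\<lambda>x. ennreal (normal_density \<mu> (sqrt v) x)))"

definition discretized_normal :: "real \<Rightarrow> real \<Rightarrow> int pmf" where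
  "discretized_normal \<mu> v =
     embed_pmf (\<lambda>z. measure (gaussian \<mu> v) {real_of_int z - 1/2 ..< real_of_int z + 1/2})"

lemma sets_gaussian [simp, measurable_cong]: "sets (gaussian \<mu> v) = sets borel"
  by (simp add: gaussian_def)

lemma space_gaussian [simp]: "space (gaussian \<mu> v) = UNIV"
  by (simp add: gaussian_def)

lemma prob_space_gaussian:
  assumes "v \<ge> 0"
  shows "prob_space (gaussian \<mu> v)"
  using assms by (auto simp: gaussian_def intro!: prob_space_return prob_space_normal_density)

lemma pmf_discretized_normal:
  assumes "v \<ge> 0"
  shows "pmf (discretized_normal \<mu> v) z =
    measure (gaussian \<mu> v) {real_of_int z - 1/2 ..< real_of_int z + 1/2}"
  unfolding discretized_normal_def
proof (rule pmf_embed_pmf)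
  interpret prob_space "gaussian \<mu> v" using assms by (rule prob_space_gaussian)
  let ?I = "\<lambda>z::int. {real_of_int z - 1/2 ..< real_of_int z + 1/2}"
  have mem: "x \<in> ?I z \<longleftrightarrow> z = \<lfloor>x + 1/2\<rfloor>" for x z
    by (simp add: eq_commute[of z] floor_eq_iff) linarith
  have "(\<integral>\<^sup>+z. ennreal (measure (gaussian \<mu> v) (?I z)) \<partial>count_space UNIV) =
        (\<integral>\<^sup>+z. emeasure (gaussian \<mu> v) (?I z) \<partial>count_space UNIV)"
    by (simp add: emeasure_eq_measure)
  also have "\<dots> = emeasure (gaussian \<mu> v) (\<Union>z. ?I z)"
    by (rule emeasure_UN_countable[symmetric])
       (auto simp: disjoint_family_on_def mem simp del: atLeastLessThan_iff)
  also have "(\<Union>z. ?I z) = space (gaussian \<mu> v)"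
    by (auto simp: mem simp del: atLeastLessThan_iff)
  finally show "(\<integral>\<^sup>+z. ennreal (measure (gaussian \<mu> v) (?I z)) \<partial>count_space UNIV) = 1"
    by (simp add: emeasure_space_1[simplified])
qed simp

lemma tv_dist_bdd_above:
  assumes "prob_space M" and "prob_space N"
  shows "bdd_above ((\<lambda>A. \<bar>measure M A - measure N A\<bar>) ` sets borel)"
proof (rule bdd_aboveI2)
  fix A
  show "\<bar>measure M A - measure N A\<bar> \<le> 1"
    using prob_space.prob_le_1[OF assms(1), of A] prob_space.prob_le_1[OF assms(2), of A]
      measure_nonneg[of M A] measure_nonneg[of N A] by linarith
qed

end

theory Submission
  imports Defs
begin

text \<open>Stein's method. Let \<open>W\<close> be the number of vertices of degree \<open>d\<close>, \<open>X v\<close> the centred indicator of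
  \<open>deg v = d\<close>, and \<open>W - \<delta> v\<close> the same count after deleting the vertex \<open>v\<close>. As \<open>W - \<delta> v\<close> is independent
  of \<open>X v\<close>, the expectation of \<open>(W - \<mu>) f W\<close> is that of \<open>\<Sum>v. X v * (f W - f (W - \<delta> v))\<close>.
  Let \<open>f\<close> solve the Gaussian Stein equation for the indicator of a union of the intervals
  \<open>[z - 1/2, z + 1/2)\<close>, with derivative \<open>g\<close>. Then \<open>f w - f (w - k) - k * g w\<close> is, up to a small error,
  a difference \<open>K k w - K k (w - 1)\<close> with \<open>K\<close> bounded by \<open>k\<^sup>2\<close> times the bound of \<open>g\<close>. It
  remains to control the fluctuation of \<open>Z = \<Sum>v. X v * \<delta> v\<close>, whose mean is the variance of \<open>W\<close>, and
  the mean of \<open>\<Psi> W - \<Psi> (W - 1)\<close> where \<open>\<Psi> w = \<Sum>v. X v * K (\<delta> v) w\<close>. The latter is done by reversibility of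
  adding and deleting an edge whose addition lowers \<open>W\<close> by one. The rates \<open>Tminus\<close> and \<open>Tplus\<close> of
  these moves have mean of order \<open>n\<close> and, like \<open>Z\<close>, variance of order \<open>n\<close> by the Efron-Stein
  inequality, so that the smoothing gains the factor \<open>1 / sqrt n\<close>.\<close>

section \<open>Expectations over random subsets\<close>

text \<open>The obstacle is the roughness of the test set: \<open>g\<close> jumps where the
  indicator does, so \<open>g z - g (z - 1)\<close> is only of order \<open>1 / n\<close>, no better
  than \<open>g\<close> itself. A plain second-order expansion of \<open>f\<close>, summed over
  \<open>n\<close> vertices, would leave an error of order one. The missing smoothness has to come
  from the law of \<open>W\<close>, and this is why the main error is kept as an exact unit
  difference in \<open>w\<close>. The power count is as follows. The variance of \<open>W\<close>
  and the mean rate \<open>q\<close> are at least of order \<open>n\<close>. Hence \<open>g\<close>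
  is of order \<open>1 / n\<close> and \<open>\<Psi>\<close> of order one; Cauchy-Schwarz against a
  rate with standard deviation of order \<open>sqrt n\<close>, divided by \<open>q\<close>, gives
  \<open>1 / sqrt n\<close>. The non-telescoping remainder is of order \<open>n powr (-3/2)\<close>
  per vertex. All upper bounds reduce to the fourth moment of \<open>1 + deg\<close>, which is
  bounded since \<open>n * p\<close> is. The lower bounds on the variance and on \<open>q\<close>
  are where \<open>\<theta>' > 0\<close> enters. Small \<open>n\<close> are absorbed by the trivial
  bound 1 on the distance. Expectations are finite weighted sums over subsets of the edge set, so
  that independence, variance bounds and reversibility can be proved by conditioning on single
  elements.\<close>

definition subset_expect :: "real \<Rightarrow> 'a set \<Rightarrow> ('a set \<Rightarrow> real) \<Rightarrow> real" where
  "subset_expect p E F = (\<Sum>G\<in>Pow E. p ^ card G * (1 - p) ^ card (E - G) * F G)"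

lemma subset_expect_empty [simp]: "subset_expect p {} F = F {}"
  by (simp add: subset_expect_def)

text \<open>Conditioning on whether \<open>e\<close> is present. This recursion drives the
  inductions on the ground set below.\<close>

lemma subset_expect_insert:
  assumes "finite E" "e \<notin> E"
  shows "subset_expect p (insert e E) F =
    p * subset_expect p E (\<lambda>G. F (insert e G)) + (1 - p) * subset_expect p E F"
proof -
  let ?w = "\<lambda>E' G. p ^ card G * (1 - p) ^ card (E' - G) * F G"
  have "subset_expect p (insert e E) F =
      (\<Sum>G\<in>Pow E. ?w (insert e E) G) + (\<Sum>G\<in>insert e ` Pow E. ?w (insert e E) G)"
    unfolding subset_expect_def Pow_insert using assms
    by (intro sum.union_disjoint) auto
  also have "(\<Sum>G\<in>insert e ` Pow E. ?w (insert e E) G) = (\<Sum>G\<in>Pow E. ?w (insert e E) (insert e G))"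
    using assms by (subst sum.reindex) (auto simp: inj_on_def)
  also have "\<dots> = p * subset_expect p E (\<lambda>G. F (insert e G))"
    unfolding subset_expect_def sum_distrib_left
  proof (intro sum.cong refl)
    fix G assume G: "G \<in> Pow E"
    then have "finite G" "e \<notin> G" using assms finite_subset by auto
    moreover have "insert e E - insert e G = E - G" using assms G by auto
    ultimately show "?w (insert e E) (insert e G) =
        p * (p ^ card G * (1 - p) ^ card (E - G) * F (insert e G))" by simp
  qed
  also have "(\<Sum>G\<in>Pow E. ?w (insert e E) G) = (1 - p) * subset_expect p E F"
    unfolding subset_expect_def sum_distrib_left
  proof (intro sum.cong refl)
    fix G assume G: "G \<in> Pow E"
    have "insert e E - G = insert e (E - G)" using assms G by auto
    then have "card (insert e E - G) = Suc (card (E - G))" using assms by simp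
    then show "?w (insert e E) G = (1 - p) * (p ^ card G * (1 - p) ^ card (E - G) * F G)" by simp
  qed
  finally show ?thesis by simp
qed

lemma subset_expect_cong:
  "(\<And>G. G \<subseteq> E \<Longrightarrow> F G = F' G) \<Longrightarrow> subset_expect p E F = subset_expect p E F'"
  unfolding subset_expect_def by (intro sum.cong) auto

lemma subset_expect_add:
  "subset_expect p E (\<lambda>G. F G + H G) = subset_expect p E F + subset_expect p E H"
  by (simp add: subset_expect_def sum.distrib algebra_simps)

lemma subset_expect_diff:
  "subset_expect p E (\<lambda>G. F G - H G) = subset_expect p E F - subset_expect p E H"
  by (simp add: subset_expect_def sum_subtractf algebra_simps)

lemma subset_expect_cmult: "subset_expect p E (\<lambda>G. c * F G) = c * subset_expect p E F"
  by (simp add: subset_expect_def sum_distrib_left mult.left_commute)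

lemma subset_expect_sum:
  "subset_expect p E (\<lambda>G. \<Sum>i\<in>I. F i G) = (\<Sum>i\<in>I. subset_expect p E (F i))"
  unfolding subset_expect_def sum_distrib_left by (rule sum.swap)

lemma subset_expect_const [simp]: "finite E \<Longrightarrow> subset_expect p E (\<lambda>_. c) = c"
  by (induction E rule: finite_induct) (simp_all add: subset_expect_insert algebra_simps)

lemma subset_expect_mono:
  assumes "0 \<le> p" "p \<le> 1" "\<And>G. G \<subseteq> E \<Longrightarrow> F G \<le> F' G"
  shows "subset_expect p E F \<le> subset_expect p E F'"
  unfolding subset_expect_def using assms by (intro sum_mono mult_left_mono) auto

lemma subset_expect_nonneg:
  assumes "0 \<le> p" "p \<le> 1" "\<And>G. G \<subseteq> E \<Longrightarrow> 0 \<le> F G"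
  shows "0 \<le> subset_expect p E F"
  unfolding subset_expect_def using assms by (intro sum_nonneg mult_nonneg_nonneg) auto

lemma abs_subset_expect_le:
  assumes "0 \<le> p" "p \<le> 1" "\<And>G. G \<subseteq> E \<Longrightarrow> \<bar>F G\<bar> \<le> F' G"
  shows "\<bar>subset_expect p E F\<bar> \<le> subset_expect p E F'"
proof -
  have "subset_expect p E F \<le> subset_expect p E F'"
    using assms by (intro subset_expect_mono) (auto simp: abs_le_iff)
  moreover have "subset_expect p E (\<lambda>G. (-1) * F G) \<le> subset_expect p E F'"
    using assms by (intro subset_expect_mono) (auto simp: abs_le_iff)
  ultimately show ?thesis unfolding subset_expect_cmult by linarith
qed

lemma subset_expect_Cauchy_Schwarz:
  assumes "0 \<le> p" "p \<le> 1"
  shows "\<bar>subset_expect p E (\<lambda>G. F G * H G)\<bar> \<le>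
    sqrt (subset_expect p E (\<lambda>G. (F G)\<^sup>2)) * sqrt (subset_expect p E (\<lambda>G. (H G)\<^sup>2))"
proof -
  let ?w = "\<lambda>G. p ^ card G * (1 - p) ^ card (E - G)"
  have w: "0 \<le> ?w G" for G using assms by simp
  \<comment> \<open>Each weight is split evenly between the two factors through its square
    root.\<close>
  have "(\<Sum>G\<in>Pow E. (sqrt (?w G) * F G) * (sqrt (?w G) * H G))\<^sup>2 \<le>
      (\<Sum>G\<in>Pow E. (sqrt (?w G) * F G)\<^sup>2) * (\<Sum>G\<in>Pow E. (sqrt (?w G) * H G)\<^sup>2)"
    by (rule Cauchy_Schwarz_ineq_sum)
  moreover have "(sqrt (?w G) * F G) * (sqrt (?w G) * H G) = ?w G * (F G * H G)"
    "(sqrt (?w G) * F G)\<^sup>2 = ?w G * (F G)\<^sup>2"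
    "(sqrt (?w G) * H G)\<^sup>2 = ?w G * (H G)\<^sup>2" for G
    using real_sqrt_mult_self[of "?w G"] w[of G]
    by (simp_all add: algebra_simps power2_eq_square del: real_sqrt_mult)
  ultimately have "(subset_expect p E (\<lambda>G. F G * H G))\<^sup>2 \<le>
      subset_expect p E (\<lambda>G. (F G)\<^sup>2) * subset_expect p E (\<lambda>G. (H G)\<^sup>2)"
    unfolding subset_expect_def by simp
  then have "sqrt ((subset_expect p E (\<lambda>G. F G * H G))\<^sup>2) \<le>
     sqrt (subset_expect p E (\<lambda>G. (F G)\<^sup>2) * subset_expect p E (\<lambda>G. (H G)\<^sup>2))"
    by (rule real_sqrt_le_mono)
  then show ?thesis by (simp add: real_sqrt_mult)
qed

text \<open>Independence of functions of disjoint sets of coordinates: a new element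
  \<open>e\<close> lies inside or outside \<open>A\<close>, so only one of the two factors reacts to
  it and the other passes through the conditioning unchanged.\<close>

lemma subset_expect_mult_indep:
  assumes "finite E" "\<And>G. F G = F (G \<inter> A)" "\<And>G. H G = H (G - A)"
  shows "subset_expect p E (\<lambda>G. F G * H G) = subset_expect p E F * subset_expect p E H"
  using assms
proof (induction E arbitrary: F H rule: finite_induct)
  case (insert e E)
  show ?case
  proof (cases "e \<in> A")
    case True
    have H: "H (insert e G) = H G" for G
      using insert.prems(2)[of G] insert.prems(2)[of "insert e G"] True by (simp add: insert_Diff_if)
    have F: "F (insert e G) = F (insert e (G \<inter> A))" for G
      using insert.prems(1)[of "insert e (G \<inter> A)"] insert.prems(1)[of "insert e G"] True
      by (simp add: Int_insert_left)
    have "subset_expect p E (\<lambda>G. F (insert e G) * H G) =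
        subset_expect p E (\<lambda>G. F (insert e G)) * subset_expect p E H"
      by (rule insert.IH) (rule F, rule insert.prems(2))
    moreover have "subset_expect p E (\<lambda>G. F G * H G) = subset_expect p E F * subset_expect p E H"
      by (rule insert.IH) (rule insert.prems)+
    ultimately show ?thesis
      using insert.hyps by (simp add: subset_expect_insert H algebra_simps)
  next
    case False
    have F: "F (insert e G) = F G" for G
      using insert.prems(1)[of G] insert.prems(1)[of "insert e G"] False by (simp add: Int_insert_left)
    have H: "H (insert e G) = H (insert e (G - A))" for G
      using insert.prems(2)[of "insert e (G - A)"] insert.prems(2)[of "insert e G"] False
      by (simp add: insert_Diff_if)
    have "subset_expect p E (\<lambda>G. F G * H (insert e G)) =
        subset_expect p E F * subset_expect p E (\<lambda>G. H (insert e G))"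
      by (rule insert.IH) (rule insert.prems(1), rule H)
    moreover have "subset_expect p E (\<lambda>G. F G * H G) = subset_expect p E F * subset_expect p E H"
      by (rule insert.IH) (rule insert.prems)+
    ultimately show ?thesis
      using insert.hyps by (simp add: subset_expect_insert F algebra_simps)
  qed
qed simp

lemma subset_expect_remove:
  assumes "finite E" "e \<in> E"
  shows "subset_expect p E F = p * subset_expect p (E - {e}) (\<lambda>G. F (insert e G))
    + (1 - p) * subset_expect p (E - {e}) F"
  using subset_expect_insert[of "E - {e}" e p F] assms by (simp add: insert_absorb)

text \<open>The presence of \<open>e\<close> is independent of the rest of \<open>G\<close>, and
  composing with \<open>insert e\<close> makes the function blind to it, so the expectation on the
  right can still run over all of \<open>E\<close>.\<close>

lemma subset_expect_mem:
  assumes "finite E" "e \<in> E"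
  shows "subset_expect p E (\<lambda>G. if e \<in> G then F G else 0) =
    p * subset_expect p E (\<lambda>G. F (insert e G))"
proof -
  have "subset_expect p (E - {e}) (\<lambda>G. if e \<in> G then F G else 0) =
      subset_expect p (E - {e}) (\<lambda>G. 0)"
    by (rule subset_expect_cong) auto
  then show ?thesis
    using assms subset_expect_remove[OF assms, of p "\<lambda>G. if e \<in> G then F G else 0"]
    subset_expect_remove[OF assms, of p "\<lambda>G. F (insert e G)"]
    by (simp add: algebra_simps)
qed

lemma subset_expect_not_mem:
  assumes "finite E" "e \<in> E"
  shows "subset_expect p E (\<lambda>G. if e \<in> G then 0 else F G) =
    (1 - p) * subset_expect p E (\<lambda>G. F (G - {e}))"
proof -
  have *: "subset_expect p (E - {e}) (\<lambda>G. if e \<in> G then 0 else F G) = subset_expect p (E - {e}) F"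
    "subset_expect p (E - {e}) (\<lambda>G. F (G - {e})) = subset_expect p (E - {e}) F"
    by (rule subset_expect_cong, auto dest: subset_Diff_insert[THEN iffD1])+
  show ?thesis
    using assms subset_expect_remove[OF assms, of p "\<lambda>G. if e \<in> G then 0 else F G"]
    subset_expect_remove[OF assms, of p "\<lambda>G. F (G - {e})"] *
    by (auto simp: algebra_simps)
qed

text \<open>The Bernoulli counterpart of the Mecke formula for Poisson processes: a sum over present
  elements is traded for a sum over all elements after insertion.\<close>

lemma subset_expect_Mecke:
  assumes "finite E"
  shows "subset_expect p E (\<lambda>G. \<Sum>e\<in>G. F e G) = p * (\<Sum>e\<in>E. subset_expect p E (\<lambda>G. F e (insert e G)))"
proof -
  have "subset_expect p E (\<lambda>G. \<Sum>e\<in>G. F e G) =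
      subset_expect p E (\<lambda>G. \<Sum>e\<in>E. if e \<in> G then F e G else 0)"
    using assms by (intro subset_expect_cong) (simp add: sum.If_cases Int_absorb1 flip: Int_def)
  also have "\<dots> = p * (\<Sum>e\<in>E. subset_expect p E (\<lambda>G. F e (insert e G)))"
    unfolding subset_expect_sum sum_distrib_left
    by (intro sum.cong refl) (simp add: subset_expect_mem assms)
  finally show ?thesis .
qed

lemma subset_expect_restrict:
  assumes "finite E"
  shows "subset_expect p E (\<lambda>G. F (G \<inter> A)) = subset_expect p (E \<inter> A) F"
  using assms
proof (induction E arbitrary: F rule: finite_induct)
  case (insert e E)
  show ?case
  proof (cases "e \<in> A")
    case True
    then show ?thesis using insert
      by (simp add: subset_expect_insert insert.IH[of "\<lambda>G. F (insert e G)"])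
  next
    case False
    then show ?thesis using insert by (simp add: subset_expect_insert algebra_simps)
  qed
qed simp

section \<open>Variance and the Efron-Stein inequality\<close>

definition subset_var :: "real \<Rightarrow> 'a set \<Rightarrow> ('a set \<Rightarrow> real) \<Rightarrow> real" where
  "subset_var p E F = subset_expect p E (\<lambda>G. (F G - subset_expect p E F)\<^sup>2)"

lemma subset_var_alt:
  "finite E \<Longrightarrow> subset_var p E F = subset_expect p E (\<lambda>G. (F G)\<^sup>2) - (subset_expect p E F)\<^sup>2"
proof -
  assume "finite E"
  let ?m = "subset_expect p E F"
  have "subset_var p E F = subset_expect p E (\<lambda>G. ((F G)\<^sup>2 - 2 * ?m * F G) + ?m\<^sup>2)"
    unfolding subset_var_def by (intro subset_expect_cong) (simp add: power2_eq_square algebra_simps)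
  also have "\<dots> = subset_expect p E (\<lambda>G. (F G)\<^sup>2) - 2 * ?m * ?m + ?m\<^sup>2"
    unfolding subset_expect_add subset_expect_diff subset_expect_cmult using \<open>finite E\<close> by simp
  finally show ?thesis by (simp add: power2_eq_square)
qed

lemma subset_var_nonneg: "0 \<le> p \<Longrightarrow> p \<le> 1 \<Longrightarrow> 0 \<le> subset_var p E F"
  unfolding subset_var_def by (intro subset_expect_nonneg) auto

text \<open>Induction by the law of total variance with respect to the new element \<open>e\<close>:
  the within-group terms go to the induction hypothesis, the between-group term is the squared
  difference of the two conditional means and becomes the summand of \<open>e\<close>.\<close>

lemma subset_var_Poincare_aux:
  assumes "finite E" "0 \<le> p" "p \<le> 1"
  shows "subset_var p E F \<le> p * (1 - p) *
    (\<Sum>e\<in>E. subset_expect p E (\<lambda>G. (F (insert e G) - F (G - {e}))\<^sup>2))"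
  using assms(1)
proof (induction E arbitrary: F rule: finite_induct)
  case empty
  then show ?case by (simp add: subset_var_def)
next
  case (insert e E)
  let ?F1 = "\<lambda>G. F (insert e G)"
  let ?a = "subset_expect p E ?F1" and ?b = "subset_expect p E F"
  let ?S = "\<lambda>E F. \<Sum>f\<in>E. subset_expect p E (\<lambda>G. (F (insert f G) - F (G - {f}))\<^sup>2)"
  have "subset_var p (insert e E) F = p * subset_var p E ?F1 + (1 - p) * subset_var p E F
      + p * (1 - p) * (?a - ?b)\<^sup>2"
    using insert.hyps by (simp add: subset_var_alt subset_expect_insert power2_eq_square algebra_simps)
  \<comment> \<open>Jensen's inequality, read off from the nonnegativity of the variance of the
    difference \<open>?F1 G - F G\<close>.\<close>
  moreover have "(?a - ?b)\<^sup>2 \<le> subset_expect p E (\<lambda>G. (?F1 G - F G)\<^sup>2)"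
    using subset_var_nonneg[OF assms(2,3), of E "\<lambda>G. ?F1 G - F G"] insert.hyps
    by (simp add: subset_var_alt subset_expect_diff)
  ultimately have "subset_var p (insert e E) F \<le> p * (p * (1 - p) * ?S E ?F1)
      + (1 - p) * (p * (1 - p) * ?S E F) + p * (1 - p) * subset_expect p E (\<lambda>G. (?F1 G - F G)\<^sup>2)"
    using insert.IH[of ?F1] insert.IH[of F] assms
    by (smt (verit) mult_left_mono mult_nonneg_nonneg)
  also have "\<dots> = p * (1 - p) *
    (\<Sum>f\<in>insert e E. subset_expect p (insert e E) (\<lambda>G. (F (insert f G) - F (G - {f}))\<^sup>2))"
  proof -
    have 1: "subset_expect p (insert e E) (\<lambda>G. (F (insert e G) - F (G - {e}))\<^sup>2) =
        subset_expect p E (\<lambda>G. (?F1 G - F G)\<^sup>2)"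
    proof -
      have "subset_expect p E (\<lambda>G. (F (insert e G) - F (G - {e}))\<^sup>2) =
          subset_expect p E (\<lambda>G. (?F1 G - F G)\<^sup>2)"
      proof (rule subset_expect_cong)
        fix G assume "G \<subseteq> E"
        then have "G - {e} = G" using insert.hyps by auto
        then show "(F (insert e G) - F (G - {e}))\<^sup>2 = (?F1 G - F G)\<^sup>2" by simp
      qed
      moreover have "subset_expect p E (\<lambda>G. (F (insert e G) - F (insert e G - {e}))\<^sup>2) =
          subset_expect p E (\<lambda>G. (?F1 G - F G)\<^sup>2)"
      proof (rule subset_expect_cong)
        fix G assume "G \<subseteq> E"
        then have "insert e G - {e} = G" using insert.hyps by auto
        then show "(F (insert e G) - F (insert e G - {e}))\<^sup>2 = (?F1 G - F G)\<^sup>2" by simp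
      qed
      ultimately show ?thesis using insert.hyps by (simp add: subset_expect_insert algebra_simps)
    qed
    have 2: "subset_expect p (insert e E) (\<lambda>G. (F (insert f G) - F (G - {f}))\<^sup>2) =
        p * subset_expect p E (\<lambda>G. (?F1 (insert f G) - ?F1 (G - {f}))\<^sup>2)
        + (1 - p) * subset_expect p E (\<lambda>G. (F (insert f G) - F (G - {f}))\<^sup>2)" if "f \<in> E" for f
    proof -
      have "insert e G - {f} = insert e (G - {f})" for G using that insert.hyps by auto
      then show ?thesis
        using insert.hyps by (simp add: subset_expect_insert insert_commute)
    qed
    have "(\<Sum>f\<in>E. subset_expect p (insert e E) (\<lambda>G. (F (insert f G) - F (G - {f}))\<^sup>2)) =
        p * ?S E ?F1 + (1 - p) * ?S E F"
      using 2 by (simp add: sum.distrib sum_distrib_left)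
    then show ?thesis
      unfolding sum.insert[OF insert.hyps] 1 by (simp only: distrib_left mult.left_commute add_ac)
  qed
  finally show ?case .
qed

text \<open>After dropping \<open>1 - p\<close>, the remaining factor \<open>p\<close> is absorbed
  by the Mecke formula. What is left is a sum over the edges actually present, which in a sparse
  graph is controlled by degrees.\<close>

lemma subset_var_Poincare:
  assumes "finite E" "0 \<le> p" "p \<le> 1"
  shows "subset_var p E F \<le> subset_expect p E (\<lambda>G. \<Sum>e\<in>G. (F G - F (G - {e}))\<^sup>2)"
proof -
  let ?S = "\<Sum>e\<in>E. subset_expect p E (\<lambda>G. (F (insert e G) - F (G - {e}))\<^sup>2)"
  have "0 \<le> ?S" using assms by (intro sum_nonneg subset_expect_nonneg) auto
  have "subset_var p E F \<le> p * (1 - p) * ?S" by (rule subset_var_Poincare_aux[OF assms])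
  also have "\<dots> \<le> p * 1 * ?S"
    using assms \<open>0 \<le> ?S\<close> by (intro mult_right_mono mult_left_mono) auto
  also have "\<dots> = subset_expect p E (\<lambda>G. \<Sum>e\<in>G. (F G - F (G - {e}))\<^sup>2)"
    by (simp add: subset_expect_Mecke[OF assms(1)])
  finally show ?thesis .
qed

text \<open>Adding and deleting elements are reversible with respect to the product measure, so a
  weight on moves decreasing \<open>W\<close> by one yields a discrete integration by parts in the value of \<open>W\<close>.\<close>

lemma subset_expect_shift:
  fixes W :: "'a set \<Rightarrow> int" and \<Psi> :: "'a set \<Rightarrow> int \<Rightarrow> real"
  assumes "finite E" "0 < p" "p < 1"
    and A: "\<And>e G. A e (insert e G) = A e (G - {e})"
    and W: "\<And>e G. e \<in> E \<Longrightarrow> G \<subseteq> E \<Longrightarrow> A e (G - {e}) \<noteq> 0 \<Longrightarrow> W (insert e G) = W (G - {e}) - 1"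
  shows "subset_expect p E (\<lambda>G. (\<Sum>e\<in>G. A e G) * \<Psi> G (W G))
    - subset_expect p E (\<lambda>G. (p / (1 - p) * (\<Sum>e\<in>E - G. A e G)) * \<Psi> G (W G - 1))
    = subset_expect p E (\<lambda>G. \<Sum>e\<in>G. A e G * (\<Psi> G (W G) - \<Psi> (G - {e}) (W G)))"
proof -
  have "subset_expect p E (\<lambda>G. (\<Sum>e\<in>E - G. A e G) * \<Psi> G (W G - 1)) =
      subset_expect p E (\<lambda>G. \<Sum>e\<in>E. if e \<in> G then 0 else A e G * \<Psi> G (W G - 1))"
    using assms(1)
    by (intro subset_expect_cong) (simp add: sum.If_cases sum_distrib_right Diff_eq Compl_eq)
  also have "\<dots> = (1 - p) * (\<Sum>e\<in>E. subset_expect p E (\<lambda>G. A e (G - {e}) * \<Psi> (G - {e}) (W (G - {e}) - 1)))"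
    unfolding subset_expect_sum sum_distrib_left
    by (intro sum.cong refl) (simp add: subset_expect_not_mem assms(1))
  also have "(\<Sum>e\<in>E. subset_expect p E (\<lambda>G. A e (G - {e}) * \<Psi> (G - {e}) (W (G - {e}) - 1))) =
      (\<Sum>e\<in>E. subset_expect p E (\<lambda>G. A e (insert e G) * \<Psi> (insert e G - {e}) (W (insert e G))))"
  \<comment> \<open>Where the weight vanishes both sides are zero; elsewhere the move lowers
    \<open>W\<close> by one, so that \<open>W (G - {e}) - 1\<close> is
    \<open>W (insert e G)\<close>.\<close>
  proof (intro sum.cong refl subset_expect_cong)
    fix e G assume "e \<in> E" "G \<subseteq> E"
    then show "A e (G - {e}) * \<Psi> (G - {e}) (W (G - {e}) - 1) =
        A e (insert e G) * \<Psi> (insert e G - {e}) (W (insert e G))"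
      using W[of e G] by (cases "A e (G - {e}) = 0") (simp_all add: A)
  qed
  finally have *: "subset_expect p E (\<lambda>G. (\<Sum>e\<in>E - G. A e G) * \<Psi> G (W G - 1)) = (1 - p) *
      (\<Sum>e\<in>E. subset_expect p E (\<lambda>G. A e (insert e G) * \<Psi> (insert e G - {e}) (W (insert e G))))" .
  \<comment> \<open>The odds \<open>p / (1 - p)\<close> turn the factor \<open>1 - p\<close> from
    absence of \<open>e\<close> into the factor \<open>p\<close> that the Mecke formula attaches to
    its presence.\<close>
  have "subset_expect p E (\<lambda>G. (p / (1 - p) * (\<Sum>e\<in>E - G. A e G)) * \<Psi> G (W G - 1)) =
      p / (1 - p) * subset_expect p E (\<lambda>G. (\<Sum>e\<in>E - G. A e G) * \<Psi> G (W G - 1))"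
    unfolding mult.assoc by (rule subset_expect_cmult)
  also have "\<dots> = subset_expect p E (\<lambda>G. \<Sum>e\<in>G. A e G * \<Psi> (G - {e}) (W G))"
    unfolding * subset_expect_Mecke[OF assms(1), where F = "\<lambda>e G. A e G * \<Psi> (G - {e}) (W G)"]
    using assms(2,3) by simp
  finally have "subset_expect p E (\<lambda>G. (p / (1 - p) * (\<Sum>e\<in>E - G. A e G)) * \<Psi> G (W G - 1)) =
      subset_expect p E (\<lambda>G. \<Sum>e\<in>G. A e G * \<Psi> (G - {e}) (W G))" .
  then show ?thesis
    by (simp only: sum_distrib_right right_diff_distrib sum_subtractf subset_expect_diff)
qed

text \<open>The generating function of a binomial variable; at \<open>c = exp 1\<close> it gives the
  exponential moment of a degree.\<close>

lemma subset_expect_exp_card: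
  assumes "finite E"
  shows "subset_expect p E (\<lambda>G. c ^ card (G \<inter> A)) = (1 + p * (c - 1)) ^ card (E \<inter> A)"
proof -
  have "subset_expect p S (\<lambda>G. c ^ card G) = (1 + p * (c - 1)) ^ card S" if "finite S" for S :: "'a set"
    using that
  proof (induction S rule: finite_induct)
    case (insert e S)
    have "subset_expect p S (\<lambda>G. c ^ card (insert e G)) = subset_expect p S (\<lambda>G. c * c ^ card G)"
    proof (rule subset_expect_cong)
      fix G assume "G \<subseteq> S"
      then have "finite G" "e \<notin> G" using insert.hyps finite_subset by auto
      then show "c ^ card (insert e G) = c * c ^ card G" by simp
    qed
    then show ?case
      using insert by (simp add: subset_expect_insert subset_expect_cmult algebra_simps)
  qed simp
  then show ?thesis
    using assms by (simp add: subset_expect_restrict[of E p "\<lambda>G. c ^ card G" A])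
qed

section \<open>Binomial counts and the link to the random graph\<close>

definition binom_prob :: "real \<Rightarrow> nat \<Rightarrow> nat \<Rightarrow> real" where
  "binom_prob p m k = real (m choose k) * p ^ k * (1 - p) ^ (m - k)"

lemma subset_expect_card_eq:
  assumes "finite E" "S \<subseteq> E"
  shows "subset_expect p E (\<lambda>G. \<psi> (card (G \<inter> S))) = (\<Sum>k\<le>card S. binom_prob p (card S) k * \<psi> k)"
proof -
  have "finite S" using assms finite_subset by auto
  have "subset_expect p E (\<lambda>G. \<psi> (card (G \<inter> S))) = subset_expect p S (\<lambda>G. \<psi> (card G))"
    using assms by (simp add: subset_expect_restrict[of E p "\<lambda>G. \<psi> (card G)" S] Int_absorb1)
  also have "\<dots> = (\<Sum>k\<le>card S. \<Sum>G\<in>{G \<in> Pow S. card G = k}. p ^ card G * (1 - p) ^ card (S - G) * \<psi> (card G))"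
    unfolding subset_expect_def using \<open>finite S\<close>
    by (intro sum.group[symmetric]) (auto intro: card_mono)
  also have "\<dots> = (\<Sum>k\<le>card S. binom_prob p (card S) k * \<psi> k)"
  proof (intro sum.cong refl)
    fix k
    have "(\<Sum>G\<in>{G \<in> Pow S. card G = k}. p ^ card G * (1 - p) ^ card (S - G) * \<psi> (card G)) =
        (\<Sum>G\<in>{G \<in> Pow S. card G = k}. p ^ k * (1 - p) ^ (card S - k) * \<psi> k)"
      using \<open>finite S\<close> by (intro sum.cong refl) (auto simp: card_Diff_subset finite_subset)
    then show "(\<Sum>G\<in>{G \<in> Pow S. card G = k}. p ^ card G * (1 - p) ^ card (S - G) * \<psi> (card G)) =
        binom_prob p (card S) k * \<psi> k"
      using n_subsets[OF \<open>finite S\<close>, of k] by (simp add: binom_prob_def)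
  qed
  finally show ?thesis .
qed

lemma subset_expect_card_eq_of_bool:
  assumes "finite E" "S \<subseteq> E"
  shows "subset_expect p E (\<lambda>G. of_bool (card (G \<inter> S) = k)) = binom_prob p (card S) k"
proof -
  have "subset_expect p E (\<lambda>G. of_bool (card (G \<inter> S) = k)) =
      (\<Sum>j\<le>card S. if j = k then binom_prob p (card S) j else 0)"
    using subset_expect_card_eq[OF assms, of p "\<lambda>j. of_bool (j = k)"]
    by (simp add: of_bool_def if_distrib cong: if_cong)
  then show ?thesis by (simp add: binom_prob_def binomial_eq_0)
qed

lemma subset_expect_card_indep:
  assumes "finite E" "S \<inter> T = {}"
  shows "subset_expect p E (\<lambda>G. \<phi> (card (G \<inter> S)) * \<psi> (card (G \<inter> T))) =
    subset_expect p E (\<lambda>G. \<phi> (card (G \<inter> S))) * subset_expect p E (\<lambda>G. \<psi> (card (G \<inter> T)))"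
proof (rule subset_expect_mult_indep[OF assms(1), where A = S])
  fix G
  have "(G - S) \<inter> T = G \<inter> T" using assms by auto
  then show "\<psi> (card (G \<inter> T)) = \<psi> (card ((G - S) \<inter> T))" by simp
qed (simp add: Int_assoc)

text \<open>The map from edge indicators to edge sets is injective on the support, because
  indicators take the default \<open>False\<close> outside \<open>E\<close>; so each subset inherits
  the product weight of a single indicator function.\<close>

lemma expectation_random_subset:
  fixes F :: "'a set \<Rightarrow> real"
  assumes "finite E" "0 < p" "p < 1"
  shows "measure_pmf.expectation
      (map_pmf (\<lambda>X. {e \<in> E. X e}) (Pi_pmf E False (\<lambda>_. bernoulli_pmf p))) F = subset_expect p E F"
proof -
  let ?Pi = "Pi_pmf E False (\<lambda>_. bernoulli_pmf p)"
  let ?h = "\<lambda>X. {e \<in> E. X e}"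
  have supp: "\<not> X e" if "X \<in> set_pmf ?Pi" "e \<notin> E" for X e
    using that assms(1) set_Pi_pmf_subset[of E False "\<lambda>_. bernoulli_pmf p"] by auto
  have inj: "inj_on ?h (set_pmf ?Pi)"
  proof (rule inj_onI)
    fix X Y assume "X \<in> set_pmf ?Pi" "Y \<in> set_pmf ?Pi" "?h X = ?h Y"
    then have "X e = Y e" for e by (cases "e \<in> E") (use supp[of X e] supp[of Y e] in blast)+
    then show "X = Y" by blast
  qed
  have pmf: "pmf (map_pmf ?h ?Pi) G = p ^ card G * (1 - p) ^ card (E - G)" if "G \<subseteq> E" for G
  proof -
    let ?X = "\<lambda>e. e \<in> G"
    have *: "pmf ?Pi ?X = p ^ card G * (1 - p) ^ card (E - G)"
    proof -
      have "pmf ?Pi ?X = (\<Prod>e\<in>E. if e \<in> G then p else 1 - p)"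
        using assms that by (subst pmf_Pi) (auto intro!: prod.cong)
      also have "\<dots> = p ^ card G * (1 - p) ^ card (E - G)"
        using assms that by (simp add: prod.If_cases Int_absorb1 Diff_eq)
      finally show ?thesis .
    qed
    then have "pmf ?Pi ?X > 0" using assms by simp
    then have "?X \<in> set_pmf ?Pi" by (simp add: set_pmf_iff)
    moreover have "?h ?X = G" using that by auto
    ultimately show ?thesis using pmf_map_inj[OF inj, of ?X] * by simp
  qed
  have "measure_pmf.expectation (map_pmf ?h ?Pi) F = (\<Sum>G\<in>Pow E. pmf (map_pmf ?h ?Pi) G *\<^sub>R F G)"
    using assms by (intro integral_measure_pmf) auto
  then show ?thesis by (simp add: subset_expect_def pmf)
qed

section \<open>The Stein equation of the discretized normal distribution\<close>

text \<open>Write \<open>f w - f (w - k)\<close> as \<open>k\<close> unit steps, each an average of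
  \<open>g\<close> at its ends plus an error. Replacing these values by \<open>g w\<close> leaves
  terms \<open>g (w - j) - g w\<close>, and each of them is a unit difference in \<open>w\<close> of
  a partial sum of at most \<open>k\<close> values of \<open>g\<close>. Adding up \<open>k\<close>
  such partial sums gives a kernel of size \<open>k * k\<close>.\<close>

lemma telescoping_kernel:
  fixes f g :: "int \<Rightarrow> real"
  assumes g: "\<And>z. \<bar>g z\<bar> \<le> B" and \<sigma>: "1 \<le> \<sigma>" and b: "0 \<le> b"
    and r: "\<And>z. \<bar>f z - f (z - 1) - (g z + g (z - 1)) / 2\<bar> \<le> b * (1 + \<bar>of_int z - \<mu>\<bar> / \<sigma>)"
  obtains K :: "int \<Rightarrow> int \<Rightarrow> real"
  where "\<And>k w. \<bar>K k w\<bar> \<le> B * (of_int k)\<^sup>2"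
    "\<And>k w. \<bar>f w - f (w - k) - of_int k * g w - (K k w - K k (w - 1))\<bar>
        \<le> 2 * b * (of_int k)\<^sup>2 * (1 + \<bar>of_int w - \<mu>\<bar> / \<sigma>)"
proof -
  define r where "r z = f z - f (z - 1) - (g z + g (z - 1)) / 2" for z
  \<comment> \<open>\<open>S\<close> sums backwards from \<open>w\<close> and \<open>R\<close>
    forwards from \<open>w + 1\<close>; with these offsets the unit differences are
    \<open>g w - g (w - m)\<close> and \<open>g (w + m) - g w\<close>. \<open>P\<close> and
    \<open>N\<close> are the resulting kernels for nonnegative and negative
    \<open>k\<close>.\<close>
  define S where "S m w = (\<Sum>i<m. g (w - int i))" for m w
  define R where "R m w = (\<Sum>i<m. g (w + int i + 1))" for m w
  define P where "P m w = - (\<Sum>j<m. (S j w + S (Suc j) w) / 2)" for m w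
  define N where "N m w = - (\<Sum>j<m. (R j w + R (Suc j) w) / 2)" for m w
  have S: "S m w - S m (w - 1) = g w - g (w - int m)" for m w
    by (induction m) (simp_all add: S_def algebra_simps)
  have R: "R m w - R m (w - 1) = g (w + int m) - g w" for m w
    by (induction m) (simp_all add: R_def algebra_simps)
  have Sb: "\<bar>S m w\<bar> \<le> B * real m" for m w
    unfolding S_def using sum_norm_bound[of "{..<m}" "\<lambda>i. g (w - int i)" B] g by (simp add: mult.commute)
  have Rb: "\<bar>R m w\<bar> \<le> B * real m" for m w
    unfolding R_def using sum_norm_bound[of "{..<m}" "\<lambda>i. g (w + int i + 1)" B] g by (simp add: mult.commute)
  have B: "0 \<le> B" using g[of 0] by linarith
  have Pb: "\<bar>P m w\<bar> \<le> B * (real m)\<^sup>2" for m w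
  proof (induction m)
    case (Suc m)
    have "\<bar>P (Suc m) w\<bar> \<le> \<bar>P m w\<bar> + (\<bar>S m w\<bar> + \<bar>S (Suc m) w\<bar>) / 2"
    proof -
      have "P (Suc m) w = P m w - (S m w + S (Suc m) w) / 2" by (simp add: P_def)
      then have "\<bar>P (Suc m) w\<bar> \<le> \<bar>P m w\<bar> + \<bar>(S m w + S (Suc m) w) / 2\<bar>"
        by (simp only: abs_triangle_ineq4)
      also have "\<dots> \<le> \<bar>P m w\<bar> + (\<bar>S m w\<bar> + \<bar>S (Suc m) w\<bar>) / 2"
        by (simp add: abs_triangle_ineq divide_right_mono)
      finally show ?thesis .
    qed
    also have "\<dots> \<le> B * (real m)\<^sup>2 + (B * real m + B * real (Suc m)) / 2"
      by (intro add_mono divide_right_mono Suc Sb) simp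
    also have "\<dots> = B * ((real m)\<^sup>2 + real m + 1/2)" by (simp add: algebra_simps)
    also have "\<dots> \<le> B * (real (Suc m))\<^sup>2"
      by (intro mult_left_mono B) (simp add: power2_eq_square algebra_simps)
    finally show ?case .
  qed (simp add: P_def)
  have Nb: "\<bar>N m w\<bar> \<le> B * (real m)\<^sup>2" for m w
  proof (induction m)
    case (Suc m)
    have "\<bar>N (Suc m) w\<bar> \<le> \<bar>N m w\<bar> + (\<bar>R m w\<bar> + \<bar>R (Suc m) w\<bar>) / 2"
    proof -
      have "N (Suc m) w = N m w - (R m w + R (Suc m) w) / 2" by (simp add: N_def)
      then have "\<bar>N (Suc m) w\<bar> \<le> \<bar>N m w\<bar> + \<bar>(R m w + R (Suc m) w) / 2\<bar>"
        by (simp only: abs_triangle_ineq4)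
      also have "\<dots> \<le> \<bar>N m w\<bar> + (\<bar>R m w\<bar> + \<bar>R (Suc m) w\<bar>) / 2"
        by (simp add: abs_triangle_ineq divide_right_mono)
      finally show ?thesis .
    qed
    also have "\<dots> \<le> B * (real m)\<^sup>2 + (B * real m + B * real (Suc m)) / 2"
      by (intro add_mono divide_right_mono Suc Rb) simp
    also have "\<dots> = B * ((real m)\<^sup>2 + real m + 1/2)" by (simp add: algebra_simps)
    also have "\<dots> \<le> B * (real (Suc m))\<^sup>2"
      by (intro mult_left_mono B) (simp add: power2_eq_square algebra_simps)
    finally show ?case .
  qed (simp add: N_def)
  have P: "f w - f (w - int m) - real m * g w = P m w - P m (w - 1) + (\<Sum>j<m. r (w - int j))" for m w
  proof (induction m)
    case (Suc m)
    have "P (Suc m) w - P (Suc m) (w - 1) = P m w - P m (w - 1)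
        - ((S m w - S m (w - 1)) + (S (Suc m) w - S (Suc m) (w - 1))) / 2"
      unfolding P_def by (simp add: field_simps)
    also have "\<dots> = P m w - P m (w - 1) - (2 * g w - g (w - int m) - g (w - int (Suc m))) / 2"
      unfolding S by simp
    finally show ?case using Suc by (simp add: r_def algebra_simps) (simp add: field_simps)
  qed (simp add: P_def)
  have N: "f w - f (w + int m) + real m * g w = N m w - N m (w - 1) - (\<Sum>j<m. r (w + int j + 1))" for m w
  proof (induction m)
    case (Suc m)
    have "N (Suc m) w - N (Suc m) (w - 1) = N m w - N m (w - 1)
        - ((R m w - R m (w - 1)) + (R (Suc m) w - R (Suc m) (w - 1))) / 2"
      unfolding N_def by (simp add: field_simps)
    also have "\<dots> = N m w - N m (w - 1) - (g (w + int m) + g (w + int (Suc m)) - 2 * g w) / 2"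
      unfolding R by simp
    finally show ?case using Suc by (simp add: r_def algebra_simps) (simp add: field_simps)
  qed (simp add: N_def)
  define a where "a w = \<bar>of_int w - \<mu>\<bar> / \<sigma>" for w :: int
  have a: "0 \<le> a w" for w using \<sigma> by (simp add: a_def)
  \<comment> \<open>Moving the argument by at most \<open>m\<close> changes its standardised
    distance from \<open>\<mu>\<close> by at most \<open>m\<close>, as \<open>\<sigma>\<close> is at
    least 1.\<close>
  have rb: "\<bar>r (w + i)\<bar> \<le> b * (1 + a w + real m)" if "\<bar>of_int i\<bar> \<le> real m" for w i m
  proof -
    have "\<bar>of_int (w + i) - \<mu>\<bar> / \<sigma> \<le> (\<bar>of_int w - \<mu>\<bar> + real m) / \<sigma>"
      using \<sigma> that by (intro divide_right_mono) auto
    also have "\<dots> \<le> a w + real m"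
      using \<sigma> by (simp add: a_def add_divide_distrib divide_le_eq mult_le_cancel_left1)
    finally have "b * (1 + \<bar>of_int (w + i) - \<mu>\<bar> / \<sigma>) \<le> b * (1 + a w + real m)"
      by (intro mult_left_mono b) simp
    then show ?thesis using r[of "w + i"] unfolding r_def by linarith
  qed
  have tot: "real m * (b * (1 + a w + real m)) \<le> 2 * b * (real m)\<^sup>2 * (1 + a w)" for m w
  proof (cases "m = 0")
    case False
    then have "1 \<le> real m" by simp
    have "1 + a w + real m \<le> real m * (1 + a w) + real m * (1 + a w)"
    proof -
      have "1 * (1 + a w) \<le> real m * (1 + a w)"
        using \<open>1 \<le> real m\<close> a[of w] by (intro mult_right_mono) auto
      moreover have "real m * 1 \<le> real m * (1 + a w)"
        using a[of w] by (intro mult_left_mono) auto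
      ultimately show ?thesis by simp
    qed
    then have "real m * b * (1 + a w + real m) \<le> real m * b * (2 * real m * (1 + a w))"
      using b by (intro mult_left_mono) auto
    then show ?thesis by (simp add: power2_eq_square algebra_simps)
  qed simp
  define K where "K k w = (if 0 \<le> k then P (nat k) w else N (nat (- k)) w)" for k w
  show thesis
  proof
    fix k w
    show "\<bar>K k w\<bar> \<le> B * (of_int k)\<^sup>2"
      using Pb[of "nat k" w] Nb[of "nat (- k)" w] by (cases "0 \<le> k") (simp_all add: K_def)
    show "\<bar>f w - f (w - k) - of_int k * g w - (K k w - K k (w - 1))\<bar>
        \<le> 2 * b * (of_int k)\<^sup>2 * (1 + \<bar>of_int w - \<mu>\<bar> / \<sigma>)"
    proof (cases "0 \<le> k")
      case True
      define m where "m = nat k"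
      have k: "k = int m" using True by (simp add: m_def)
      have "\<bar>\<Sum>j<m. r (w - int j)\<bar> \<le> real m * (b * (1 + a w + real m))"
        using sum_norm_bound[of "{..<m}" "\<lambda>j. r (w - int j)" "b * (1 + a w + real m)"]
          rb[of "- int _" m w] by simp
      then show ?thesis
        using P[of w m] tot[of m w] by (simp add: K_def k a_def)
    next
      case False
      define m where "m = nat (- k)"
      have k: "k = - int m" "m \<noteq> 0" using False by (simp_all add: m_def)
      have "\<bar>\<Sum>j<m. r (w + int j + 1)\<bar> \<le> real m * (b * (1 + a w + real m))"
        using sum_norm_bound[of "{..<m}" "\<lambda>j. r (w + int j + 1)" "b * (1 + a w + real m)"]
          rb[of "int _ + 1" m w] by (simp add: add.assoc)
      then show ?thesis
        using N[of w m] tot[of m w] k(2) by (simp add: K_def k(1) a_def)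
    qed
  qed
qed

section \<open>The Gaussian weight, its tails, and the Stein equation for a bounded test
  function\<close>

definition gweight :: "real \<Rightarrow> real" where "gweight t = exp (- t\<^sup>2 / 2)"

lemma gweight_pos [simp]: "0 < gweight t"
  and gweight_nonneg [simp]: "0 \<le> gweight t"
  and gweight_uminus: "gweight (- t) = gweight t"
  by (simp_all add: gweight_def)

lemma continuous_gweight: "isCont gweight t"
  unfolding gweight_def by (intro continuous_intros) simp

lemma borel_measurable_gweight [measurable]: "gweight \<in> borel_measurable borel"
  unfolding gweight_def by measurable

lemma gweight_eq: "gweight t = sqrt (2 * pi) * std_normal_density t"
  by (simp add: gweight_def std_normal_density_def)

lemma integrable_gweight: "integrable lborel gweight"
  unfolding gweight_eq[abs_def] by auto

lemma integral_gweight: "(\<integral>t. gweight t \<partial>lborel) = sqrt (2 * pi)"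
  unfolding gweight_eq by (simp add: integral_normal_density)

lemma integrable_mult_gweight:
  assumes [measurable]: "H \<in> borel_measurable borel" and "\<And>t. \<bar>H t\<bar> \<le> B"
  shows "integrable lborel (\<lambda>t. H t * gweight t)"
proof (rule Bochner_Integration.integrable_bound)
  show "integrable lborel (\<lambda>t. B * gweight t)" using integrable_gweight by simp
  have "0 \<le> B" using assms(2)[of 0] by linarith
  then show "AE t in lborel. norm (H t * gweight t) \<le> norm (B * gweight t)"
    using assms(2) by (auto simp: abs_mult intro!: mult_right_mono)
qed simp

definition gtail :: "real \<Rightarrow> real" where
  "gtail a = (\<integral>t. indicator {a..} t * gweight t \<partial>lborel)"

lemma integrable_gtail: "integrable lborel (\<lambda>t. indicator {a..} t * gweight t)"
  by (rule integrable_mult_gweight[of _ 1]) auto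

lemma gtail_uminus: "(\<integral>t. indicator {..<a} t * gweight t \<partial>lborel) \<le> gtail (- a)"
proof -
  have "(\<integral>t. indicator {..<a} t * gweight t \<partial>lborel) =
      (\<integral>t. indicator {..<a} (-t) * gweight (-t) \<partial>lborel)"
    using lborel_integral_real_affine[of "-1" "\<lambda>t. indicator {..<a} t * gweight t" 0] by simp
  also have "\<dots> \<le> gtail (- a)"
    unfolding gtail_def
    by (intro integral_mono integrable_mult_gweight[of _ 1, unfolded gweight_uminus])
      (auto simp: gweight_uminus indicator_def integrable_gtail intro!: integrable_mult_gweight[of _ 1])
  finally show ?thesis .
qed

text \<open>For \<open>t \<ge> a \<ge> 0\<close>, the difference of the squares of \<open>t\<close>
  and \<open>a\<close> is at least the square of \<open>t - a\<close>. The rescaled tail is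
  therefore dominated by a full Gaussian weight centred at \<open>a\<close>, of mass
  \<open>sqrt (2 * pi) \<le> 3\<close>.\<close>

lemma gtail_bound1:
  assumes "0 \<le> a" shows "exp (a\<^sup>2 / 2) * gtail a \<le> 3"
proof -
  have "exp (a\<^sup>2 / 2) * gtail a = (\<integral>t. exp (a\<^sup>2 / 2) * (indicator {a..} t * gweight t) \<partial>lborel)"
    unfolding gtail_def by simp
  also have "\<dots> \<le> (\<integral>t. gweight (- a + 1 * t) \<partial>lborel)"
  proof (rule integral_mono)
    show "integrable lborel (\<lambda>t. exp (a\<^sup>2 / 2) * (indicator {a..} t * gweight t))"
      using integrable_gtail by simp
    show "integrable lborel (\<lambda>t. gweight (- a + 1 * t))"
      by (rule lborel_integrable_real_affine[OF integrable_gweight]) simp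
    fix t
    show "exp (a\<^sup>2 / 2) * (indicator {a..} t * gweight t) \<le> gweight (- a + 1 * t)"
    proof (cases "a \<le> t")
      case True
      have "a\<^sup>2 - t\<^sup>2 \<le> - (t - a)\<^sup>2"
        using mult_right_mono[OF True assms] by (simp add: power2_eq_square algebra_simps)
      then show ?thesis using True
        by (simp add: gweight_def power2_eq_square algebra_simps flip: exp_add)
    qed simp
  qed
  also have "\<dots> = (\<integral>t. gweight t \<partial>lborel)"
    using lborel_integral_real_affine[of 1 gweight "- a"] by simp
  also have "\<dots> \<le> sqrt 9"
    unfolding integral_gweight using pi_less_4 by (intro real_sqrt_le_mono) simp
  finally show ?thesis by simp
qed

text \<open>The Mills ratio bound: on \<open>t \<ge> a\<close> the integrand
  \<open>a * gweight t\<close> is at most \<open>t * gweight t\<close>, which has the antiderivative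
  \<open>- gweight\<close>.\<close>

lemma gtail_bound2:
  assumes "0 \<le> a" shows "a * (exp (a\<^sup>2 / 2) * gtail a) \<le> 1"
proof -
  have "(\<integral>\<^sup>+t. ennreal (t * gweight t) * indicator {a..} t \<partial>lborel) = ennreal (0 - (- gweight a))"
  proof (rule nn_integral_FTC_atLeast)
    show "DERIV (\<lambda>t. - gweight t) t :> t * gweight t" for t
      unfolding gweight_def by (auto intro!: derivative_eq_intros)
    show "((\<lambda>t. - gweight t) \<longlongrightarrow> 0) at_top"
      unfolding gweight_def by real_asymp
  qed (use assms in auto)
  moreover have "(\<integral>\<^sup>+t. ennreal (indicator {a..} t * (t * gweight t)) \<partial>lborel) =
      (\<integral>\<^sup>+t. ennreal (t * gweight t) * indicator {a..} t \<partial>lborel)"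
    by (intro nn_integral_cong) (auto simp: indicator_def)
  ultimately have "has_bochner_integral lborel (\<lambda>t. indicator {a..} t * (t * gweight t)) (gweight a)"
    using assms by (intro has_bochner_integral_nn_integral) (auto simp: indicator_def)
  then have *: "integrable lborel (\<lambda>t. indicator {a..} t * (t * gweight t))"
    "(\<integral>t. indicator {a..} t * (t * gweight t) \<partial>lborel) = gweight a"
    by (auto simp: has_bochner_integral_iff)
  have "a * gtail a = (\<integral>t. a * (indicator {a..} t * gweight t) \<partial>lborel)"
    unfolding gtail_def by simp
  also have "\<dots> \<le> gweight a"
    unfolding *(2)[symmetric] using integrable_gtail *(1)
    by (intro integral_mono) (auto simp: indicator_def)
  finally have "exp (a\<^sup>2 / 2) * (a * gtail a) \<le> exp (a\<^sup>2 / 2) * gweight a"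
    by (intro mult_left_mono) auto
  then show ?thesis by (simp add: gweight_def mult.left_commute flip: exp_add)
qed

text \<open>The solution of \<open>F' y = y * F y + H y\<close> by the integrating factor
  \<open>gweight\<close>. Integrating from minus infinity keeps it bounded on the left; the
  vanishing Gaussian mean of \<open>H\<close> does so on the right.\<close>

definition stein_solution :: "(real \<Rightarrow> real) \<Rightarrow> real \<Rightarrow> real" where
  "stein_solution H y = exp (y\<^sup>2 / 2) * (\<integral>t. indicator {..<y} t * (H t * gweight t) \<partial>lborel)"

context
  fixes H :: "real \<Rightarrow> real"
  assumes H_meas [measurable]: "H \<in> borel_measurable borel"
    and H_le: "\<And>t. \<bar>H t\<bar> \<le> 1"
    and H_int: "(\<integral>t. H t * gweight t \<partial>lborel) = 0"
begin

lemma integrable_stein: "A \<in> sets borel \<Longrightarrow> integrable lborel (\<lambda>t. indicator A t * (H t * gweight t))"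
  using integrable_mult_gweight[of "\<lambda>t. indicator A t * H t" 1] H_le
  by (simp add: mult.assoc indicator_def)

text \<open>For \<open>y > 0\<close> the zero mean replaces the integral over \<open>{..<y}\<close>
  by minus the one over \<open>{y..}\<close>, so on either side only the tail beyond
  \<open>\<bar>y\<bar>\<close> is paid for.\<close>

lemma abs_stein_integral_le:
  "\<bar>\<integral>t. indicator {..<y} t * (H t * gweight t) \<partial>lborel\<bar> \<le> gtail \<bar>y\<bar>"
proof (cases "y \<le> 0")
  case True
  have "\<bar>\<integral>t. indicator {..<y} t * (H t * gweight t) \<partial>lborel\<bar>
      \<le> (\<integral>t. indicator {..<y} t * gweight t \<partial>lborel)"
  proof (rule integral_abs_bound_integral)
    show "integrable lborel (\<lambda>t. indicator {..<y} t * (H t * gweight t))"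
      by (rule integrable_stein) simp
    show "integrable lborel (\<lambda>t. indicator {..<y} t * gweight t)"
      by (rule integrable_mult_gweight[of _ 1]) auto
    show "\<bar>indicator {..<y} t * (H t * gweight t)\<bar> \<le> indicator {..<y} t * gweight t" for t
      using mult_right_mono[OF H_le[of t] gweight_nonneg[of t]] by (auto simp: abs_mult indicator_def)
  qed
  then show ?thesis using True gtail_uminus[of y] by simp
next
  case False
  have "(\<integral>t. indicator {..<y} t * (H t * gweight t) \<partial>lborel) +
      (\<integral>t. indicator {y..} t * (H t * gweight t) \<partial>lborel) =
      (\<integral>t. indicator {..<y} t * (H t * gweight t) + indicator {y..} t * (H t * gweight t) \<partial>lborel)"
    by (rule Bochner_Integration.integral_add[symmetric]) (auto intro: integrable_stein)
  also have "\<dots> = (\<integral>t. H t * gweight t \<partial>lborel)"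
    by (intro Bochner_Integration.integral_cong) (auto simp: indicator_def)
  finally have "\<bar>\<integral>t. indicator {..<y} t * (H t * gweight t) \<partial>lborel\<bar> =
      \<bar>\<integral>t. indicator {y..} t * (H t * gweight t) \<partial>lborel\<bar>"
    unfolding H_int by linarith
  also have "\<dots> \<le> gtail y"
    unfolding gtail_def
  proof (rule integral_abs_bound_integral)
    show "integrable lborel (\<lambda>t. indicator {y..} t * (H t * gweight t))"
      by (rule integrable_stein) simp
    show "integrable lborel (\<lambda>t. indicator {y..} t * gweight t)"
      by (rule integrable_mult_gweight[of _ 1]) auto
    show "\<bar>indicator {y..} t * (H t * gweight t)\<bar> \<le> indicator {y..} t * gweight t" for t
      using mult_right_mono[OF H_le[of t] gweight_nonneg[of t]] by (auto simp: abs_mult indicator_def)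
  qed
  finally show ?thesis using False by simp
qed

lemma abs_stein_solution_le: "\<bar>stein_solution H y\<bar> \<le> 3"
proof -
  have "\<bar>stein_solution H y\<bar> \<le> exp (\<bar>y\<bar>\<^sup>2 / 2) * gtail \<bar>y\<bar>"
    unfolding stein_solution_def abs_mult using abs_stein_integral_le
    by (simp add: mult_left_mono)
  then show ?thesis using gtail_bound1[of "\<bar>y\<bar>"] by simp
qed

lemma abs_mult_stein_solution_le: "\<bar>y * stein_solution H y\<bar> \<le> 1"
proof -
  have "\<bar>y * stein_solution H y\<bar> \<le> \<bar>y\<bar> * (exp (\<bar>y\<bar>\<^sup>2 / 2) * gtail \<bar>y\<bar>)"
    unfolding stein_solution_def abs_mult using abs_stein_integral_le
    by (simp add: mult_left_mono)
  then show ?thesis using gtail_bound2[of "\<bar>y\<bar>"] by simp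
qed

text \<open>\<open>H\<close> is only piecewise constant, so the differential equation is claimed
  strictly inside an interval of constancy and continuity up to its ends. On \<open>{a..b}\<close>
  the solution agrees with an everywhere differentiable function built from an antiderivative of
  \<open>gweight\<close>.\<close>

lemma stein_solution_DERIV:
  assumes "a < b" and c: "\<And>t. a \<le> t \<Longrightarrow> t < b \<Longrightarrow> H t = c"
  shows "continuous_on {a..b} (stein_solution H)"
    and "\<And>y. a < y \<Longrightarrow> y < b \<Longrightarrow> DERIV (stein_solution H) y :> y * stein_solution H y + c"
proof -
  obtain Q where Q: "(Q has_vector_derivative gweight x) (at x)" for x
    using einterval_antiderivative[of "-\<infinity>" "\<infinity>" gweight] continuous_gweight by auto
  define J where "J y = (\<integral>t. indicator {..<y} t * (H t * gweight t) \<partial>lborel)" for y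
  have J: "J y = J a + c * (Q y - Q a)" if "a \<le> y" "y \<le> b" for y
  proof -
    have "J y - J a = (\<integral>t. indicator {..<y} t * (H t * gweight t) - indicator {..<a} t * (H t * gweight t) \<partial>lborel)"
      unfolding J_def by (rule Bochner_Integration.integral_diff[symmetric]) (auto intro: integrable_stein)
    also have "\<dots> = (\<integral>t. c * (indicator {a..<y} t * gweight t) \<partial>lborel)"
      using that by (intro Bochner_Integration.integral_cong) (auto simp: indicator_def c)
    also have "\<dots> = c * (LBINT t:{a..<y}. gweight t)"
      by (simp add: set_lebesgue_integral_def)
    also have "(LBINT t:{a..<y}. gweight t) = (LBINT t=a..y. gweight t)"
      using that by (simp add: interval_integral_Ico)
    also have "\<dots> = Q y - Q a"
      by (rule interval_integral_FTC_finite)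
        (auto intro: continuous_at_imp_continuous_on continuous_gweight has_vector_derivative_at_within Q)
    finally show ?thesis by simp
  qed
  define F where "F y = exp (y\<^sup>2 / 2) * (J a + c * (Q y - Q a))" for y
  have FF: "stein_solution H y = F y" if "a \<le> y" "y \<le> b" for y
    unfolding stein_solution_def F_def J_def[symmetric] using J[OF that] by simp
  have QD: "(Q has_field_derivative gweight y) (at y)" for y
    using Q[of y] by (simp add: has_real_derivative_iff_has_vector_derivative)
  have F: "DERIV F y :> y * F y + c" for y
  proof -
    have "DERIV (\<lambda>y. exp (y\<^sup>2 / 2)) y :> y * exp (y\<^sup>2 / 2)"
      by (auto intro!: derivative_eq_intros)
    moreover have "DERIV (\<lambda>y. J a + c * (Q y - Q a)) y :> c * gweight y"
      using DERIV_add[OF DERIV_const DERIV_cmult[OF DERIV_diff[OF QD DERIV_const]]] by simp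
    ultimately have D: "DERIV F y :> y * exp (y\<^sup>2 / 2) * (J a + c * (Q y - Q a))
        + c * gweight y * exp (y\<^sup>2 / 2)"
      unfolding F_def by (rule DERIV_mult)
    have "gweight y * exp (y\<^sup>2 / 2) = 1"
      by (simp add: gweight_def flip: exp_add)
    then have "c * gweight y * exp (y\<^sup>2 / 2) = c" by (simp only: mult.assoc mult_1_right)
    then show ?thesis using D by (simp only: F_def mult.assoc)
  qed
  show "continuous_on {a..b} (stein_solution H)"
    using FF DERIV_isCont[OF F] by (subst continuous_on_cong[of _ _ _ F])
      (auto intro!: continuous_at_imp_continuous_on)
  fix y assume y: "a < y" "y < b"
  have "eventually (\<lambda>x. x \<in> {a<..<b}) (nhds y)" using y by (intro eventually_nhds_in_open) auto
  then have "eventually (\<lambda>x. stein_solution H x = F x) (nhds y)"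
    by eventually_elim (auto intro: FF)
  then have "(DERIV (stein_solution H) y :> y * F y + c) \<longleftrightarrow> (DERIV F y :> y * F y + c)"
    by (intro DERIV_cong_ev) auto
  then show "DERIV (stein_solution H) y :> y * stein_solution H y + c"
    using F[of y] FF[of y] y by simp
qed

lemma stein_derivative_bound: "\<bar>y * stein_solution H y + H z\<bar> \<le> 2"
  using abs_mult_stein_solution_le[of y] H_le[of z] by linarith

lemma stein_solution_MVT:
  assumes "a \<le> y" "y < x" "x \<le> b" and c: "\<And>t. a \<le> t \<Longrightarrow> t < b \<Longrightarrow> H t = c"
  obtains z where "y < z" "z < x"
    "stein_solution H x - stein_solution H y = (x - y) * (z * stein_solution H z + c)"
proof -
  let ?F = "stein_solution H"
  have "a < b" using assms by linarith
  note D = stein_solution_DERIV[OF this c]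
  have "\<exists>l z. y < z \<and> z < x \<and> DERIV ?F z :> l \<and> ?F x - ?F y = (x - y) * l"
  proof (rule MVT[OF \<open>y < x\<close>])
    show "continuous_on {y..x} ?F"
      by (rule continuous_on_subset[OF D(1)]) (use assms in auto)
    show "?F differentiable (at z)" if "y < z" "z < x" for z
      using D(2)[of z] that assms(1,3) unfolding real_differentiable_def by auto
  qed
  then obtain l z where z: "y < z" "z < x" "DERIV ?F z :> l" "?F x - ?F y = (x - y) * l" by blast
  have "a < z" "z < b" using z(1,2) assms(1-3) by linarith+
  then have "l = z * ?F z + c" using DERIV_unique[OF z(3) D(2)] by blast
  then show thesis using z by (intro that[of z]) simp_all
qed

lemma stein_solution_lipschitz:
  assumes "a \<le> y" "y \<le> x" "x \<le> b" and c: "\<And>t. a \<le> t \<Longrightarrow> t < b \<Longrightarrow> H t = c"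
  shows "\<bar>stein_solution H x - stein_solution H y\<bar> \<le> 2 * (x - y)"
proof (cases "y = x")
  case False
  then have "y < x" using assms by simp
  obtain z where z: "y < z" "z < x"
    "stein_solution H x - stein_solution H y = (x - y) * (z * stein_solution H z + c)"
    by (rule stein_solution_MVT[OF assms(1) \<open>y < x\<close> assms(3) c])
  have "c = H a" using c[of a] assms(1,3) \<open>y < x\<close> by simp
  then have "\<bar>z * stein_solution H z + c\<bar> \<le> 2" using stein_derivative_bound by simp
  then have "\<bar>(x - y) * (z * stein_solution H z + c)\<bar> \<le> (x - y) * 2"
    unfolding abs_mult using \<open>y < x\<close> by (intro mult_mono) auto
  then show ?thesis using z by simp
qed simp

text \<open>By the mean value theorem the increment is \<open>x - y\<close> times the derivative at
  some \<open>z\<close>. On an interval where \<open>H\<close> is the constant \<open>c\<close>,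
  replacing \<open>z\<close> by \<open>u\<close> only changes \<open>z * F z\<close>. The constants
  3 and 2 are the sup bound and the Lipschitz bound of \<open>F\<close>.\<close>

lemma stein_solution_half_step:
  assumes "a \<le> y" "y < x" "x \<le> b" and c: "\<And>t. a \<le> t \<Longrightarrow> t < b \<Longrightarrow> H t = c"
    and u: "y \<le> u" "u \<le> x"
  shows "\<bar>stein_solution H x - stein_solution H y - (x - y) * (u * stein_solution H u + c)\<bar>
    \<le> (x - y)\<^sup>2 * (3 + 2 * \<bar>u\<bar>)"
proof -
  let ?F = "stein_solution H"
  obtain z where z: "y < z" "z < x" "?F x - ?F y = (x - y) * (z * ?F z + c)"
    by (rule stein_solution_MVT[OF assms(1-3) c])
  have zu: "\<bar>z - u\<bar> \<le> x - y" using z u by linarith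
  have "\<bar>?F z - ?F u\<bar> \<le> 2 * \<bar>z - u\<bar>"
    using stein_solution_lipschitz[of a z u b c] stein_solution_lipschitz[of a u z b c] c assms z
    by (cases "z \<le> u") (auto simp: abs_minus_commute)
  then have "\<bar>u\<bar> * \<bar>?F z - ?F u\<bar> \<le> \<bar>u\<bar> * (2 * (x - y))"
    using zu by (intro mult_left_mono) auto
  moreover have "\<bar>z - u\<bar> * \<bar>?F z\<bar> \<le> (x - y) * 3"
    using zu abs_stein_solution_le by (intro mult_mono) auto
  moreover have "z * ?F z - u * ?F u = (z - u) * ?F z + u * (?F z - ?F u)"
    by (simp add: algebra_simps)
  moreover have "\<bar>(z - u) * ?F z + u * (?F z - ?F u)\<bar> \<le> \<bar>z - u\<bar> * \<bar>?F z\<bar> + \<bar>u\<bar> * \<bar>?F z - ?F u\<bar>"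
    by (simp only: abs_triangle_ineq flip: abs_mult)
  ultimately have "\<bar>z * ?F z - u * ?F u\<bar> \<le> (x - y) * 3 + \<bar>u\<bar> * (2 * (x - y))"
    by linarith
  then have "(x - y) * \<bar>z * ?F z - u * ?F u\<bar> \<le> (x - y) * ((x - y) * 3 + \<bar>u\<bar> * (2 * (x - y)))"
    using \<open>y < x\<close> by (intro mult_left_mono) auto
  also have "\<dots> = (x - y)\<^sup>2 * (3 + 2 * \<bar>u\<bar>)" by (simp add: power2_eq_square algebra_simps)
  finally have "\<bar>(x - y) * (z * ?F z - u * ?F u)\<bar> \<le> (x - y)\<^sup>2 * (3 + 2 * \<bar>u\<bar>)"
    using \<open>y < x\<close> by (simp add: abs_mult)
  moreover have "?F x - ?F y - (x - y) * (u * ?F u + c) = (x - y) * (z * ?F z - u * ?F u)"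
    unfolding z(3) by (simp add: algebra_simps)
  ultimately show ?thesis by simp
qed

end

text \<open>The atoms are the normal masses of disjoint unit intervals, so \<open>A\<close> receives
  the mass of all points that round into \<open>A\<close>. The substitution
  \<open>x = \<mu> + \<sigma> * t\<close> then standardises the normal law.\<close>

lemma prob_discretized_normal:
  assumes "0 < \<sigma>"
  shows "measure (measure_pmf (discretized_normal \<mu> (\<sigma>\<^sup>2))) A =
    (\<integral>t. indicator {t. \<lfloor>\<mu> + \<sigma> * t + 1/2\<rfloor> \<in> A} t * gweight t \<partial>lborel) / sqrt (2 * pi)"
proof -
  let ?D = "discretized_normal \<mu> (\<sigma>\<^sup>2)" and ?N = "gaussian \<mu> (\<sigma>\<^sup>2)"
  let ?I = "\<lambda>z::int. {real_of_int z - 1/2 ..< real_of_int z + 1/2}"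
  let ?C = "{t. \<lfloor>\<mu> + \<sigma> * t + 1/2\<rfloor> \<in> A}"
  interpret prob_space ?N by (rule prob_space_gaussian) simp
  have mem: "x \<in> ?I z \<longleftrightarrow> z = \<lfloor>x + 1/2\<rfloor>" for x z
    by (simp add: eq_commute[of z] floor_eq_iff) linarith
  have [measurable]: "(\<lambda>x::real. indicator A \<lfloor>x\<rfloor> :: real) \<in> borel_measurable borel"
    by (rule measurable_compose[OF measurable_real_floor]) simp
  have "emeasure (measure_pmf ?D) A = (\<integral>\<^sup>+z. pmf ?D z \<partial>count_space A)"
    by (simp add: nn_integral_pmf)
  also have "\<dots> = (\<integral>\<^sup>+z. emeasure ?N (?I z) \<partial>count_space A)"
    by (simp add: pmf_discretized_normal emeasure_eq_measure)
  also have "\<dots> = emeasure ?N (\<Union>z\<in>A. ?I z)"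
    by (rule emeasure_UN_countable[symmetric])
       (auto simp: disjoint_family_on_def mem simp del: atLeastLessThan_iff)
  also have "(\<Union>z\<in>A. ?I z) = {x. \<lfloor>x + 1/2\<rfloor> \<in> A}"
    by (auto simp: mem simp del: atLeastLessThan_iff)
  also have "emeasure ?N \<dots> = (\<integral>\<^sup>+x. ennreal (normal_density \<mu> \<sigma> x) * indicator {x. \<lfloor>x + 1/2\<rfloor> \<in> A} x \<partial>lborel)"
    using assms by (simp add: gaussian_def emeasure_density)
  also have "\<dots> = (\<integral>\<^sup>+x. ennreal (normal_density \<mu> \<sigma> x * indicator A \<lfloor>x + 1/2\<rfloor>) \<partial>lborel)"
    by (intro nn_integral_cong) (auto simp: indicator_def)
  also have "\<dots> = ennreal \<sigma> * (\<integral>\<^sup>+t. ennreal (normal_density \<mu> \<sigma> (\<mu> + \<sigma> * t) * indicator A \<lfloor>\<mu> + \<sigma> * t + 1/2\<rfloor>) \<partial>lborel)"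
    using assms nn_integral_real_affine[of "\<lambda>x. ennreal (normal_density \<mu> \<sigma> x * indicator A \<lfloor>x + 1/2\<rfloor>)" \<sigma> \<mu>]
    by simp
  also have "\<dots> = (\<integral>\<^sup>+t. ennreal (indicator ?C t * gweight t / sqrt (2 * pi)) \<partial>lborel)"
  proof (subst nn_integral_cmult[symmetric])
    have "\<sigma> * (normal_density \<mu> \<sigma> (\<mu> + \<sigma> * t) * indicator A \<lfloor>\<mu> + \<sigma> * t + 1/2\<rfloor>) =
        indicator ?C t * gweight t / sqrt (2 * pi)" for t
    proof -
      have "\<sigma> * normal_density \<mu> \<sigma> (\<mu> + \<sigma> * t) = gweight t / sqrt (2 * pi)"
        using assms by (simp add: gweight_def normal_density_def power_mult_distrib real_sqrt_mult)
      then show ?thesis by (simp add: indicator_def)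
    qed
    then show "(\<integral>\<^sup>+t. ennreal \<sigma> * ennreal (normal_density \<mu> \<sigma> (\<mu> + \<sigma> * t) * indicator A \<lfloor>\<mu> + \<sigma> * t + 1/2\<rfloor>) \<partial>lborel) =
        (\<integral>\<^sup>+t. ennreal (indicator ?C t * gweight t / sqrt (2 * pi)) \<partial>lborel)"
      using assms by (simp add: ennreal_mult'[symmetric])
  qed measurable
  also have "\<dots> = ennreal (\<integral>t. indicator ?C t * gweight t / sqrt (2 * pi) \<partial>lborel)"
  proof (rule nn_integral_eq_integral)
    have "(\<lambda>t. indicator A \<lfloor>\<mu> + \<sigma> * t + 1/2\<rfloor>) = (indicator ?C :: real \<Rightarrow> real)"
      by (auto simp: indicator_def)
    moreover have "(\<lambda>t. indicator A \<lfloor>\<mu> + \<sigma> * t + 1/2\<rfloor> :: real) \<in> borel_measurable borel" by measurable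
    ultimately have "(indicator ?C :: real \<Rightarrow> real) \<in> borel_measurable borel" by simp
    then have "integrable lborel (\<lambda>t. indicator ?C t * gweight t)"
      by (intro integrable_mult_gweight[of _ 1]) (auto simp: indicator_def)
    then show "integrable lborel (\<lambda>t. indicator ?C t * gweight t / sqrt (2 * pi))" by simp
  qed (auto simp: indicator_def)
  finally have "ennreal (measure (measure_pmf ?D) A) = \<dots>"
    by (simp add: measure_pmf.emeasure_eq_measure)
  then show ?thesis
    by (subst (asm) ennreal_inj) (auto intro!: integral_nonneg_AE simp: indicator_def)
qed

text \<open>The test function is constant on \<open>[z - 1/2, z + 1/2)\<close>, so \<open>f\<close> is smooth there; hence \<open>f z - f (z - 1)\<close>
  is compared with half of the derivative at either end.\<close>

lemma discretized_normal_Stein: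
  assumes \<sigma>: "1 \<le> \<sigma>"
  obtains f g :: "int \<Rightarrow> real"
  where "\<And>z. \<sigma>\<^sup>2 * g z - (of_int z - \<mu>) * f z =
      indicator A z - measure (measure_pmf (discretized_normal \<mu> (\<sigma>\<^sup>2))) A"
    and "\<And>z. \<bar>g z\<bar> \<le> 2 / \<sigma>\<^sup>2"
    and "\<And>z. \<bar>f z - f (z - 1) - (g z + g (z - 1)) / 2\<bar> \<le> 2 / \<sigma> ^ 3 * (1 + \<bar>of_int z - \<mu>\<bar> / \<sigma>)"
proof -
  define m where "m = measure (measure_pmf (discretized_normal \<mu> (\<sigma>\<^sup>2))) A"
  define C where "C = {t. \<lfloor>\<mu> + \<sigma> * t + 1/2\<rfloor> \<in> A}"
  define H where "H t = indicator C t - m" for t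
  have "0 < \<sigma>" using \<sigma> by simp
  have m: "0 \<le> m" "m \<le> 1" by (auto simp: m_def)
  have "C \<in> sets borel"
  proof -
    have "(\<lambda>t. \<lfloor>\<mu> + \<sigma> * t + 1/2\<rfloor>) -` A \<inter> space borel \<in> sets borel"
      by (rule measurable_sets[where A = "count_space UNIV"]) auto
    then show ?thesis by (simp add: C_def vimage_def)
  qed
  then have H_meas: "H \<in> borel_measurable borel" unfolding H_def[abs_def] by simp
  have H_le: "\<bar>H t\<bar> \<le> 1" for t using m by (auto simp: H_def indicator_def)
  have H_int: "(\<integral>t. H t * gweight t \<partial>lborel) = 0"
  proof -
    have "(\<integral>t. H t * gweight t \<partial>lborel) = (\<integral>t. indicator C t * gweight t - m * gweight t \<partial>lborel)"
      by (simp add: H_def algebra_simps)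
    also have "\<dots> = (\<integral>t. indicator C t * gweight t \<partial>lborel) - m * sqrt (2 * pi)"
      using integrable_mult_gweight[of "indicator C" 1] \<open>C \<in> sets borel\<close> integrable_gweight
      by (subst Bochner_Integration.integral_diff) (auto simp: integral_gweight indicator_def)
    also have "\<dots> = 0"
      unfolding m_def prob_discretized_normal[OF \<open>0 < \<sigma>\<close>] C_def[symmetric] by simp
    finally show ?thesis .
  qed
  note stein = H_meas H_le H_int
  define F where "F = stein_solution H"
  define Y where "Y z = (of_int z - \<mu>) / \<sigma>" for z :: int
  define D where "D y = y * F y + H y" for y
  define h where "h = 1 / \<sigma>"
  have h: "0 < h" "h \<le> 1" using \<sigma> by (auto simp: h_def)
  have HY: "H t = H (Y z)" if "Y z - h / 2 \<le> t" "t < Y z + h / 2" for t z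
  proof -
    have "of_int z - 1/2 \<le> \<mu> + \<sigma> * t" "\<mu> + \<sigma> * t < of_int z + 1/2"
    proof -
      have "Y z - h / 2 = (of_int z - \<mu> - 1/2) / \<sigma>" "Y z + h / 2 = (of_int z - \<mu> + 1/2) / \<sigma>"
        by (simp_all add: Y_def h_def diff_divide_distrib add_divide_distrib)
      then show "of_int z - 1/2 \<le> \<mu> + \<sigma> * t" "\<mu> + \<sigma> * t < of_int z + 1/2"
        using that \<open>0 < \<sigma>\<close> by (simp_all add: pos_divide_le_eq pos_less_divide_eq mult.commute)
    qed
    then have "\<lfloor>\<mu> + \<sigma> * t + 1/2\<rfloor> = z" by (simp add: floor_eq_iff)
    moreover have "\<lfloor>\<mu> + \<sigma> * Y z + 1/2\<rfloor> = z" using \<open>0 < \<sigma>\<close> by (simp add: Y_def floor_eq_iff)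
    ultimately show ?thesis by (auto simp: H_def C_def indicator_def)
  qed
  have Y1: "Y (z - 1) = Y z - h" for z by (simp add: Y_def h_def diff_divide_distrib)
  \<comment> \<open>The step of length \<open>h\<close> is cut at its midpoint, the image of
    \<open>z - 1/2\<close>, which is the only place inside it where \<open>H\<close> can jump. Each
    half is expanded about its own integer end.\<close>
  have step: "\<bar>F (Y z) - F (Y z - h) - h / 2 * (D (Y z) + D (Y z - h))\<bar> \<le> 2 * h\<^sup>2 * (1 + \<bar>Y z\<bar>)" for z
  proof -
    let ?y = "Y z"
    have 1: "\<bar>F ?y - F (?y - h/2) - h/2 * D ?y\<bar> \<le> (h/2)\<^sup>2 * (3 + 2 * \<bar>?y\<bar>)"
    proof -
      have "\<bar>F ?y - F (?y - h/2) - (?y - (?y - h/2)) * (?y * F ?y + H ?y)\<bar>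
          \<le> (?y - (?y - h/2))\<^sup>2 * (3 + 2 * \<bar>?y\<bar>)"
        unfolding F_def
        by (rule stein_solution_half_step[OF stein _ _ _ HY]) (use h in auto)
      then show ?thesis by (simp add: D_def)
    qed
    have 2: "\<bar>F (?y - h/2) - F (?y - h) - h/2 * D (?y - h)\<bar> \<le> (h/2)\<^sup>2 * (3 + 2 * \<bar>?y - h\<bar>)"
    proof -
      have "\<bar>F (Y (z - 1) + h/2) - F (Y (z - 1)) - (Y (z - 1) + h/2 - Y (z - 1)) * (Y (z - 1) * F (Y (z - 1)) + H (Y (z - 1)))\<bar>
          \<le> (Y (z - 1) + h/2 - Y (z - 1))\<^sup>2 * (3 + 2 * \<bar>Y (z - 1)\<bar>)"
        unfolding F_def
        by (rule stein_solution_half_step[OF stein _ _ _ HY]) (use h in auto)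
      moreover have "Y (z - 1) + h/2 = ?y - h/2" by (simp add: Y1)
      moreover have "Y (z - 1) + h/2 - Y (z - 1) = h/2" by simp
      ultimately show ?thesis by (simp only: Y1 D_def)
    qed
    have "F ?y - F (?y - h) - h/2 * (D ?y + D (?y - h)) =
        (F ?y - F (?y - h/2) - h/2 * D ?y) + (F (?y - h/2) - F (?y - h) - h/2 * D (?y - h))"
      by (simp add: algebra_simps)
    also have "\<bar>\<dots>\<bar> \<le> (h/2)\<^sup>2 * (3 + 2 * \<bar>?y\<bar>) + (h/2)\<^sup>2 * (3 + 2 * \<bar>?y - h\<bar>)"
      using 1 2 by linarith
    also have "\<dots> = (h/2)\<^sup>2 * (6 + 2 * \<bar>?y\<bar> + 2 * \<bar>?y - h\<bar>)" by (simp add: algebra_simps)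
    also have "\<dots> \<le> (h/2)\<^sup>2 * (8 * (1 + \<bar>?y\<bar>))"
    proof (rule mult_left_mono)
      have "\<bar>?y - h\<bar> \<le> \<bar>?y\<bar> + h" using h abs_triangle_ineq4[of ?y h] by simp
      then show "6 + 2 * \<bar>?y\<bar> + 2 * \<bar>?y - h\<bar> \<le> 8 * (1 + \<bar>?y\<bar>)" using h by argo
    qed simp
    also have "\<dots> = 2 * h\<^sup>2 * (1 + \<bar>?y\<bar>)" by (simp add: power2_eq_square)
    finally show ?thesis .
  qed
  \<comment> \<open>The scaling undoes the standardisation: \<open>f\<close> carries one factor
    \<open>1 / \<sigma>\<close> and its derivative \<open>g\<close> two, so that the left side of
    the integer equation equals \<open>D (Y z) - Y z * F (Y z)\<close>, which is
    \<open>H (Y z)\<close>.\<close>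
  define f where "f z = F (Y z) / \<sigma>" for z
  define g where "g z = D (Y z) / \<sigma>\<^sup>2" for z
  show thesis
  proof
    fix z
    have "\<lfloor>\<mu> + \<sigma> * Y z + 1/2\<rfloor> = z" using \<open>0 < \<sigma>\<close> by (simp add: Y_def floor_eq_iff)
    then have "H (Y z) = indicator A z - m" by (simp add: H_def C_def indicator_def)
    moreover have "\<sigma>\<^sup>2 * g z - (of_int z - \<mu>) * f z = D (Y z) - Y z * F (Y z)"
      using \<open>0 < \<sigma>\<close> by (simp add: g_def f_def Y_def)
    ultimately show "\<sigma>\<^sup>2 * g z - (of_int z - \<mu>) * f z =
        indicator A z - measure (measure_pmf (discretized_normal \<mu> (\<sigma>\<^sup>2))) A"
      by (simp add: D_def m_def)
    show "\<bar>g z\<bar> \<le> 2 / \<sigma>\<^sup>2"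
      using stein_derivative_bound[OF stein, of "Y z" "Y z"] \<open>0 < \<sigma>\<close>
      by (simp add: g_def D_def F_def divide_right_mono)
    have "f z - f (z - 1) - (g z + g (z - 1)) / 2 =
        1 / \<sigma> * (F (Y z) - F (Y z - h) - h / 2 * (D (Y z) + D (Y z - h)))"
      using \<open>0 < \<sigma>\<close> by (simp add: f_def g_def Y1 h_def power2_eq_square field_simps)
    also have "\<bar>\<dots>\<bar> \<le> 1 / \<sigma> * (2 * h\<^sup>2 * (1 + \<bar>Y z\<bar>))"
      unfolding abs_mult using \<open>0 < \<sigma>\<close> step[of z] by (simp add: divide_right_mono)
    also have "\<dots> = 2 / \<sigma> ^ 3 * (1 + \<bar>of_int z - \<mu>\<bar> / \<sigma>)"
      using \<open>0 < \<sigma>\<close> by (simp add: h_def Y_def power2_eq_square power3_eq_cube)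
    finally show "\<bar>f z - f (z - 1) - (g z + g (z - 1)) / 2\<bar> \<le> 2 / \<sigma> ^ 3 * (1 + \<bar>of_int z - \<mu>\<bar> / \<sigma>)" .
  qed
qed

section \<open>Vertex degrees\<close>

definition neighbours :: "nat set set \<Rightarrow> nat \<Rightarrow> nat set" where
  "neighbours G v = {u. u \<noteq> v \<and> {u, v} \<in> G}"

lemma finite_vertex_pairs [simp]: "finite (vertex_pairs n)"
  by (rule finite_subset[of _ "Pow {1..n}"]) (auto simp: vertex_pairs_def)

lemma vertex_pairs_subset: "e \<in> vertex_pairs n \<Longrightarrow> e \<subseteq> {1..n}"
  by (simp add: vertex_pairs_def)

lemma vertex_pairs_finite: "e \<in> vertex_pairs n \<Longrightarrow> finite e"
  by (rule card_ge_0_finite) (simp add: vertex_pairs_def)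

lemma vertex_pairs_card: "e \<in> vertex_pairs n \<Longrightarrow> card e = 2"
  by (auto simp: vertex_pairs_def)

lemma finite_subset_vertex_pairs: "G \<subseteq> vertex_pairs n \<Longrightarrow> finite G"
  using finite_subset[OF _ finite_vertex_pairs] .

lemma vertex_pair_eqI:
  assumes "e \<in> vertex_pairs n" "u \<in> e" "v \<in> e" "u \<noteq> v" shows "e = {u, v}"
proof -
  obtain a b where "e = {a, b}" using vertex_pairs_card[OF assms(1)] by (auto simp: card_2_iff)
  then show ?thesis using assms(2-4) by blast
qed

lemma vertex_degree_Int: "vertex_degree G v = card (G \<inter> {e. v \<in> e})"
  by (simp add: vertex_degree_def Int_def)

lemma neighbours_subset: "G \<subseteq> vertex_pairs n \<Longrightarrow> neighbours G v \<subseteq> {1..n}"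
  unfolding neighbours_def using vertex_pairs_subset by fastforce

lemma finite_neighbours: "G \<subseteq> vertex_pairs n \<Longrightarrow> finite (neighbours G v)"
  by (rule finite_subset[OF neighbours_subset]) auto

lemma neighbours_sym: "u \<in> neighbours G v \<longleftrightarrow> v \<in> neighbours G u"
  by (auto simp: neighbours_def insert_commute)

lemma card_neighbours:
  assumes "G \<subseteq> vertex_pairs n" shows "card (neighbours G v) = vertex_degree G v"
proof -
  have "bij_betw (\<lambda>u. {u, v}) (neighbours G v) {e \<in> G. v \<in> e}"
  proof (rule bij_betw_imageI)
    show "inj_on (\<lambda>u. {u, v}) (neighbours G v)"
      by (auto simp: inj_on_def neighbours_def doubleton_eq_iff)
    show "(\<lambda>u. {u, v}) ` neighbours G v = {e \<in> G. v \<in> e}"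
    proof (intro equalityI subsetI)
      fix e assume e: "e \<in> {e \<in> G. v \<in> e}"
      then have "card e = 2" using assms vertex_pairs_card by auto
      then obtain a b where ab: "e = {a, b}" "a \<noteq> b" by (auto simp: card_2_iff)
      show "e \<in> (\<lambda>u. {u, v}) ` neighbours G v"
      proof (cases "v = a")
        case True
        then have "b \<in> neighbours G v" "e = {b, v}" using e ab by (auto simp: neighbours_def insert_commute)
        then show ?thesis by blast
      next
        case False
        then have "v = b" using e ab by auto
        then have "a \<in> neighbours G v" "e = {a, v}" using e ab by (auto simp: neighbours_def)
        then show ?thesis by blast
      qed
    qed (auto simp: neighbours_def)
  qed
  then show ?thesis by (simp add: vertex_degree_def bij_betw_same_card)
qed

lemma vertex_degree_remove:
  assumes "finite G" "e \<in> G"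
  shows "vertex_degree G v = vertex_degree (G - {e}) v + of_bool (v \<in> e)"
proof (cases "v \<in> e")
  case True
  have "{f \<in> G - {e}. v \<in> f} = {f \<in> G. v \<in> f} - {e}" by auto
  moreover have "card {f \<in> G. v \<in> f} > 0" using assms True by (auto simp: card_gt_0_iff)
  ultimately show ?thesis using assms True by (simp add: vertex_degree_def card_Diff_singleton)
next
  case False
  then have "{f \<in> G - {e}. v \<in> f} = {f \<in> G. v \<in> f}" by auto
  then show ?thesis using False by (simp add: vertex_degree_def)
qed

lemma vertex_degree_pos: "finite G \<Longrightarrow> e \<in> G \<Longrightarrow> v \<in> e \<Longrightarrow> 1 \<le> vertex_degree G v"
  using vertex_degree_remove[of G e v] by simp

lemma neighbours_remove:
  assumes "v \<notin> e" shows "neighbours (G - {e}) v = neighbours G v"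
  using assms by (auto simp: neighbours_def)

lemma vertex_degree_remove_star:
  assumes "G \<subseteq> vertex_pairs n" "u \<noteq> v"
  shows "vertex_degree G u = vertex_degree (G - {e. v \<in> e}) u + of_bool (u \<in> neighbours G v)"
proof -
  have fin: "finite G" by (rule finite_subset_vertex_pairs[OF assms(1)])
  have "{f \<in> G. u \<in> f} = {f \<in> G - {e. v \<in> e}. u \<in> f} \<union> {f \<in> G. u \<in> f \<and> v \<in> f}" by auto
  moreover have "{f \<in> G. u \<in> f \<and> v \<in> f} = (if u \<in> neighbours G v then {{u, v}} else {})"
    using assms vertex_pair_eqI[of _ n u v] by (auto simp: neighbours_def)
  ultimately have "{f \<in> G. u \<in> f} = {f \<in> G - {e. v \<in> e}. u \<in> f} \<union> (if u \<in> neighbours G v then {{u, v}} else {})"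
    by simp
  then have "card {f \<in> G. u \<in> f} = card {f \<in> G - {e. v \<in> e}. u \<in> f}
      + card (if u \<in> neighbours G v then {{u, v}} else {})"
    using fin by (simp only: , subst card_Un_disjoint) auto
  then show ?thesis by (simp add: vertex_degree_def)
qed

text \<open>Double counting of incident pairs of a vertex and an edge.\<close>

lemma sum_edges_endpoints:
  assumes "G \<subseteq> vertex_pairs n"
  shows "(\<Sum>e\<in>G. \<Sum>v\<in>e. \<phi> v) = (\<Sum>v\<in>{1..n}. real (vertex_degree G v) * \<phi> v)"
proof -
  have fin: "finite G" by (rule finite_subset_vertex_pairs[OF assms])
  have "(\<Sum>e\<in>G. \<Sum>v\<in>e. \<phi> v) = (\<Sum>e\<in>G. \<Sum>v\<in>{v \<in> {1..n}. v \<in> e}. \<phi> v)"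
  proof (intro sum.cong refl)
    fix e assume "e \<in> G"
    then show "e = {v \<in> {1..n}. v \<in> e}" using assms vertex_pairs_subset by blast
  qed
  also have "\<dots> = (\<Sum>v\<in>{1..n}. \<Sum>e\<in>{e \<in> G. v \<in> e}. \<phi> v)"
    using fin by (intro sum.swap_restrict) auto
  finally show ?thesis by (simp add: vertex_degree_def)
qed

lemma sum_neighbours:
  assumes "G \<subseteq> vertex_pairs n"
  shows "(\<Sum>u\<in>{1..n}. \<Sum>v\<in>neighbours G u. \<phi> v) = (\<Sum>v\<in>{1..n}. real (vertex_degree G v) * \<phi> v)"
proof -
  have "(\<Sum>u\<in>{1..n}. \<Sum>v\<in>neighbours G u. \<phi> v) =
      (\<Sum>u\<in>{1..n}. \<Sum>v\<in>{v \<in> {1..n}. v \<in> neighbours G u}. \<phi> v)"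
    using neighbours_subset[OF assms] by (intro sum.cong refl) blast
  also have "\<dots> = (\<Sum>v\<in>{1..n}. \<Sum>u\<in>{u \<in> {1..n}. v \<in> neighbours G u}. \<phi> v)"
    by (intro sum.swap_restrict) auto
  also have "\<dots> = (\<Sum>v\<in>{1..n}. \<Sum>u\<in>neighbours G v. \<phi> v)"
    using neighbours_subset[OF assms] neighbours_sym by (intro sum.cong refl) blast
  finally show ?thesis by (simp add: card_neighbours[OF assms])
qed

lemma card_star:
  assumes "v \<in> {1..n}" shows "card {e \<in> vertex_pairs n. v \<in> e} = n - 1"
proof -
  have "neighbours (vertex_pairs n) v = {1..n} - {v}"
    using assms by (auto simp: neighbours_def vertex_pairs_def card_insert_if)
  then show ?thesis
    using card_neighbours[of "vertex_pairs n" n v] assms by (simp add: vertex_degree_def)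
qed

section \<open>Vertices of given degree in the random graph\<close>

text \<open>The bound \<open>x / 4 \<le> exp (x / 4)\<close> raised to the fourth power, whence
  256.\<close>

lemma exp_ge_power4: "0 \<le> x \<Longrightarrow> x ^ 4 \<le> 256 * exp x" for x :: real
proof -
  assume "0 \<le> x"
  have "x / 4 \<le> exp (x / 4)" using exp_ge_add_one_self[of "x / 4"] by linarith
  then have "(x / 4) ^ 4 \<le> exp (x / 4) ^ 4" using \<open>0 \<le> x\<close> by (intro power_mono) auto
  also have "exp (x / 4) ^ 4 = exp x" by (simp flip: exp_of_nat_mult)
  finally show ?thesis by (simp add: power_divide)
qed

text \<open>The sparse regime. All upper bounds below depend on \<open>p\<close> and
  \<open>n\<close> only through \<open>L\<close> and explicit powers of \<open>n\<close>;
  \<open>p \<le> 1 / 2\<close> keeps the odds \<open>p / (1 - p)\<close> below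
  \<open>2 * p\<close>.\<close>

locale er_graph =
  fixes n d :: nat and p L :: real
  assumes p_pos: "0 < p" and p_le: "p \<le> 1 / 2" and np_le: "real n * p \<le> L"
begin

declare sum_of_bool_eq [simp del]

lemma p_bounds: "0 \<le> p" "p \<le> 1" "p < 1" using p_pos p_le by auto

abbreviation "E \<equiv> vertex_pairs n"
abbreviation "V \<equiv> {1..n}"
abbreviation "Mean \<equiv> subset_expect p E"
abbreviation "Var \<equiv> subset_var p E"
abbreviation "deg \<equiv> vertex_degree"

lemma L_nonneg: "0 \<le> L"
  using np_le p_pos by (smt (verit) mult_nonneg_nonneg of_nat_0_le_iff)

text \<open>A bound for the fourth moment of \<open>1 + deg\<close>: 256 and \<open>exp 1\<close>
  come from \<open>exp_ge_power4\<close> at \<open>1 + deg\<close>, and \<open>exp (2 * L)\<close>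
  bounds the binomial generating function, using \<open>exp 1 - 1 \<le> 2\<close>.\<close>

definition "M = 256 * exp (1 + 2 * L)"

lemma M_nonneg: "0 \<le> M" by (simp add: M_def)

lemma card_Int_star: "v \<in> V \<Longrightarrow> card (E \<inter> {e. v \<in> e}) = n - 1"
  using card_star[of v n] by (simp add: Int_def)

lemma Mean_deg_le: "v \<in> V \<Longrightarrow> Mean (\<lambda>G. (1 + real (deg G v)) ^ 4) \<le> M"
proof -
  assume v: "v \<in> V"
  have "Mean (\<lambda>G. (1 + real (deg G v)) ^ 4) \<le> Mean (\<lambda>G. 256 * exp 1 * exp 1 ^ card (G \<inter> {e. v \<in> e}))"
  proof (rule subset_expect_mono[OF p_bounds(1,2)])
    fix G
    have "(1 + real (deg G v)) ^ 4 \<le> 256 * exp (1 + real (deg G v))"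
      by (rule exp_ge_power4) simp
    then show "(1 + real (deg G v)) ^ 4 \<le> 256 * exp 1 * exp 1 ^ card (G \<inter> {e. v \<in> e})"
      by (simp add: vertex_degree_Int exp_add flip: exp_of_nat_mult)
  qed
  also have "\<dots> = 256 * exp 1 * (1 + p * (exp 1 - 1)) ^ (n - 1)"
    using card_Int_star[OF v] by (simp only: subset_expect_cmult) (simp add: subset_expect_exp_card)
  also have "(1 + p * (exp 1 - 1)) ^ (n - 1) \<le> exp (p * (exp 1 - 1)) ^ (n - 1)"
    using p_pos by (intro power_mono exp_ge_add_one_self) (auto intro!: add_nonneg_nonneg)
  also have "\<dots> \<le> exp (2 * L)"
  proof -
    have "real (n - 1) * (p * (exp 1 - 1)) \<le> real n * (p * 2)"
      using p_pos exp_le by (intro mult_mono) auto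
    then show ?thesis using np_le by (simp flip: exp_of_nat_mult)
  qed
  finally show ?thesis by (simp add: M_def exp_add)
qed

lemma Mean_sum_deg_le: "Mean (\<lambda>G. \<Sum>v\<in>V. (1 + real (deg G v)) ^ 4) \<le> real n * M"
proof -
  have "(\<Sum>v\<in>V. Mean (\<lambda>G. (1 + real (deg G v)) ^ 4)) \<le> (\<Sum>v\<in>V. M)"
    by (intro sum_mono Mean_deg_le)
  then show ?thesis by (simp add: subset_expect_sum)
qed

text \<open>Efron-Stein with a local Lipschitz bound. Cauchy-Schwarz over the two endpoints gives
  the factor 2, and summing squared degrees over edges yields cubes of degrees summed over vertices,
  which the fourth moment covers.\<close>

lemma Var_le_of_removal:
  assumes c: "0 \<le> c"
    and F: "\<And>G e. G \<subseteq> E \<Longrightarrow> e \<in> G \<Longrightarrow> \<bar>F G - F (G - {e})\<bar> \<le> c * (\<Sum>v\<in>e. real (deg G v))"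
  shows "Var F \<le> 2 * c\<^sup>2 * (real n * M)"
proof -
  have "Var F \<le> Mean (\<lambda>G. \<Sum>e\<in>G. (F G - F (G - {e}))\<^sup>2)"
    by (rule subset_var_Poincare) (use p_bounds in auto)
  also have "\<dots> \<le> Mean (\<lambda>G. 2 * c\<^sup>2 * (\<Sum>v\<in>V. (1 + real (deg G v)) ^ 4))"
  proof (rule subset_expect_mono[OF p_bounds(1,2)])
    fix G assume G: "G \<subseteq> E"
    have "(\<Sum>e\<in>G. (F G - F (G - {e}))\<^sup>2) \<le> (\<Sum>e\<in>G. \<Sum>v\<in>e. 2 * c\<^sup>2 * (real (deg G v))\<^sup>2)"
    proof (rule sum_mono)
      fix e assume e: "e \<in> G"
      then have "card e = 2" using G vertex_pairs_card by auto
      have "(F G - F (G - {e}))\<^sup>2 = \<bar>F G - F (G - {e})\<bar>\<^sup>2" by simp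
      also have "\<dots> \<le> (c * (\<Sum>v\<in>e. real (deg G v)))\<^sup>2"
        using F[OF G e] by (intro power_mono) auto
      also have "\<dots> = c\<^sup>2 * (\<Sum>v\<in>e. 1 * real (deg G v))\<^sup>2" by (simp add: power_mult_distrib)
      also have "\<dots> \<le> c\<^sup>2 * ((\<Sum>v\<in>e. 1\<^sup>2) * (\<Sum>v\<in>e. (real (deg G v))\<^sup>2))"
        by (intro mult_left_mono Cauchy_Schwarz_ineq_sum) simp
      finally show "(F G - F (G - {e}))\<^sup>2 \<le> (\<Sum>v\<in>e. 2 * c\<^sup>2 * (real (deg G v))\<^sup>2)"
        using \<open>card e = 2\<close> by (simp add: sum_distrib_left mult_ac)
    qed
    also have "\<dots> = (\<Sum>v\<in>V. real (deg G v) * (2 * c\<^sup>2 * (real (deg G v))\<^sup>2))"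
      by (rule sum_edges_endpoints[OF G])
    also have "\<dots> \<le> (\<Sum>v\<in>V. 2 * c\<^sup>2 * (1 + real (deg G v)) ^ 4)"
    proof (rule sum_mono)
      fix v
      have "real (deg G v) ^ 3 \<le> (1 + real (deg G v)) ^ 3" by (intro power_mono) auto
      also have "\<dots> \<le> (1 + real (deg G v)) ^ 4" by (intro power_increasing) auto
      finally have "2 * c\<^sup>2 * real (deg G v) ^ 3 \<le> 2 * c\<^sup>2 * (1 + real (deg G v)) ^ 4"
        by (intro mult_left_mono) auto
      then show "real (deg G v) * (2 * c\<^sup>2 * (real (deg G v))\<^sup>2) \<le> 2 * c\<^sup>2 * (1 + real (deg G v)) ^ 4"
        by (simp add: power2_eq_square power3_eq_cube mult_ac)
    qed
    finally show "(\<Sum>e\<in>G. (F G - F (G - {e}))\<^sup>2) \<le> 2 * c\<^sup>2 * (\<Sum>v\<in>V. (1 + real (deg G v)) ^ 4)"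
      by (simp add: sum_distrib_left)
  qed
  also have "\<dots> \<le> 2 * c\<^sup>2 * (real n * M)"
    unfolding subset_expect_cmult using Mean_sum_deg_le by (intro mult_left_mono) auto
  finally show ?thesis .
qed

section \<open>The count \<open>W\<close>, deletion of a vertex, and the fluctuation of
  \<open>Z\<close>\<close>

definition W :: "nat set set \<Rightarrow> int" where
  "W G = int (num_of_degree d n G)"

lemma W_sum: "W G = (\<Sum>v\<in>V. of_bool (deg G v = d))"
  by (simp add: W_def num_of_degree_def sum_of_bool_eq Int_def flip: of_nat_sum)

lemma W_real: "of_int (W G) = (\<Sum>v\<in>V. of_bool (deg G v = d) :: real)"
  by (simp add: W_sum of_bool_def if_distrib cong: if_cong)

text \<open>\<open>\<delta> v G\<close> is the change of \<open>W\<close> when all edges at \<open>v\<close> are deleted and \<open>v\<close> itself is discarded.\<close>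

definition \<delta> :: "nat \<Rightarrow> nat set set \<Rightarrow> int" where
  "\<delta> v G = of_bool (deg G v = d)
    + (\<Sum>u\<in>neighbours G v. of_bool (deg G u = d) - of_bool (deg G u = d + 1))"

text \<open>Deleting the star of \<open>v\<close> lowers by one exactly the degrees of the
  neighbours of \<open>v\<close>: those of degree \<open>d\<close> stop counting and those of degree
  \<open>d + 1\<close> start. The right-hand side reads no edge at \<open>v\<close>, which is the
  source of the independence from \<open>X v\<close>.\<close>

lemma W_minus_\<delta>:
  assumes G: "G \<subseteq> E" and v: "v \<in> V"
  shows "W G - \<delta> v G = (\<Sum>u\<in>V - {v}. of_bool (deg (G - {e. v \<in> e}) u = d))"
proof -
  let ?t = "\<lambda>u. of_bool (deg G u = d) - of_bool (deg G u = d + 1) :: int"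
  have "neighbours G v \<subseteq> V - {v}" using neighbours_subset[OF G] by (auto simp: neighbours_def)
  have "(\<Sum>u\<in>V - {v}. of_bool (deg (G - {e. v \<in> e}) u = d) :: int) =
      (\<Sum>u\<in>V - {v}. of_bool (deg G u = d) - (if u \<in> neighbours G v then ?t u else 0))"
    by (intro sum.cong refl) (auto simp: vertex_degree_remove_star[OF G, of _ v])
  also have "\<dots> = (\<Sum>u\<in>V - {v}. of_bool (deg G u = d)) - (\<Sum>u\<in>neighbours G v. ?t u)"
    using \<open>neighbours G v \<subseteq> V - {v}\<close> by (simp add: sum_subtractf sum.If_cases Int_absorb1)
  also have "(\<Sum>u\<in>V - {v}. of_bool (deg G u = d)) = W G - of_bool (deg G v = d)"
    unfolding W_sum using v sum.remove[of V v "\<lambda>u. of_bool (deg G u = d) :: int"] by simp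
  finally show ?thesis by (simp add: \<delta>_def)
qed

lemma abs_\<delta>_le:
  assumes G: "G \<subseteq> E" shows "\<bar>of_int (\<delta> v G) :: real\<bar> \<le> 1 + real (deg G v)"
proof -
  have "\<bar>\<Sum>u\<in>neighbours G v. of_bool (deg G u = d) - of_bool (deg G u = d + 1) :: int\<bar>
      \<le> (\<Sum>u\<in>neighbours G v. 1)"
    by (rule order_trans[OF sum_abs]) (intro sum_mono, auto)
  moreover have "\<bar>\<delta> v G\<bar> \<le> \<bar>of_bool (deg G v = d)\<bar>
      + \<bar>\<Sum>u\<in>neighbours G v. of_bool (deg G u = d) - of_bool (deg G u = d + 1) :: int\<bar>"
    by (simp only: \<delta>_def abs_triangle_ineq)
  moreover have "\<bar>of_bool (deg G v = d) :: int\<bar> \<le> 1" by simp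
  ultimately have "\<bar>\<delta> v G\<bar> \<le> 1 + int (deg G v)"
    by (cases "deg G v = d") (simp_all add: card_neighbours[OF G])
  then show ?thesis by linarith
qed

text \<open>With \<open>v\<close> outside \<open>e\<close>, its degree and neighbourhood are
  unchanged; only the terms of neighbours that are endpoints of \<open>e\<close> move, each by at
  most 2.\<close>

lemma \<delta>_remove:
  assumes G: "G \<subseteq> E" and e: "e \<in> G" and v: "v \<notin> e"
  shows "\<bar>\<delta> v G - \<delta> v (G - {e})\<bar> \<le> 2 * int (card (neighbours G v \<inter> e))"
proof -
  let ?t = "\<lambda>G u. of_bool (deg G u = d) - of_bool (deg G u = d + 1) :: int"
  have deg: "deg G u = deg (G - {e}) u" if "u \<notin> e" for u
    using vertex_degree_remove[OF finite_subset_vertex_pairs[OF G] e, of u] that by simp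
  have "\<delta> v G - \<delta> v (G - {e}) = (\<Sum>u\<in>neighbours G v. ?t G u - ?t (G - {e}) u)"
    by (simp add: \<delta>_def deg[OF v] neighbours_remove[OF v] sum_subtractf)
  also have "\<bar>\<dots>\<bar> \<le> (\<Sum>u\<in>neighbours G v. if u \<in> e then 2 else 0)"
    by (rule order_trans[OF sum_abs]) (intro sum_mono, auto simp: deg)
  also have "\<dots> = 2 * int (card (neighbours G v \<inter> e))"
    using finite_neighbours[OF G] by (simp add: sum.If_cases)
  finally show ?thesis .
qed

definition \<pi> :: "nat \<Rightarrow> real" where "\<pi> v = Mean (\<lambda>G. of_bool (deg G v = d))"

definition X :: "nat \<Rightarrow> nat set set \<Rightarrow> real" where "X v G = of_bool (deg G v = d) - \<pi> v"

lemma \<pi>_bounds: "0 \<le> \<pi> v" "\<pi> v \<le> 1"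
proof -
  show "0 \<le> \<pi> v" unfolding \<pi>_def by (rule subset_expect_nonneg) (use p_bounds in auto)
  have "\<pi> v \<le> Mean (\<lambda>_. 1)" unfolding \<pi>_def by (rule subset_expect_mono) (use p_bounds in auto)
  then show "\<pi> v \<le> 1" by simp
qed

lemma abs_X_le: "\<bar>X v G\<bar> \<le> 1" using \<pi>_bounds[of v] by (auto simp: X_def)

lemma X_remove:
  assumes "G \<subseteq> E" "e \<in> G" "v \<notin> e" shows "X v (G - {e}) = X v G"
  using vertex_degree_remove[OF finite_subset_vertex_pairs[OF assms(1)] assms(2), of v] assms(3)
  by (simp add: X_def)

lemma Mean_X: "Mean (X v) = 0"
  unfolding X_def[abs_def] by (simp add: subset_expect_diff \<pi>_def)

lemma Mean_W: "Mean (\<lambda>G. of_int (W G)) = (\<Sum>v\<in>V. \<pi> v)"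
  by (simp add: W_real subset_expect_sum \<pi>_def)

lemma X_indep:
  "Mean (\<lambda>G. X v G * h (\<Sum>u\<in>V - {v}. of_bool (deg (G - {e. v \<in> e}) u = d) :: int)) = 0"
proof -
  have "Mean (\<lambda>G. X v G * h (\<Sum>u\<in>V - {v}. of_bool (deg (G - {e. v \<in> e}) u = d) :: int)) =
      Mean (X v) * Mean (\<lambda>G. h (\<Sum>u\<in>V - {v}. of_bool (deg (G - {e. v \<in> e}) u = d) :: int))"
    by (rule subset_expect_mult_indep[where A = "{e. v \<in> e}"])
      (simp_all add: X_def vertex_degree_Int Int_assoc)
  then show ?thesis by (simp add: Mean_X)
qed

lemma Stein_expansion:
  "Mean (\<lambda>G. (of_int (W G) - Mean (\<lambda>G. of_int (W G))) * f (W G)) =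
    Mean (\<lambda>G. \<Sum>v\<in>V. X v G * (f (W G) - f (W G - \<delta> v G)))"
proof -
  have "Mean (\<lambda>G. (of_int (W G) - Mean (\<lambda>G. of_int (W G))) * f (W G)) =
      Mean (\<lambda>G. \<Sum>v\<in>V. X v G * f (W G))"
    unfolding Mean_W by (intro subset_expect_cong)
      (simp add: W_real X_def sum_subtractf flip: sum_distrib_right)
  also have "\<dots> = (\<Sum>v\<in>V. Mean (\<lambda>G. X v G * f (W G)) - 0)"
    by (simp add: subset_expect_sum)
  also have "\<dots> = (\<Sum>v\<in>V. Mean (\<lambda>G. X v G * (f (W G) - f (W G - \<delta> v G))))"
  proof (intro sum.cong refl)
    fix v assume v: "v \<in> V"
    have "0 = Mean (\<lambda>G. X v G * f (W G - \<delta> v G))"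
      unfolding X_indep[of v f, symmetric]
      by (intro subset_expect_cong) (simp add: W_minus_\<delta>[OF _ v])
    then show "Mean (\<lambda>G. X v G * f (W G)) - 0 = Mean (\<lambda>G. X v G * (f (W G) - f (W G - \<delta> v G)))"
      by (simp add: right_diff_distrib subset_expect_diff)
  qed
  finally show ?thesis by (simp add: subset_expect_sum)
qed

definition Z :: "nat set set \<Rightarrow> real" where "Z G = (\<Sum>v\<in>V. X v G * of_int (\<delta> v G))"

text \<open>The Stein expansion applied to the identity function, for which the difference in
  \<open>f\<close> is exactly \<open>\<delta> v\<close>.\<close>

lemma Mean_Z: "Mean Z = Var (\<lambda>G. of_int (W G))"
proof -
  let ?\<mu> = "Mean (\<lambda>G. of_int (W G))"
  have "Mean Z = Mean (\<lambda>G. (of_int (W G) - ?\<mu>) * of_int (W G))"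
    using Stein_expansion[of of_int] by (simp add: Z_def[abs_def])
  also have "\<dots> = Mean (\<lambda>G. (of_int (W G))\<^sup>2 - ?\<mu> * of_int (W G))"
    by (simp add: power2_eq_square algebra_simps)
  also have "\<dots> = Mean (\<lambda>G. (of_int (W G))\<^sup>2) - ?\<mu>\<^sup>2"
    by (simp add: subset_expect_diff subset_expect_cmult power2_eq_square)
  finally show ?thesis by (simp add: subset_var_alt)
qed

lemma sum_card_neighbours_Int:
  assumes G: "G \<subseteq> E" and e: "e \<subseteq> V"
  shows "(\<Sum>v\<in>V. real (card (neighbours G v \<inter> e))) = (\<Sum>u\<in>e. real (deg G u))"
proof -
  have "(\<Sum>v\<in>V. real (card (neighbours G v \<inter> e))) = (\<Sum>v\<in>V. \<Sum>u\<in>neighbours G v. of_bool (u \<in> e))"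
    using finite_neighbours[OF G] by (simp add: sum_of_bool_eq Int_def)
  also have "\<dots> = (\<Sum>v\<in>V. real (deg G v) * of_bool (v \<in> e))" by (rule sum_neighbours[OF G])
  also have "\<dots> = (\<Sum>v\<in>V. if v \<in> e then real (deg G v) else 0)" by (intro sum.cong) auto
  also have "\<dots> = (\<Sum>u\<in>e. real (deg G u))"
    using e by (simp add: sum.If_cases Int_absorb1 flip: Int_def)
  finally show ?thesis .
qed

lemma Var_Z_le: "Var Z \<le> 72 * (real n * M)"
proof -
  have "Var Z \<le> 2 * 6\<^sup>2 * (real n * M)"
  proof (rule Var_le_of_removal)
    fix G e assume G: "G \<subseteq> E" and e: "e \<in> G"
    have eV: "e \<subseteq> V" "finite e" using G e vertex_pairs_subset vertex_pairs_finite by blast+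
    have fin: "finite G" by (rule finite_subset_vertex_pairs[OF G])
    let ?D = "\<lambda>v. X v G * of_int (\<delta> v G) - X v (G - {e}) * of_int (\<delta> v (G - {e}))"
    have b: "\<bar>X v G' * of_int (\<delta> v G')\<bar> \<le> 1 + real (deg G v)" if "G' = G \<or> G' = G - {e}" for v G'
    proof -
      have "G' \<subseteq> E" "deg G' v \<le> deg G v" using that G vertex_degree_remove[OF fin e, of v] by auto
      have "\<bar>X v G'\<bar> * \<bar>of_int (\<delta> v G')\<bar> \<le> 1 * (1 + real (deg G' v))"
        by (intro mult_mono abs_X_le abs_\<delta>_le \<open>G' \<subseteq> E\<close>) auto
      then show ?thesis using \<open>deg G' v \<le> deg G v\<close> by (simp add: abs_mult)
    qed
    have "\<bar>Z G - Z (G - {e})\<bar> = \<bar>\<Sum>v\<in>V. ?D v\<bar>" by (simp add: Z_def sum_subtractf)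
    also have "\<dots> \<le> (\<Sum>v\<in>V. (if v \<in> e then 2 * (1 + real (deg G v)) else 0) + 2 * real (card (neighbours G v \<inter> e)))"
    proof (rule order_trans[OF sum_abs], rule sum_mono)
      fix v
      show "\<bar>?D v\<bar> \<le> (if v \<in> e then 2 * (1 + real (deg G v)) else 0) + 2 * real (card (neighbours G v \<inter> e))"
      proof (cases "v \<in> e")
        case True
        then show ?thesis using b[of G v] b[of "G - {e}" v] by auto
      next
        case False
        have "?D v = X v G * of_int (\<delta> v G - \<delta> v (G - {e}))"
          by (simp add: X_remove[OF G e False] right_diff_distrib)
        also have "\<bar>\<dots>\<bar> \<le> 1 * of_int \<bar>\<delta> v G - \<delta> v (G - {e})\<bar>"
          unfolding abs_mult by (intro mult_mono abs_X_le) auto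
        also have "\<dots> \<le> of_int (2 * int (card (neighbours G v \<inter> e)))"
          using \<delta>_remove[OF G e False] by (simp only: mult_1 of_int_le_iff)
        finally show ?thesis using False by simp
      qed
    qed
    also have "\<dots> = (\<Sum>v\<in>e. 2 * (1 + real (deg G v))) + 2 * (\<Sum>v\<in>e. real (deg G v))"
      unfolding sum.distrib sum_card_neighbours_Int[OF G eV(1), symmetric] using eV
      by (simp add: sum.If_cases Int_absorb1 sum_distrib_left flip: Int_def)
    \<comment> \<open>An endpoint of a present edge has degree at least 1, so the endpoint terms
      cost 4 times the degree. Together with 2 from the adjacent vertices this makes 6, and
      \<open>72 = 2 * 6 * 6\<close>.\<close>
    also have "(\<Sum>v\<in>e. 2 * (1 + real (deg G v))) \<le> (\<Sum>v\<in>e. 4 * real (deg G v))"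
      using vertex_degree_pos[OF fin e] by (intro sum_mono) fastforce
    finally show "\<bar>Z G - Z (G - {e})\<bar> \<le> 6 * (\<Sum>v\<in>e. real (deg G v))"
      by (simp flip: sum_distrib_left)
  qed simp
  then show ?thesis by simp
qed

text \<open>Adding \<open>e\<close> turns degrees \<open>d\<close> and \<open>d + 1\<close> of its endpoints into \<open>d + 1\<close> and \<open>d + 2\<close>, so \<open>W\<close> drops
  by one. Moves raising \<open>W\<close> would not do: for \<open>d = 0\<close> no added edge raises it.\<close>

definition lowering :: "nat set \<Rightarrow> nat set set \<Rightarrow> real" where
  "lowering e G = of_bool (\<exists>a b. e = {a, b} \<and> deg (G - {e}) a = d \<and> deg (G - {e}) b = d + 1)"

section \<open>Rates of the lowering moves and the smoothing estimate\<close>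

definition Tminus :: "nat set set \<Rightarrow> real" where "Tminus G = (\<Sum>e\<in>G. lowering e G)"
text \<open>The factor \<open>p / (1 - p)\<close> is the probability ratio of the graph with and
  without \<open>e\<close>, as detailed balance with the deletions counted by \<open>Tminus\<close>
  requires.\<close>

definition Tplus :: "nat set set \<Rightarrow> real" where "Tplus G = p / (1 - p) * (\<Sum>e\<in>E - G. lowering e G)"
definition q :: real where "q = Mean Tminus"

lemma lowering_bounds: "0 \<le> lowering e G" "lowering e G \<le> 1" by (simp_all add: lowering_def)

lemma lowering_insert: "lowering e (insert e G) = lowering e (G - {e})"
  by (simp add: lowering_def)

lemma W_insert:
  assumes e: "e \<in> E" and G: "G \<subseteq> E" and lowering: "lowering e (G - {e}) \<noteq> 0"
  shows "W (insert e G) = W (G - {e}) - 1"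
proof -
  define H where "H = G - {e}"
  have H: "finite H" "insert e G = insert e H" "e \<notin> H"
    using finite_subset_vertex_pairs[OF G] by (auto simp: H_def)
  obtain a b where ab: "e = {a, b}" "deg H a = d" "deg H b = d + 1"
    using lowering by (auto simp: lowering_def H_def)
  have "a \<in> V" using vertex_pairs_subset[OF e] ab by auto
  have deg: "deg (insert e H) v = deg H v + (if v = a \<or> v = b then 1 else 0)" for v
    using vertex_degree_remove[of "insert e H" e v] H ab(1) by simp
  have "W (insert e H) = (\<Sum>v\<in>V. of_bool (deg H v = d) - (if v = a then 1 else 0))"
    unfolding W_sum by (intro sum.cong refl) (auto simp: deg ab(2,3))
  also have "\<dots> = W H - 1" using \<open>a \<in> V\<close> by (simp add: W_sum sum_subtractf)
  finally show ?thesis unfolding H(2) H_def .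
qed

lemma lowering_remove:
  assumes "f \<inter> e = {}" shows "lowering f (G - {e}) = lowering f G"
proof -
  have "deg (G - {e} - {f}) a = deg (G - {f}) a" if "a \<in> f" for a
  proof -
    have "{h \<in> G - {e} - {f}. a \<in> h} = {h \<in> G - {f}. a \<in> h}" using that assms by auto
    then show ?thesis by (simp add: vertex_degree_def)
  qed
  then show ?thesis unfolding lowering_def by (intro arg_cong[of _ _ of_bool]) (metis insertCI)
qed

lemma card_touching:
  assumes "e \<in> E"
  shows "card {f \<in> G. f \<inter> e \<noteq> {}} \<le> (\<Sum>v\<in>e. deg G v)"
proof -
  have "{f \<in> G. f \<inter> e \<noteq> {}} = (\<Union>v\<in>e. {f \<in> G. v \<in> f})" by auto
  then show ?thesis
    using card_UN_le[OF vertex_pairs_finite[OF assms], of "\<lambda>v. {f \<in> G. v \<in> f}"]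
    by (simp add: vertex_degree_def)
qed

text \<open>Removing \<open>e\<close> can change the status only of pairs that meet
  \<open>e\<close>, each by at most one. The \<open>+ 1\<close> leaves room for the term of
  \<open>e\<close> itself, which the cardinality on the right counts.\<close>

lemma abs_sum_lowering_remove:
  assumes "finite S" "e \<in> E"
  shows "\<bar>\<Sum>f\<in>S - {e}. lowering f G - lowering f (G - {e})\<bar> + 1 \<le> real (card {f \<in> insert e S. f \<inter> e \<noteq> {}})"
proof -
  have "e \<noteq> {}" using vertex_pairs_card[OF assms(2)] by auto
  have "\<bar>\<Sum>f\<in>S - {e}. lowering f G - lowering f (G - {e})\<bar> \<le> (\<Sum>f\<in>S - {e}. of_bool (f \<inter> e \<noteq> {}))"
  proof (rule order_trans[OF sum_abs], rule sum_mono)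
    fix f
    show "\<bar>lowering f G - lowering f (G - {e})\<bar> \<le> of_bool (f \<inter> e \<noteq> {})"
      using lowering_remove[of f e G] lowering_bounds[of f G] lowering_bounds[of f "G - {e}"] by auto
  qed
  also have "\<dots> = real (card {f \<in> S - {e}. f \<inter> e \<noteq> {}})"
    using assms by (simp add: sum_of_bool_eq Int_def)
  finally have "\<bar>\<Sum>f\<in>S - {e}. lowering f G - lowering f (G - {e})\<bar> + 1 \<le> real (Suc (card {f \<in> S - {e}. f \<inter> e \<noteq> {}}))"
    by simp
  also have "Suc (card {f \<in> S - {e}. f \<inter> e \<noteq> {}}) = card (insert e {f \<in> S - {e}. f \<inter> e \<noteq> {}})"
    using assms by simp
  also have "insert e {f \<in> S - {e}. f \<inter> e \<noteq> {}} = {f \<in> insert e S. f \<inter> e \<noteq> {}}"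
    using \<open>e \<noteq> {}\<close> by auto
  finally show ?thesis .
qed

lemma Var_Tminus_le: "Var Tminus \<le> 2 * (real n * M)"
proof -
  have "Var Tminus \<le> 2 * 1\<^sup>2 * (real n * M)"
  proof (rule Var_le_of_removal)
    fix G e assume G: "G \<subseteq> E" and e: "e \<in> G"
    have fin: "finite G" by (rule finite_subset_vertex_pairs[OF G])
    have "Tminus G - Tminus (G - {e}) = lowering e G + (\<Sum>f\<in>G - {e}. lowering f G - lowering f (G - {e}))"
      unfolding Tminus_def sum_subtractf using sum.remove[OF fin e] by simp
    then have "\<bar>Tminus G - Tminus (G - {e})\<bar> \<le> \<bar>\<Sum>f\<in>G - {e}. lowering f G - lowering f (G - {e})\<bar> + 1"
      using lowering_bounds[of e G] by linarith
    also have "\<dots> \<le> real (card {f \<in> insert e G. f \<inter> e \<noteq> {}})"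
      using abs_sum_lowering_remove[OF fin] e G by blast
    also have "\<dots> \<le> real (\<Sum>v\<in>e. deg G v)"
      using card_touching[of e G] e G by (auto simp: insert_absorb simp del: of_nat_sum)
    finally show "\<bar>Tminus G - Tminus (G - {e})\<bar> \<le> 1 * (\<Sum>v\<in>e. real (deg G v))" by simp
  qed simp
  then show ?thesis by simp
qed

text \<open>Here the sum runs over absent pairs, and about \<open>2 * n\<close> of them may meet
  \<open>e\<close>. The weight is at most \<open>2 * p\<close>, so the change is bounded by
  \<open>4 * n * p \<le> 4 * L\<close>; endpoints of the present edge \<open>e\<close> have positive
  degree, which brings this into the form of \<open>Var_le_of_removal\<close>.\<close>

lemma Var_Tplus_le: "Var Tplus \<le> 32 * L\<^sup>2 * (real n * M)"
proof -
  have "Var Tplus \<le> 2 * (4 * L)\<^sup>2 * (real n * M)"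
  proof (rule Var_le_of_removal)
    fix G e assume G: "G \<subseteq> E" and e: "e \<in> G"
    have fin: "finite G" by (rule finite_subset_vertex_pairs[OF G])
    have eE: "e \<in> E" using e G by auto
    let ?S = "\<lambda>G. \<Sum>f\<in>E - G. lowering f G"
    let ?R = "\<Sum>f\<in>E - G - {e}. lowering f G - lowering f (G - {e})"
    have "?S (G - {e}) = (\<Sum>f\<in>insert e (E - G). lowering f (G - {e}))"
      using eE by (intro sum.cong) auto
    also have "\<dots> = lowering e (G - {e}) + (\<Sum>f\<in>E - G. lowering f (G - {e}))"
      using e by (intro sum.insert) auto
    moreover have "?R = ?S G - (\<Sum>f\<in>E - G. lowering f (G - {e}))"
      using e by (simp add: sum_subtractf)
    ultimately have "\<bar>?S G - ?S (G - {e})\<bar> \<le> \<bar>?R\<bar> + 1"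
      using lowering_bounds[of e "G - {e}"] by linarith
    also have "\<dots> \<le> real (card {f \<in> insert e (E - G). f \<inter> e \<noteq> {}})"
      by (rule abs_sum_lowering_remove) (use eE in auto)
    also have "\<dots> \<le> real (card {f \<in> E. f \<inter> e \<noteq> {}})"
      using eE by (intro of_nat_mono card_mono) auto
    also have "\<dots> \<le> real (\<Sum>v\<in>e. deg E v)"
      by (intro of_nat_mono card_touching eE)
    also have "(\<Sum>v\<in>e. deg E v) \<le> (\<Sum>v\<in>e. n)"
    proof (rule sum_mono)
      fix v assume "v \<in> e"
      then have "v \<in> V" using vertex_pairs_subset[OF eE] by blast
      then show "deg E v \<le> n" using card_star[of v n] by (simp add: vertex_degree_def)
    qed
    also have "real (\<Sum>v\<in>e. n) = 2 * real n" using vertex_pairs_card[OF eE] by simp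
    finally have S: "\<bar>?S G - ?S (G - {e})\<bar> \<le> 2 * real n" by simp
    have "\<bar>Tplus G - Tplus (G - {e})\<bar> = p / (1 - p) * \<bar>?S G - ?S (G - {e})\<bar>"
      unfolding Tplus_def right_diff_distrib[symmetric] abs_mult using p_bounds by simp
    also have "\<dots> \<le> (2 * p) * (2 * real n)"
    proof (rule mult_mono[OF _ S])
      have "p * 1 \<le> p * (2 * (1 - p))" using p_pos p_le by (intro mult_left_mono) auto
      then show "p / (1 - p) \<le> 2 * p" using p_bounds by (simp add: divide_le_eq algebra_simps)
    qed (use p_pos in auto)
    also have "\<dots> \<le> 4 * L * 1" using np_le by (simp add: mult.commute)
    also have "\<dots> \<le> 4 * L * (\<Sum>v\<in>e. real (deg G v))"
    proof (rule mult_left_mono)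
      obtain v where "v \<in> e" using vertex_pairs_card[OF eE] by fastforce
      then have "real (deg G v) \<le> (\<Sum>v\<in>e. real (deg G v))"
        using vertex_pairs_finite[OF eE] by (intro member_le_sum) auto
      moreover have "1 \<le> deg G v" by (rule vertex_degree_pos[OF fin e \<open>v \<in> e\<close>])
      ultimately show "1 \<le> (\<Sum>v\<in>e. real (deg G v))" by linarith
    qed (use L_nonneg in simp)
    finally show "\<bar>Tplus G - Tplus (G - {e})\<bar> \<le> 4 * L * (\<Sum>v\<in>e. real (deg G v))" .
  qed (use L_nonneg in simp)
  then show ?thesis by (simp add: power_mult_distrib)
qed

lemma shift:
  "Mean (\<lambda>G. Tminus G * \<Psi> G (W G)) - Mean (\<lambda>G. Tplus G * \<Psi> G (W G - 1)) =
    Mean (\<lambda>G. \<Sum>e\<in>G. lowering e G * (\<Psi> G (W G) - \<Psi> (G - {e}) (W G)))"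
  unfolding Tminus_def Tplus_def
  by (rule subset_expect_shift[OF finite_vertex_pairs p_pos p_bounds(3) lowering_insert W_insert])

text \<open>The constant function in \<open>shift\<close>: additions and deletions balance in mean,
  so both rates can be centred at the same \<open>q\<close>.\<close>

lemma Mean_Tplus: "Mean Tplus = q"
  using shift[of "\<lambda>_ _. 1"] by (simp add: q_def)

lemma smoothing:
  assumes \<Psi>: "\<And>G w. G \<subseteq> E \<Longrightarrow> \<bar>\<Psi> G w\<bar> \<le> Q G"
  shows "q * \<bar>Mean (\<lambda>G. \<Psi> G (W G) - \<Psi> G (W G - 1))\<bar> \<le>
    (sqrt (Var Tminus) + sqrt (Var Tplus)) * sqrt (Mean (\<lambda>G. (Q G)\<^sup>2))
    + Mean (\<lambda>G. \<Sum>e\<in>G. \<bar>\<Psi> G (W G) - \<Psi> (G - {e}) (W G)\<bar>)"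
proof -
  have q: "0 \<le> q" unfolding q_def Tminus_def
    by (intro subset_expect_nonneg sum_nonneg) (use p_bounds lowering_bounds in auto)
  have CS: "\<bar>Mean (\<lambda>G. (T G - q) * \<Psi> G (w G))\<bar> \<le> sqrt (Var T) * sqrt (Mean (\<lambda>G. (Q G)\<^sup>2))"
    if "Mean T = q" for T w
  proof -
    have "\<bar>Mean (\<lambda>G. (T G - q) * \<Psi> G (w G))\<bar> \<le>
        sqrt (Mean (\<lambda>G. (T G - q)\<^sup>2)) * sqrt (Mean (\<lambda>G. (\<Psi> G (w G))\<^sup>2))"
      by (rule subset_expect_Cauchy_Schwarz[OF p_bounds(1,2)])
    also have "\<dots> \<le> sqrt (Mean (\<lambda>G. (T G - q)\<^sup>2)) * sqrt (Mean (\<lambda>G. (Q G)\<^sup>2))"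
    proof (intro mult_left_mono real_sqrt_le_mono subset_expect_mono p_bounds(1,2))
      fix G assume "G \<subseteq> E"
      then show "(\<Psi> G (w G))\<^sup>2 \<le> (Q G)\<^sup>2"
        using power_mono[OF \<Psi>[of G "w G"], of 2] by simp
    next
      show "0 \<le> sqrt (Mean (\<lambda>G. (T G - q)\<^sup>2))"
        by (intro real_sqrt_ge_zero subset_expect_nonneg p_bounds(1,2)) simp
    qed
    finally show ?thesis unfolding subset_var_def that .
  qed
  let ?S = "\<lambda>G. \<Sum>e\<in>G. lowering e G * (\<Psi> G (W G) - \<Psi> (G - {e}) (W G))"
  \<comment> \<open>Replacing \<open>q\<close> by \<open>Tminus\<close> at \<open>W\<close> and by
    \<open>Tplus\<close> at \<open>W - 1\<close> makes the difference accessible to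
    \<open>shift\<close>. The price is two centred products, handled by Cauchy-Schwarz, and the
    effect on \<open>\<Psi>\<close> of removing one edge.\<close>
  have "q * Mean (\<lambda>G. \<Psi> G (W G) - \<Psi> G (W G - 1)) =
      Mean ?S - Mean (\<lambda>G. (Tminus G - q) * \<Psi> G (W G)) + Mean (\<lambda>G. (Tplus G - q) * \<Psi> G (W G - 1))"
  proof -
    have "Mean (\<lambda>G. (T G - q) * \<Psi> G (w G)) = Mean (\<lambda>G. T G * \<Psi> G (w G)) - q * Mean (\<lambda>G. \<Psi> G (w G))"
      for T w by (simp only: left_diff_distrib subset_expect_diff subset_expect_cmult)
    note this[of Tminus W] this[of Tplus "\<lambda>G. W G - 1"]
    moreover have "q * Mean (\<lambda>G. \<Psi> G (W G) - \<Psi> G (W G - 1)) =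
        q * Mean (\<lambda>G. \<Psi> G (W G)) - q * Mean (\<lambda>G. \<Psi> G (W G - 1))"
      by (simp only: subset_expect_diff right_diff_distrib)
    ultimately show ?thesis using shift[of \<Psi>] by linarith
  qed
  moreover have "\<bar>Mean ?S\<bar> \<le> Mean (\<lambda>G. \<Sum>e\<in>G. \<bar>\<Psi> G (W G) - \<Psi> (G - {e}) (W G)\<bar>)"
  proof (rule abs_subset_expect_le[OF p_bounds(1,2)], rule order_trans[OF sum_abs], rule sum_mono)
    fix G e
    have "\<bar>lowering e G\<bar> * \<bar>\<Psi> G (W G) - \<Psi> (G - {e}) (W G)\<bar> \<le> 1 * \<bar>\<Psi> G (W G) - \<Psi> (G - {e}) (W G)\<bar>"
      using lowering_bounds[of e G] by (intro mult_right_mono) auto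
    then show "\<bar>lowering e G * (\<Psi> G (W G) - \<Psi> (G - {e}) (W G))\<bar> \<le> \<bar>\<Psi> G (W G) - \<Psi> (G - {e}) (W G)\<bar>"
      by (simp only: abs_mult mult_1)
  qed
  moreover note CS[OF q_def[symmetric], of W] CS[OF Mean_Tplus, of "\<lambda>G. W G - 1"]
  ultimately have "\<bar>q * Mean (\<lambda>G. \<Psi> G (W G) - \<Psi> G (W G - 1))\<bar> \<le>
      sqrt (Var Tminus) * sqrt (Mean (\<lambda>G. (Q G)\<^sup>2)) + sqrt (Var Tplus) * sqrt (Mean (\<lambda>G. (Q G)\<^sup>2))
      + Mean (\<lambda>G. \<Sum>e\<in>G. \<bar>\<Psi> G (W G) - \<Psi> (G - {e}) (W G)\<bar>)"
    by linarith
  then show ?thesis by (simp only: abs_mult abs_of_nonneg[OF q] distrib_right)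
qed

definition Q :: "nat set set \<Rightarrow> real" where "Q G = (\<Sum>v\<in>V. (1 + real (deg G v))\<^sup>2)"

lemma Mean_Q_sq_le: "Mean (\<lambda>G. (Q G)\<^sup>2) \<le> (real n)\<^sup>2 * M"
proof -
  have "Mean (\<lambda>G. (Q G)\<^sup>2) \<le> Mean (\<lambda>G. real n * (\<Sum>v\<in>V. (1 + real (deg G v)) ^ 4))"
  proof (rule subset_expect_mono[OF p_bounds(1,2)])
    fix G
    have "(\<Sum>v\<in>V. 1 * (1 + real (deg G v))\<^sup>2)\<^sup>2 \<le> (\<Sum>v\<in>V. 1\<^sup>2) * (\<Sum>v\<in>V. ((1 + real (deg G v))\<^sup>2)\<^sup>2)"
      by (rule Cauchy_Schwarz_ineq_sum)
    then show "(Q G)\<^sup>2 \<le> real n * (\<Sum>v\<in>V. (1 + real (deg G v)) ^ 4)"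
      by (simp add: Q_def flip: power_mult)
  qed
  also have "\<dots> \<le> real n * (real n * M)"
    unfolding subset_expect_cmult by (intro mult_left_mono Mean_sum_deg_le) simp
  finally show ?thesis by (simp add: power2_eq_square)
qed

section \<open>Size and edge sensitivity of the functional \<open>\<Psi>\<close>\<close>

definition \<Psi> :: "(int \<Rightarrow> int \<Rightarrow> real) \<Rightarrow> nat set set \<Rightarrow> int \<Rightarrow> real" where
  "\<Psi> K G w = (\<Sum>v\<in>V. X v G * K (\<delta> v G) w)"

context
  fixes K :: "int \<Rightarrow> int \<Rightarrow> real" and B :: real
  assumes K: "\<And>k w. \<bar>K k w\<bar> \<le> B * (of_int k)\<^sup>2"
begin

lemma B_nonneg: "0 \<le> B" using K[of 1 0] by simp

lemma abs_X_K_le: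
  assumes "G \<subseteq> E" "deg G v \<le> m"
  shows "\<bar>X v G * K (\<delta> v G) w\<bar> \<le> B * (1 + real m)\<^sup>2"
proof -
  have "\<bar>of_int (\<delta> v G)\<bar> \<le> 1 + real m" using abs_\<delta>_le[OF assms(1), of v] assms(2) by simp
  then have "\<bar>of_int (\<delta> v G)\<bar>\<^sup>2 \<le> (1 + real m)\<^sup>2" by (intro power_mono) auto
  then have "B * (of_int (\<delta> v G))\<^sup>2 \<le> B * (1 + real m)\<^sup>2"
    using B_nonneg by (intro mult_left_mono) auto
  then have "\<bar>X v G\<bar> * \<bar>K (\<delta> v G) w\<bar> \<le> 1 * (B * (1 + real m)\<^sup>2)"
    using K[of "\<delta> v G" w] by (intro mult_mono abs_X_le) auto
  then show ?thesis by (simp add: abs_mult)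
qed

lemma abs_\<Psi>_le: "G \<subseteq> E \<Longrightarrow> \<bar>\<Psi> K G w\<bar> \<le> B * Q G"
  unfolding \<Psi>_def Q_def sum_distrib_left
  by (rule order_trans[OF sum_abs], rule sum_mono) (rule abs_X_K_le, auto)

text \<open>A term can change only if \<open>v\<close> is an endpoint of \<open>e\<close> or has a
  neighbour in \<open>e\<close>. In both cases the crude bound \<open>2 * B\<close> times the
  squared \<open>1 + deg\<close> is used; in the second one it is multiplied by a cardinality that
  is at least 1.\<close>

lemma \<Psi>_remove:
  assumes G: "G \<subseteq> E" and e: "e \<in> G"
  shows "\<bar>\<Psi> K G w - \<Psi> K (G - {e}) w\<bar> \<le>
    2 * B * ((\<Sum>v\<in>e. (1 + real (deg G v))\<^sup>2) +
      (\<Sum>v\<in>V. (1 + real (deg G v))\<^sup>2 * real (card (neighbours G v \<inter> e))))"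
proof -
  let ?D = "\<lambda>v. X v G * K (\<delta> v G) w - X v (G - {e}) * K (\<delta> v (G - {e})) w"
  let ?h = "\<lambda>v. (1 + real (deg G v))\<^sup>2"
  have eV: "e \<subseteq> V" using G e vertex_pairs_subset by blast
  have fin: "finite G" by (rule finite_subset_vertex_pairs[OF G])
  have D: "\<bar>?D v\<bar> \<le> 2 * B * ?h v" for v
  proof -
    have "G - {e} \<subseteq> E" "deg (G - {e}) v \<le> deg G v"
      using G vertex_degree_remove[OF fin e, of v] by auto
    then have "\<bar>X v (G - {e}) * K (\<delta> v (G - {e})) w\<bar> \<le> B * ?h v" by (rule abs_X_K_le)
    moreover have "\<bar>X v G * K (\<delta> v G) w\<bar> \<le> B * ?h v" by (rule abs_X_K_le[OF G order_refl])
    ultimately show ?thesis by linarith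
  qed
  have "\<bar>\<Psi> K G w - \<Psi> K (G - {e}) w\<bar> = \<bar>\<Sum>v\<in>V. ?D v\<bar>" by (simp add: \<Psi>_def sum_subtractf)
  also have "\<dots> \<le> (\<Sum>v\<in>V. (if v \<in> e then 2 * B * ?h v else 0)
      + 2 * B * (?h v * real (card (neighbours G v \<inter> e))))"
  proof (rule order_trans[OF sum_abs], rule sum_mono)
    fix v
    consider "v \<in> e" | "v \<notin> e" "neighbours G v \<inter> e = {}" | "v \<notin> e" "neighbours G v \<inter> e \<noteq> {}" by blast
    then show "\<bar>?D v\<bar> \<le> (if v \<in> e then 2 * B * ?h v else 0)
      + 2 * B * (?h v * real (card (neighbours G v \<inter> e)))"
    proof cases
      case 1
      have "0 \<le> 2 * B * (?h v * real (card (neighbours G v \<inter> e)))" using B_nonneg by simp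
      then show ?thesis unfolding if_P[OF 1] using D[of v] by linarith
    next
      case 2
      then have "\<delta> v (G - {e}) = \<delta> v G" using \<delta>_remove[OF G e, of v] by simp
      then show ?thesis using 2 X_remove[OF G e, of v] by simp
    next
      case 3
      then have "1 \<le> card (neighbours G v \<inter> e)"
        using finite_neighbours[OF G] by (simp add: Suc_le_eq card_gt_0_iff)
      then have "2 * B * (?h v * 1) \<le> 2 * B * (?h v * real (card (neighbours G v \<inter> e)))"
        using B_nonneg by (intro mult_left_mono) auto
      then show ?thesis unfolding if_not_P[OF 3(1)] mult_1_right using D[of v] by linarith
    qed
  qed
  also have "\<dots> = (\<Sum>v\<in>e. 2 * B * ?h v) + (\<Sum>v\<in>V. 2 * B * (?h v * real (card (neighbours G v \<inter> e))))"
    unfolding sum.distrib using eV by (simp add: sum.If_cases Int_absorb1 flip: Int_def)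
  finally show ?thesis by (simp add: distrib_left sum_distrib_left)
qed

lemma Mean_\<Psi>_remove_le:
  "Mean (\<lambda>G. \<Sum>e\<in>G. \<bar>\<Psi> K G (w G) - \<Psi> K (G - {e}) (w G)\<bar>) \<le> 6 * B * (real n * M)"
proof -
  have "Mean (\<lambda>G. \<Sum>e\<in>G. \<bar>\<Psi> K G (w G) - \<Psi> K (G - {e}) (w G)\<bar>) \<le>
      Mean (\<lambda>G. 6 * B * (\<Sum>v\<in>V. (1 + real (deg G v)) ^ 4))"
  proof (rule subset_expect_mono[OF p_bounds(1,2)])
    fix G assume G: "G \<subseteq> E"
    let ?a = "\<lambda>v. 1 + real (deg G v)"
    have fin: "finite G" by (rule finite_subset_vertex_pairs[OF G])
    have le4: "real (deg G v) * ?a v ^ k \<le> ?a v ^ 4" if "k \<le> 3" for v k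
    proof -
      have "real (deg G v) * ?a v ^ k \<le> ?a v * ?a v ^ k" by (intro mult_right_mono) auto
      also have "\<dots> = ?a v ^ Suc k" by simp
      also have "\<dots> \<le> ?a v ^ 4" using that by (intro power_increasing) auto
      finally show ?thesis .
    qed
    have 1: "(\<Sum>e\<in>G. \<Sum>v\<in>e. (?a v)\<^sup>2) \<le> (\<Sum>v\<in>V. ?a v ^ 4)"
      unfolding sum_edges_endpoints[OF G] by (intro sum_mono le4) simp
    have card: "(\<Sum>e\<in>G. real (card (neighbours G v \<inter> e))) = (\<Sum>u\<in>neighbours G v. real (deg G u))" for v
    proof -
      have "(\<Sum>e\<in>G. real (card (neighbours G v \<inter> e))) = (\<Sum>e\<in>G. \<Sum>u\<in>e. of_bool (u \<in> neighbours G v))"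
        using G vertex_pairs_finite by (intro sum.cong refl) (auto simp: sum_of_bool_eq Int_commute)
      also have "\<dots> = (\<Sum>u\<in>V. real (deg G u) * of_bool (u \<in> neighbours G v))"
        by (rule sum_edges_endpoints[OF G])
      also have "\<dots> = (\<Sum>u\<in>V. if u \<in> neighbours G v then real (deg G u) else 0)"
        by (intro sum.cong) auto
      also have "\<dots> = (\<Sum>u\<in>neighbours G v. real (deg G u))"
        using neighbours_subset[OF G, of v] by (simp add: sum.If_cases Int_absorb1 flip: Int_def)
      finally show ?thesis .
    qed
    have "(\<Sum>e\<in>G. \<Sum>v\<in>V. (?a v)\<^sup>2 * real (card (neighbours G v \<inter> e))) =
        (\<Sum>v\<in>V. \<Sum>u\<in>neighbours G v. (?a v)\<^sup>2 * real (deg G u))"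
      by (subst sum.swap) (simp add: card flip: sum_distrib_left)
    \<comment> \<open>Mixed moments of adjacent degrees are decoupled by bounding the product by the
      sum of the cubes; symmetry of adjacency then reduces both cubes to the same sum over
      vertices.\<close>
    also have "\<dots> \<le> (\<Sum>v\<in>V. \<Sum>u\<in>neighbours G v. ?a v ^ 3 + ?a u ^ 3)"
    proof (intro sum_mono)
      fix v u
      have cube: "x\<^sup>2 * y \<le> x ^ 3 + y ^ 3" if "0 \<le> x" "0 \<le> y" for x y :: real
      proof (cases "y \<le> x")
        case True
        then have "x\<^sup>2 * y \<le> x\<^sup>2 * x" by (intro mult_left_mono) auto
        then show ?thesis using that by (simp add: power2_eq_square power3_eq_cube add_increasing2)
      next
        case False
        then have "x\<^sup>2 * y \<le> y\<^sup>2 * y" using that by (intro mult_right_mono power_mono) auto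
        then show ?thesis using that by (simp add: power2_eq_square power3_eq_cube add_increasing)
      qed
      have "(?a v)\<^sup>2 * real (deg G u) \<le> (?a v)\<^sup>2 * ?a u" by (intro mult_left_mono) auto
      also have "\<dots> \<le> ?a v ^ 3 + ?a u ^ 3" by (rule cube) auto
      finally show "(?a v)\<^sup>2 * real (deg G u) \<le> ?a v ^ 3 + ?a u ^ 3" .
    qed
    also have "\<dots> = 2 * (\<Sum>v\<in>V. real (deg G v) * ?a v ^ 3)"
      unfolding sum.distrib sum_neighbours[OF G] by (simp add: card_neighbours[OF G])
    also have "\<dots> \<le> 2 * (\<Sum>v\<in>V. ?a v ^ 4)" by (intro mult_left_mono sum_mono le4) auto
    finally have 2: "(\<Sum>e\<in>G. \<Sum>v\<in>V. (?a v)\<^sup>2 * real (card (neighbours G v \<inter> e))) \<le> 2 * (\<Sum>v\<in>V. ?a v ^ 4)" .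
    have "(\<Sum>e\<in>G. \<bar>\<Psi> K G (w G) - \<Psi> K (G - {e}) (w G)\<bar>) \<le>
        (\<Sum>e\<in>G. 2 * B * ((\<Sum>v\<in>e. (?a v)\<^sup>2) + (\<Sum>v\<in>V. (?a v)\<^sup>2 * real (card (neighbours G v \<inter> e)))))"
      by (intro sum_mono \<Psi>_remove[OF G])
    also have "\<dots> = 2 * B * ((\<Sum>e\<in>G. \<Sum>v\<in>e. (?a v)\<^sup>2)
        + (\<Sum>e\<in>G. \<Sum>v\<in>V. (?a v)\<^sup>2 * real (card (neighbours G v \<inter> e))))"
      by (simp only: sum.distrib flip: sum_distrib_left)
    also have "\<dots> \<le> 2 * B * (3 * (\<Sum>v\<in>V. ?a v ^ 4))"
      using 1 2 B_nonneg by (intro mult_left_mono) auto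
    finally show "(\<Sum>e\<in>G. \<bar>\<Psi> K G (w G) - \<Psi> K (G - {e}) (w G)\<bar>) \<le> 6 * B * (\<Sum>v\<in>V. ?a v ^ 4)"
      by simp
  qed
  also have "\<dots> \<le> 6 * B * (real n * M)"
    unfolding subset_expect_cmult using B_nonneg by (intro mult_left_mono Mean_sum_deg_le) auto
  finally show ?thesis .
qed

end

end

section \<open>The error in the Stein equation\<close>

context er_graph begin

abbreviation "\<mu> \<equiv> Mean (\<lambda>G. of_int (W G))"
abbreviation "\<sigma> \<equiv> sqrt (Var (\<lambda>G. of_int (W G)))"

lemma \<sigma>_sq: "\<sigma>\<^sup>2 = Var (\<lambda>G. of_int (W G))"
  by (simp add: subset_var_nonneg p_bounds)

lemma sqrt_Mean_Q_sq_le: "sqrt (Mean (\<lambda>G. (Q G)\<^sup>2)) \<le> real n * sqrt M"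
  using real_sqrt_le_mono[OF Mean_Q_sq_le] by (simp add: real_sqrt_mult)

text \<open>The Stein expansion is split into \<open>Z * g\<close>, a unit difference of
  \<open>\<Psi>\<close> and a remainder. As \<open>Z\<close> has mean equal to the variance of
  \<open>W\<close>, only its fluctuation survives against that variance times \<open>g\<close>. The
  three summands of the bound belong to the unit difference, the remainder and the fluctuation, in
  this order.\<close>

lemma Stein_bound:
  fixes f g :: "int \<Rightarrow> real"
  assumes \<sigma>: "1 \<le> \<sigma>" and q: "0 < q" and g: "\<And>z. \<bar>g z\<bar> \<le> B" and b: "0 \<le> b"
    and fg: "\<And>z. \<bar>f z - f (z - 1) - (g z + g (z - 1)) / 2\<bar> \<le> b * (1 + \<bar>of_int z - \<mu>\<bar> / \<sigma>)"
  shows "\<bar>Mean (\<lambda>G. \<sigma>\<^sup>2 * g (W G) - (of_int (W G) - \<mu>) * f (W G))\<bar> \<le>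
    B * ((sqrt (Var Tminus) + sqrt (Var Tplus)) * (real n * sqrt M) + 6 * real n * M) / q
    + 4 * b * (real n * sqrt M) + B * sqrt (Var Z)"
proof -
  obtain K :: "int \<Rightarrow> int \<Rightarrow> real" where K: "\<And>k w. \<bar>K k w\<bar> \<le> B * (of_int k)\<^sup>2"
    and K': "\<And>k w. \<bar>f w - f (w - k) - of_int k * g w - (K k w - K k (w - 1))\<bar>
        \<le> 2 * b * (of_int k)\<^sup>2 * (1 + \<bar>of_int w - \<mu>\<bar> / \<sigma>)"
    by (rule telescoping_kernel[OF g \<sigma> b fg]) (rule that)
  have B: "0 \<le> B" using g[of 0] by linarith
  define r where "r k w = f w - f (w - k) - of_int k * g w - (K k w - K k (w - 1))" for k w
  define R where "R G = (\<Sum>v\<in>V. X v G * r (\<delta> v G) (W G))" for G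
  define a where "a G = \<bar>of_int (W G) - \<mu>\<bar> / \<sigma>" for G
  have a: "0 \<le> a G" for G using \<sigma> by (simp add: a_def)
  have pointwise: "(\<Sum>v\<in>V. X v G * (f (W G) - f (W G - \<delta> v G))) =
      Z G * g (W G) + (\<Psi> K G (W G) - \<Psi> K G (W G - 1)) + R G" for G
  proof -
    have "(\<Sum>v\<in>V. X v G * (f (W G) - f (W G - \<delta> v G))) = (\<Sum>v\<in>V. X v G * of_int (\<delta> v G) * g (W G)
        + (X v G * K (\<delta> v G) (W G) - X v G * K (\<delta> v G) (W G - 1)) + X v G * r (\<delta> v G) (W G))"
      by (intro sum.cong refl) (simp add: r_def algebra_simps)
    then show ?thesis
      by (simp only: Z_def \<Psi>_def R_def sum.distrib sum_subtractf sum_distrib_right)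
  qed
  have Zm: "Mean Z = \<sigma>\<^sup>2" using Mean_Z \<sigma>_sq by simp
  have "Mean (\<lambda>G. \<sigma>\<^sup>2 * g (W G) - (of_int (W G) - \<mu>) * f (W G)) =
      \<sigma>\<^sup>2 * Mean (\<lambda>G. g (W G)) - (Mean (\<lambda>G. Z G * g (W G)) +
        Mean (\<lambda>G. \<Psi> K G (W G) - \<Psi> K G (W G - 1)) + Mean R)"
    unfolding subset_expect_diff[of _ _ "\<lambda>G. \<sigma>\<^sup>2 * g (W G)"] Stein_expansion pointwise
    by (simp only: subset_expect_add subset_expect_cmult)
  also have "\<dots> = - Mean (\<lambda>G. (Z G - Mean Z) * g (W G))
      - Mean (\<lambda>G. \<Psi> K G (W G) - \<Psi> K G (W G - 1)) - Mean R"
  proof -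
    have "Mean (\<lambda>G. (Z G - Mean Z) * g (W G)) = Mean (\<lambda>G. Z G * g (W G)) - \<sigma>\<^sup>2 * Mean (\<lambda>G. g (W G))"
      unfolding Zm left_diff_distrib subset_expect_diff[of _ _ "\<lambda>G. Z G * g (W G)"] subset_expect_cmult ..
    then show ?thesis by linarith
  qed
  finally have eq: "Mean (\<lambda>G. \<sigma>\<^sup>2 * g (W G) - (of_int (W G) - \<mu>) * f (W G)) =
    - Mean (\<lambda>G. (Z G - Mean Z) * g (W G))
      - Mean (\<lambda>G. \<Psi> K G (W G) - \<Psi> K G (W G - 1)) - Mean R" .
  have 1: "\<bar>Mean (\<lambda>G. (Z G - Mean Z) * g (W G))\<bar> \<le> B * sqrt (Var Z)"
  proof -
    have "\<bar>Mean (\<lambda>G. (Z G - Mean Z) * g (W G))\<bar> \<le>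
        sqrt (Mean (\<lambda>G. (Z G - Mean Z)\<^sup>2)) * sqrt (Mean (\<lambda>G. (g (W G))\<^sup>2))"
      by (rule subset_expect_Cauchy_Schwarz[OF p_bounds(1,2)])
    also have "\<dots> \<le> sqrt (Var Z) * B"
      unfolding subset_var_def
    proof (rule mult_left_mono)
      have "Mean (\<lambda>G. (g (W G))\<^sup>2) \<le> Mean (\<lambda>G. B\<^sup>2)"
      proof (rule subset_expect_mono[OF p_bounds(1,2)])
        show "(g (W G))\<^sup>2 \<le> B\<^sup>2" for G using power_mono[OF g[of "W G"], of 2] by simp
      qed
      then have "Mean (\<lambda>G. (g (W G))\<^sup>2) \<le> B\<^sup>2" by simp
      then show "sqrt (Mean (\<lambda>G. (g (W G))\<^sup>2)) \<le> B" using B by (rule real_le_lsqrt[rotated 1])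
      show "0 \<le> sqrt (Mean (\<lambda>G. (Z G - Mean Z)\<^sup>2))"
        by (intro real_sqrt_ge_zero subset_expect_nonneg p_bounds(1,2)) simp
    qed
    finally show ?thesis by (simp only: mult.commute)
  qed
  have 2: "\<bar>Mean R\<bar> \<le> 4 * b * (real n * sqrt M)"
  proof -
    have "\<bar>Mean R\<bar> \<le> Mean (\<lambda>G. 2 * b * (Q G * (1 + a G)))"
    proof (rule abs_subset_expect_le[OF p_bounds(1,2)])
      fix G assume G: "G \<subseteq> E"
      have "\<bar>R G\<bar> \<le> (\<Sum>v\<in>V. 2 * b * (1 + real (deg G v))\<^sup>2 * (1 + a G))"
        unfolding R_def
      proof (rule order_trans[OF sum_abs], rule sum_mono)
        fix v
        have "\<bar>of_int (\<delta> v G)\<bar>\<^sup>2 \<le> (1 + real (deg G v))\<^sup>2"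
          by (intro power_mono abs_\<delta>_le[OF G]) simp
        then have "2 * b * (of_int (\<delta> v G))\<^sup>2 * (1 + a G) \<le> 2 * b * (1 + real (deg G v))\<^sup>2 * (1 + a G)"
          using b a[of G] by (intro mult_right_mono mult_left_mono) auto
        then have "\<bar>r (\<delta> v G) (W G)\<bar> \<le> 2 * b * (1 + real (deg G v))\<^sup>2 * (1 + a G)"
          using K'[where k = "\<delta> v G" and w = "W G"] unfolding r_def a_def by linarith
        then have "\<bar>X v G\<bar> * \<bar>r (\<delta> v G) (W G)\<bar> \<le> 1 * (2 * b * (1 + real (deg G v))\<^sup>2 * (1 + a G))"
          by (intro mult_mono abs_X_le) auto
        then show "\<bar>X v G * r (\<delta> v G) (W G)\<bar> \<le> 2 * b * (1 + real (deg G v))\<^sup>2 * (1 + a G)"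
          by (simp only: abs_mult mult_1)
      qed
      then show "\<bar>R G\<bar> \<le> 2 * b * (Q G * (1 + a G))"
        by (simp add: Q_def sum_distrib_left sum_distrib_right mult.assoc)
    qed
    also have "\<dots> = 2 * b * Mean (\<lambda>G. Q G * (1 + a G))" by (rule subset_expect_cmult)
    also have "\<dots> \<le> 2 * b * (real n * sqrt M * 2)"
    proof (rule mult_left_mono)
      have "Mean (\<lambda>G. Q G * (1 + a G)) \<le> sqrt (Mean (\<lambda>G. (Q G)\<^sup>2)) * sqrt (Mean (\<lambda>G. (1 + a G)\<^sup>2))"
        using subset_expect_Cauchy_Schwarz[OF p_bounds(1,2), of E Q "\<lambda>G. 1 + a G"] by linarith
      also have "\<dots> \<le> (real n * sqrt M) * 2"
      proof (rule mult_mono[OF sqrt_Mean_Q_sq_le])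
        \<comment> \<open>\<open>a\<close> is the standardised distance of \<open>W\<close> from its
          mean, so its second moment is 1 and the mean of the squared \<open>1 + a\<close> is at
          most 4.\<close>
        have "Mean (\<lambda>G. (1 + a G)\<^sup>2) \<le> Mean (\<lambda>G. 2 + 2 / \<sigma>\<^sup>2 * (of_int (W G) - \<mu>)\<^sup>2)"
        proof (rule subset_expect_mono[OF p_bounds(1,2)])
          fix G
          have "(1 + a G)\<^sup>2 \<le> 2 + 2 * (a G)\<^sup>2"
            using sum_squares_bound[of 1 "a G"] by (simp add: power2_eq_square algebra_simps)
          also have "(a G)\<^sup>2 = (of_int (W G) - \<mu>)\<^sup>2 / \<sigma>\<^sup>2" by (simp only: a_def power_divide power2_abs)
          finally show "(1 + a G)\<^sup>2 \<le> 2 + 2 / \<sigma>\<^sup>2 * (of_int (W G) - \<mu>)\<^sup>2" by simp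
        qed
        also have "\<dots> = 2 + 2 / \<sigma>\<^sup>2 * \<sigma>\<^sup>2"
          unfolding subset_expect_add subset_expect_cmult \<sigma>_sq unfolding subset_var_def by simp
        also have "\<dots> = 2\<^sup>2" using \<sigma> by (simp del: real_sqrt_pow2_iff)
        finally show "sqrt (Mean (\<lambda>G. (1 + a G)\<^sup>2)) \<le> 2" by (rule real_le_lsqrt[rotated 1]) simp
        show "0 \<le> sqrt (Mean (\<lambda>G. (1 + a G)\<^sup>2))"
          by (intro real_sqrt_ge_zero subset_expect_nonneg p_bounds(1,2)) simp
      qed (use M_nonneg in auto)
      finally show "Mean (\<lambda>G. Q G * (1 + a G)) \<le> real n * sqrt M * 2" .
    qed (use b in simp)
    finally show ?thesis by simp
  qed
  have 3: "\<bar>Mean (\<lambda>G. \<Psi> K G (W G) - \<Psi> K G (W G - 1))\<bar> \<le>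
      B * ((sqrt (Var Tminus) + sqrt (Var Tplus)) * (real n * sqrt M) + 6 * real n * M) / q"
  proof -
    let ?s = "sqrt (Var Tminus) + sqrt (Var Tplus)"
    have s: "0 \<le> ?s"
      by (intro add_nonneg_nonneg real_sqrt_ge_zero subset_var_nonneg p_bounds(1,2))
    have "q * \<bar>Mean (\<lambda>G. \<Psi> K G (W G) - \<Psi> K G (W G - 1))\<bar> \<le>
        ?s * sqrt (Mean (\<lambda>G. (B * Q G)\<^sup>2))
        + Mean (\<lambda>G. \<Sum>e\<in>G. \<bar>\<Psi> K G (W G) - \<Psi> K (G - {e}) (W G)\<bar>)"
      by (rule smoothing) (rule abs_\<Psi>_le[OF K])
    also have "\<dots> \<le> ?s * (B * (real n * sqrt M)) + 6 * B * (real n * M)"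
    proof (rule add_mono)
      have "sqrt (Mean (\<lambda>G. (B * Q G)\<^sup>2)) = B * sqrt (Mean (\<lambda>G. (Q G)\<^sup>2))"
        using B by (simp only: power_mult_distrib subset_expect_cmult real_sqrt_mult real_sqrt_abs abs_of_nonneg)
      then show "?s * sqrt (Mean (\<lambda>G. (B * Q G)\<^sup>2)) \<le> ?s * (B * (real n * sqrt M))"
        using mult_left_mono[OF sqrt_Mean_Q_sq_le B] s by (intro mult_left_mono) auto
      show "Mean (\<lambda>G. \<Sum>e\<in>G. \<bar>\<Psi> K G (W G) - \<Psi> K (G - {e}) (W G)\<bar>) \<le> 6 * B * (real n * M)"
        by (rule Mean_\<Psi>_remove_le[OF K])
    qed
    also have "\<dots> = B * (?s * (real n * sqrt M) + 6 * real n * M)"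
      by (simp only: distrib_left mult_ac)
    finally show ?thesis using q by (simp only: pos_le_divide_eq mult.commute)
  qed
  show ?thesis unfolding eq using 1 2 3 by linarith
qed

section \<open>Lower bounds for the variance of \<open>W\<close> and for \<open>q\<close>\<close>

lemma star_facts:
  assumes e: "{u, v} \<in> E" "u \<noteq> v"
  defines "S \<equiv> {f \<in> E - {{u, v}}. u \<in> f}" and "T \<equiv> {f \<in> E - {{u, v}}. v \<in> f}"
  shows "S \<inter> T = {}" "card S = n - 2" "card T = n - 2"
    and "\<And>G. G \<subseteq> E \<Longrightarrow> deg (G - {{u, v}}) u = card (G \<inter> S)"
    and "\<And>G. G \<subseteq> E \<Longrightarrow> deg (G - {{u, v}}) v = card (G \<inter> T)"
proof -
  have uv: "u \<in> V" "v \<in> V" using vertex_pairs_subset[OF e(1)] by auto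
  show "S \<inter> T = {}"
  proof (rule equals0I)
    fix f assume "f \<in> S \<inter> T"
    then have f: "f \<in> E" "u \<in> f" "v \<in> f" "f \<noteq> {u, v}" by (auto simp: S_def T_def)
    then show False using vertex_pair_eqI[OF f(1-3) e(2)] by simp
  qed
  have "S = {f \<in> E. u \<in> f} - {{u, v}}" "T = {f \<in> E. v \<in> f} - {{u, v}}" by (auto simp: S_def T_def)
  then show "card S = n - 2" "card T = n - 2"
    using card_star[OF uv(1)] card_star[OF uv(2)] e by (simp_all add: card_Diff_singleton)
  fix G assume G: "G \<subseteq> E"
  have "{f \<in> G - {{u, v}}. u \<in> f} = G \<inter> S" "{f \<in> G - {{u, v}}. v \<in> f} = G \<inter> T"
    using G by (auto simp: S_def T_def)
  then show "deg (G - {{u, v}}) u = card (G \<inter> S)" "deg (G - {{u, v}}) v = card (G \<inter> T)"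
    by (simp_all add: vertex_degree_def)
qed

lemma pair_in_E: "u \<in> V \<Longrightarrow> v \<in> V \<Longrightarrow> u \<noteq> v \<Longrightarrow> {u, v} \<in> E"
  by (simp add: vertex_pairs_def)

text \<open>Given the status of the pair \<open>{u, v}\<close>, the two degrees are independent and
  identically distributed, since they read disjoint sets of \<open>n - 2\<close> further pairs. The
  covariance is therefore the variance of the conditional probability, \<open>p * (1 - p)\<close>
  times the square of \<open>\<alpha>1 - \<alpha>0\<close>.\<close>

lemma Mean_X_mult_nonneg:
  assumes uv: "u \<in> V" "v \<in> V" "u \<noteq> v"
  shows "0 \<le> Mean (\<lambda>G. X u G * X v G)"
proof -
  let ?e = "{u, v}" and ?E' = "E - {{u, v}}"
  have e: "?e \<in> E" by (rule pair_in_E[OF uv])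
  define S where "S = {f \<in> ?E'. u \<in> f}"
  define T where "T = {f \<in> ?E'. v \<in> f}"
  note st = star_facts[OF e uv(3), folded S_def T_def]
  define y where "y j = (of_bool (j = d) :: real)" for j :: nat
  let ?M = "subset_expect p ?E'"
  have deg0: "deg G u = card (G \<inter> S)" "deg G v = card (G \<inter> T)" if "G \<subseteq> ?E'" for G
  proof -
    have "G \<subseteq> E" "G - {?e} = G" using that by auto
    then show "deg G u = card (G \<inter> S)" "deg G v = card (G \<inter> T)" using st(4,5)[of G] by simp_all
  qed
  have deg1: "deg (insert ?e G) u = Suc (card (G \<inter> S))" "deg (insert ?e G) v = Suc (card (G \<inter> T))"
    if "G \<subseteq> ?E'" for G
  proof -
    have "finite (insert ?e G)" "insert ?e G - {?e} = G"
      using that finite_subset[OF that] by auto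
    then show "deg (insert ?e G) u = Suc (card (G \<inter> S))" "deg (insert ?e G) v = Suc (card (G \<inter> T))"
      using vertex_degree_remove[of "insert ?e G" ?e] deg0[OF that] by simp_all
  qed
  define \<alpha>1 where "\<alpha>1 = ?M (\<lambda>G. y (Suc (card (G \<inter> S))))"
  define \<alpha>0 where "\<alpha>0 = ?M (\<lambda>G. y (card (G \<inter> S)))"
  have fin: "finite ?E'" by simp
  have sub: "S \<subseteq> ?E'" "T \<subseteq> ?E'" by (auto simp: S_def T_def)
  have T: "?M (\<lambda>G. \<psi> (card (G \<inter> T))) = ?M (\<lambda>G. \<psi> (card (G \<inter> S)))" for \<psi>
    by (simp only: subset_expect_card_eq[OF fin sub(1)] subset_expect_card_eq[OF fin sub(2)] st(2,3))
  have "\<pi> u = p * ?M (\<lambda>G. y (deg (insert ?e G) u)) + (1 - p) * ?M (\<lambda>G. y (deg G u))"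
    unfolding \<pi>_def y_def by (rule subset_expect_remove[OF finite_vertex_pairs e])
  also have "\<dots> = p * \<alpha>1 + (1 - p) * \<alpha>0"
    by (simp add: \<alpha>1_def \<alpha>0_def deg1 deg0 cong: subset_expect_cong)
  finally have pu: "\<pi> u = p * \<alpha>1 + (1 - p) * \<alpha>0" .
  have "\<pi> v = p * ?M (\<lambda>G. y (deg (insert ?e G) v)) + (1 - p) * ?M (\<lambda>G. y (deg G v))"
    unfolding \<pi>_def y_def by (rule subset_expect_remove[OF finite_vertex_pairs e])
  also have "\<dots> = p * ?M (\<lambda>G. y (Suc (card (G \<inter> T)))) + (1 - p) * ?M (\<lambda>G. y (card (G \<inter> T)))"
    by (simp add: deg1 deg0 cong: subset_expect_cong)
  also have "\<dots> = p * \<alpha>1 + (1 - p) * \<alpha>0"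
    by (simp only: \<alpha>1_def \<alpha>0_def T[of y] T[of "\<lambda>j. y (Suc j)"])
  finally have pv: "\<pi> v = p * \<alpha>1 + (1 - p) * \<alpha>0" .
  have "Mean (\<lambda>G. y (deg G u) * y (deg G v)) =
      p * ?M (\<lambda>G. y (deg (insert ?e G) u) * y (deg (insert ?e G) v)) + (1 - p) * ?M (\<lambda>G. y (deg G u) * y (deg G v))"
    by (rule subset_expect_remove[OF finite_vertex_pairs e])
  also have "\<dots> = p * ?M (\<lambda>G. y (Suc (card (G \<inter> S))) * y (Suc (card (G \<inter> T))))
      + (1 - p) * ?M (\<lambda>G. y (card (G \<inter> S)) * y (card (G \<inter> T)))"
    by (simp add: deg1 deg0 cong: subset_expect_cong)
  also have "\<dots> = p * (\<alpha>1 * \<alpha>1) + (1 - p) * (\<alpha>0 * \<alpha>0)"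
    by (simp only: subset_expect_card_indep[OF fin st(1), of p y y] \<alpha>1_def \<alpha>0_def T[of y] T[of "\<lambda>j. y (Suc j)"]
      subset_expect_card_indep[OF fin st(1), of p "\<lambda>j. y (Suc j)" "\<lambda>j. y (Suc j)"])
  finally have puv: "Mean (\<lambda>G. y (deg G u) * y (deg G v)) = p * (\<alpha>1 * \<alpha>1) + (1 - p) * (\<alpha>0 * \<alpha>0)" .
  have "Mean (\<lambda>G. X u G * X v G) = Mean (\<lambda>G. y (deg G u) * y (deg G v)
      - \<pi> v * y (deg G u) - \<pi> u * y (deg G v) + \<pi> u * \<pi> v)"
    by (rule subset_expect_cong) (simp add: X_def y_def algebra_simps)
  also have "\<dots> = Mean (\<lambda>G. y (deg G u) * y (deg G v)) - \<pi> u * \<pi> v"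
    unfolding subset_expect_add subset_expect_diff subset_expect_cmult
    by (simp add: y_def \<pi>_def)
  also have "\<dots> = p * (1 - p) * (\<alpha>1 - \<alpha>0)\<^sup>2"
    unfolding puv pu pv by (simp add: power2_eq_square algebra_simps)
  finally show ?thesis using p_bounds by simp
qed

text \<open>All covariances are nonnegative, so the diagonal alone is a lower bound.\<close>

lemma Var_W_ge: "(\<Sum>v\<in>V. \<pi> v * (1 - \<pi> v)) \<le> Var (\<lambda>G. of_int (W G))"
proof -
  have diag: "Mean (\<lambda>G. X v G * X v G) = \<pi> v * (1 - \<pi> v)" for v
  proof -
    have "Mean (\<lambda>G. X v G * X v G) = Mean (\<lambda>G. (1 - 2 * \<pi> v) * of_bool (deg G v = d) + \<pi> v * \<pi> v)"
      by (rule subset_expect_cong) (auto simp: X_def algebra_simps)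
    also have "\<dots> = (1 - 2 * \<pi> v) * \<pi> v + \<pi> v * \<pi> v"
      unfolding subset_expect_add subset_expect_cmult by (simp add: \<pi>_def)
    finally show ?thesis by (simp add: algebra_simps)
  qed
  have "Var (\<lambda>G. of_int (W G)) = Mean (\<lambda>G. \<Sum>u\<in>V. \<Sum>v\<in>V. X u G * X v G)"
    unfolding subset_var_def Mean_W
    by (rule subset_expect_cong) (simp add: W_real X_def sum_subtractf power2_eq_square
      flip: sum_product)
  also have "\<dots> = (\<Sum>u\<in>V. \<Sum>v\<in>V. Mean (\<lambda>G. X u G * X v G))"
    by (simp only: subset_expect_sum)
  also have "\<dots> \<ge> (\<Sum>u\<in>V. Mean (\<lambda>G. X u G * X u G))"
  proof (rule sum_mono)
    fix u assume u: "u \<in> V"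
    show "Mean (\<lambda>G. X u G * X u G) \<le> (\<Sum>v\<in>V. Mean (\<lambda>G. X u G * X v G))"
      by (rule member_le_sum[OF u]) (use u Mean_X_mult_nonneg in auto)
  qed
  finally show ?thesis by (simp add: diag)
qed

lemma Mean_deg_eq:
  assumes "v \<in> V" shows "Mean (\<lambda>G. of_bool (deg G v = k)) = binom_prob p (n - 1) k"
proof -
  have "Mean (\<lambda>G. of_bool (deg G v = k)) = Mean (\<lambda>G. of_bool (card (G \<inter> {e \<in> E. v \<in> e}) = k))"
  proof (rule subset_expect_cong)
    fix G assume "G \<subseteq> E"
    then have "{e \<in> G. v \<in> e} = G \<inter> {e \<in> E. v \<in> e}" by auto
    then show "of_bool (deg G v = k) = (of_bool (card (G \<inter> {e \<in> E. v \<in> e}) = k) :: real)"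
      by (simp add: vertex_degree_def)
  qed
  also have "\<dots> = binom_prob p (n - 1) k"
    using subset_expect_card_eq_of_bool[of E "{e \<in> E. v \<in> e}" p k] card_star[OF assms] by simp
  finally show ?thesis .
qed

text \<open>Degree \<open>d + 1\<close> excludes degree \<open>d\<close>; hence its probability
  bounds \<open>1 - \<pi> v\<close> from below, just as that of degree \<open>d\<close> bounds
  \<open>\<pi> v\<close>.\<close>

lemma Var_W_lower:
  assumes c: "0 \<le> c" "c \<le> binom_prob p (n - 1) d" "c \<le> binom_prob p (n - 1) (d + 1)"
  shows "real n * c\<^sup>2 \<le> Var (\<lambda>G. of_int (W G))"
proof -
  have "(\<Sum>v\<in>V. c\<^sup>2) \<le> (\<Sum>v\<in>V. \<pi> v * (1 - \<pi> v))"
  proof (rule sum_mono)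
    fix v assume v: "v \<in> V"
    have "Mean (\<lambda>G. of_bool (deg G v = d) + of_bool (deg G v = d + 1)) \<le> Mean (\<lambda>_. 1)"
      by (rule subset_expect_mono[OF p_bounds(1,2)]) auto
    then have "binom_prob p (n - 1) d + binom_prob p (n - 1) (d + 1) \<le> 1"
      by (simp add: subset_expect_add Mean_deg_eq[OF v] del: One_nat_def add_Suc_right)
    moreover have "\<pi> v = binom_prob p (n - 1) d" unfolding \<pi>_def by (rule Mean_deg_eq[OF v])
    ultimately have "c \<le> \<pi> v" "c \<le> 1 - \<pi> v" using c by linarith+
    then show "c\<^sup>2 \<le> \<pi> v * (1 - \<pi> v)"
      unfolding power2_eq_square using c(1) \<pi>_bounds[of v] by (intro mult_mono) auto
  qed
  then show ?thesis using Var_W_ge by simp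
qed

text \<open>The Mecke formula turns \<open>q\<close> into \<open>p\<close> times a sum over all
  \<open>n * (n - 1) / 2\<close> pairs. For each pair it suffices that a fixed endpoint has
  \<open>d\<close> and the other \<open>d + 1\<close> further edges; these events are independent as
  the two stars are disjoint.\<close>

lemma q_lower:
  assumes c: "0 \<le> c" "c \<le> binom_prob p (n - 2) d" "c \<le> binom_prob p (n - 2) (d + 1)"
  shows "p * real (n - 1) * real n / 2 * c\<^sup>2 \<le> q"
proof -
  have card: "2 * real (card E) = real n * real (n - 1)"
  proof -
    have "2 * real (card E) = (\<Sum>e\<in>E. \<Sum>v\<in>e. 1)" by (simp add: vertex_pairs_card)
    also have "\<dots> = (\<Sum>v\<in>V. real (deg E v) * 1)" by (rule sum_edges_endpoints) simp
    also have "\<dots> = (\<Sum>v\<in>V. real (n - 1))"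
      by (intro sum.cong refl) (simp add: vertex_degree_def card_star)
    also have "\<dots> = real n * real (n - 1)" by (cases n) simp_all
    finally show ?thesis .
  qed
  have "(\<Sum>e\<in>E. c\<^sup>2) \<le> (\<Sum>e\<in>E. Mean (\<lambda>G. lowering e (insert e G)))"
  proof (rule sum_mono)
    fix e assume e: "e \<in> E"
    then obtain a b where ab: "e = {a, b}" "a \<noteq> b" using vertex_pairs_card[OF e] by (auto simp: card_2_iff)
    define S where "S = {f \<in> E - {{a, b}}. a \<in> f}"
    define T where "T = {f \<in> E - {{a, b}}. b \<in> f}"
    have "{a, b} \<in> E" using e ab by simp
    note st = star_facts[OF this ab(2), folded S_def T_def]
    have "c\<^sup>2 \<le> binom_prob p (n - 2) d * binom_prob p (n - 2) (d + 1)"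
      unfolding power2_eq_square using c by (intro mult_mono) auto
    also have "\<dots> = Mean (\<lambda>G. of_bool (card (G \<inter> S) = d)) * Mean (\<lambda>G. of_bool (card (G \<inter> T) = d + 1))"
      using subset_expect_card_eq_of_bool[of E S p d] subset_expect_card_eq_of_bool[of E T p "d + 1"] st(2,3)
      by (simp add: S_def T_def subset_iff)
    also have "\<dots> = Mean (\<lambda>G. of_bool (card (G \<inter> S) = d) * of_bool (card (G \<inter> T) = d + 1))"
      by (rule subset_expect_card_indep[OF finite_vertex_pairs st(1), symmetric])
    also have "\<dots> \<le> Mean (\<lambda>G. lowering e (insert e G))"
    proof (rule subset_expect_mono[OF p_bounds(1,2)])
      fix G assume G: "G \<subseteq> E"
      show "of_bool (card (G \<inter> S) = d) * of_bool (card (G \<inter> T) = d + 1) \<le> lowering e (insert e G)"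
      proof (cases "card (G \<inter> S) = d \<and> card (G \<inter> T) = d + 1")
        case True
        then have "deg (insert e G - {e}) a = d" "deg (insert e G - {e}) b = d + 1"
          using st(4,5)[OF G] ab(1) by simp_all
        then have "lowering e (insert e G) = 1" unfolding lowering_def using ab(1) by (auto simp del: insert_Diff_single)
        then show ?thesis by simp
      qed (auto simp: lowering_bounds)
    qed
    finally show "c\<^sup>2 \<le> Mean (\<lambda>G. lowering e (insert e G))" .
  qed
  then have "p * (real (card E) * c\<^sup>2) \<le> p * (\<Sum>e\<in>E. Mean (\<lambda>G. lowering e (insert e G)))"
    using p_pos by (intro mult_left_mono) auto
  also have "\<dots> = q"
    unfolding q_def Tminus_def by (rule subset_expect_Mecke[OF finite_vertex_pairs, symmetric])
  also have "p * (real (card E) * c\<^sup>2) = p * real (n - 1) * real n / 2 * c\<^sup>2"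
    using card by (simp add: field_simps)
  finally show ?thesis .
qed

end

text \<open>Combines \<open>m choose k \<ge> (m / k) ^ k\<close> with
  \<open>1 - p \<ge> exp (- 2 * p)\<close>. For \<open>k = 0\<close> the first factor is
  \<open>0 ^ 0 = 1\<close>, because division by zero gives zero.\<close>

lemma binom_prob_lower:
  assumes "0 < p" "p \<le> 1 / 2" "k \<le> m" "0 \<le> \<tau>" "\<tau> \<le> real m * p" "real m * p \<le> L"
  shows "(\<tau> / real k) ^ k * exp (- 2 * L) \<le> binom_prob p m k"
proof -
  have "(\<tau> / real k) ^ k \<le> (real m * p / real k) ^ k"
    using assms by (intro power_mono divide_right_mono) auto
  also have "\<dots> = (real m / real k) ^ k * p ^ k" by (simp add: power_mult_distrib power_divide)
  also have "\<dots> \<le> real (m choose k) * p ^ k"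
    using assms binomial_ge_n_over_k_pow_k[OF \<open>k \<le> m\<close>, where 'a = real] by (intro mult_right_mono) auto
  finally have 1: "(\<tau> / real k) ^ k \<le> real (m choose k) * p ^ k" .
  \<comment> \<open>Absorbs the quadratic term of the standard lower bound of
    \<open>ln (1 - p)\<close> for \<open>p \<le> 1 / 2\<close> into the linear one.\<close>
  have "2 * p\<^sup>2 \<le> p"
    using mult_left_mono[of "2 * p" 1 p] assms by (simp add: power2_eq_square algebra_simps)
  then have "- (2 * p) \<le> ln (1 - p)"
    using ln_one_minus_pos_lower_bound[of p] assms by linarith
  then have "exp (- (2 * p)) \<le> 1 - p"
    using assms by (simp add: ln_ge_iff)
  then have "exp (- (2 * p)) ^ (m - k) \<le> (1 - p) ^ (m - k)" by (intro power_mono) auto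
  moreover have "exp (- 2 * L) \<le> exp (- (2 * p)) ^ (m - k)"
  proof -
    have "real (m - k) * (2 * p) \<le> real m * (2 * p)" using assms by (intro mult_right_mono) auto
    also have "\<dots> \<le> 2 * L" using assms by simp
    finally have "- 2 * L \<le> real (m - k) * - (2 * p)" by simp
    then show ?thesis unfolding exp_of_nat_mult[symmetric] by (simp only: exp_le_cancel_iff)
  qed
  ultimately have 2: "exp (- 2 * L) \<le> (1 - p) ^ (m - k)" by linarith
  show ?thesis unfolding binom_prob_def
    using assms by (intro mult_mono 1 2) auto
qed

section \<open>The bound in total variation and the choice of constants\<close>

lemma law_pmf_measure:
  assumes "S \<in> sets borel"
  shows "measure (law P X) S = measure (measure_pmf P) (X -` S)"
  using assms by (simp add: law_def measure_distr)

lemma prob_space_law: "prob_space (law P X)"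
  unfolding law_def by (rule prob_space.prob_space_distr[OF prob_space_measure_pmf]) simp

lemma tv_dist_le:
  assumes "\<And>S. S \<in> sets borel \<Longrightarrow> \<bar>measure N S - measure N' S\<bar> \<le> r"
  shows "tv_dist N N' \<le> r"
  unfolding tv_dist_def using assms by (intro cSUP_least) (auto intro: sets.empty_sets)

lemma tv_dist_law_le_1: "tv_dist (law P X) (law P' Y) \<le> 1"
proof (rule tv_dist_le)
  fix S
  interpret N: prob_space "law P X" by (rule prob_space_law)
  interpret N': prob_space "law P' Y" by (rule prob_space_law)
  show "\<bar>measure (law P X) S - measure (law P' Y) S\<bar> \<le> 1"
    using N.prob_le_1[of S] N'.prob_le_1[of S] measure_nonneg[of "law P X" S] measure_nonneg[of "law P' Y" S]
    by linarith
qed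

text \<open>The three summands of \<open>Stein_bound\<close> with \<open>1 / sqrt n\<close> taken
  out, after inserting the Stein bounds on \<open>g\<close> and its remainder, the variance bounds,
  and \<open>n * c\<close> as a lower bound of both the variance of \<open>W\<close> and
  \<open>q\<close>.\<close>

definition tv_const :: "real \<Rightarrow> real \<Rightarrow> real \<Rightarrow> real" where
  "tv_const M L c = 2 / c\<^sup>2 * ((sqrt 2 + sqrt 32 * L) * M + 6 * M) + 8 * sqrt M / (c * sqrt c)
    + 2 * sqrt 72 * sqrt M / c"

context er_graph begin

lemma normal_approximation:
  assumes c: "0 < c" "1 \<le> real n * c" "real n * c \<le> Var (\<lambda>G. of_int (W G))" "real n * c \<le> q"
  shows "\<bar>Mean (\<lambda>G. indicator U (W G))
      - measure (measure_pmf (discretized_normal \<mu> (Var (\<lambda>G. of_int (W G))))) U\<bar>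
    \<le> tv_const M L c / sqrt (real n)"
proof -
  have n: "1 \<le> real n" using c by (cases n) auto
  \<comment> \<open>Every quantity is expressed by powers of \<open>s\<close>, so that each error
    visibly loses exactly one power. The hypothesis \<open>1 \<le> n * c\<close> provides
    \<open>\<sigma> \<ge> 1\<close> for the Stein equation.\<close>
  define s where "s = sqrt (real n)"
  have s: "0 < s" "1 \<le> s" "s\<^sup>2 = real n" using n by (auto simp: s_def)
  have "1 \<le> Var (\<lambda>G. of_int (W G))" using c by linarith
  then have \<sigma>: "1 \<le> \<sigma>" by simp
  have q: "0 < q" using c by linarith
  obtain f g :: "int \<Rightarrow> real" where
    st: "\<And>z. \<sigma>\<^sup>2 * g z - (of_int z - \<mu>) * f z =
      indicator U z - measure (measure_pmf (discretized_normal \<mu> (\<sigma>\<^sup>2))) U"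
    and g: "\<And>z. \<bar>g z\<bar> \<le> 2 / \<sigma>\<^sup>2"
    and fg: "\<And>z. \<bar>f z - f (z - 1) - (g z + g (z - 1)) / 2\<bar> \<le> 2 / \<sigma> ^ 3 * (1 + \<bar>of_int z - \<mu>\<bar> / \<sigma>)"
    by (rule discretized_normal_Stein[OF \<sigma>, of \<mu> U]) (rule that)
  have "0 \<le> 2 / \<sigma> ^ 3" using \<sigma> by simp
  note bound = Stein_bound[OF \<sigma> q g this fg]
  have "Mean (\<lambda>G. \<sigma>\<^sup>2 * g (W G) - (of_int (W G) - \<mu>) * f (W G)) =
      Mean (\<lambda>G. indicator U (W G)) - measure (measure_pmf (discretized_normal \<mu> (\<sigma>\<^sup>2))) U"
    by (simp only: st subset_expect_diff subset_expect_const[OF finite_vertex_pairs])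
  moreover have "discretized_normal \<mu> (\<sigma>\<^sup>2) = discretized_normal \<mu> (Var (\<lambda>G. of_int (W G)))"
    by (simp only: \<sigma>_sq)
  ultimately have "Mean (\<lambda>G. \<sigma>\<^sup>2 * g (W G) - (of_int (W G) - \<mu>) * f (W G)) =
      Mean (\<lambda>G. indicator U (W G)) - measure (measure_pmf (discretized_normal \<mu> (Var (\<lambda>G. of_int (W G))))) U"
    by (simp only:)
  note bound = bound[unfolded this]
  have \<sigma>2: "s\<^sup>2 * c \<le> \<sigma>\<^sup>2" unfolding s(3) \<sigma>_sq by (rule c(3))
  have \<sigma>3: "s ^ 3 * (c * sqrt c) \<le> \<sigma> ^ 3"
  proof -
    have "s * sqrt c \<le> \<sigma>"
      using real_sqrt_le_mono[OF c(3)] by (simp add: s_def real_sqrt_mult)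
    then have "(s * sqrt c) ^ 3 \<le> \<sigma> ^ 3" using s c by (intro power_mono) auto
    moreover have "sqrt c ^ 3 = c * sqrt c" using c by (simp add: power3_eq_cube)
    ultimately show ?thesis by (simp add: power_mult_distrib)
  qed
  have B: "2 / \<sigma>\<^sup>2 \<le> 2 / (s\<^sup>2 * c)"
  proof (rule divide_left_mono[OF \<sigma>2])
    have "0 < \<sigma>" using \<sigma> by linarith
    then show "0 < \<sigma>\<^sup>2 * (s\<^sup>2 * c)" using s(1) c(1) by (intro mult_pos_pos zero_less_power)
  qed simp
  have b: "2 / \<sigma> ^ 3 \<le> 2 / (s ^ 3 * (c * sqrt c))"
    using \<sigma>3 s c \<sigma> by (intro divide_left_mono mult_pos_pos) auto
  have V1: "sqrt (Var Tminus) \<le> sqrt 2 * s * sqrt M"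
    using real_sqrt_le_mono[OF Var_Tminus_le] by (simp add: s_def real_sqrt_mult mult_ac)
  have V2: "sqrt (Var Tplus) \<le> sqrt 32 * L * s * sqrt M"
    using real_sqrt_le_mono[OF Var_Tplus_le] L_nonneg by (simp add: s_def real_sqrt_mult mult_ac)
  have V3: "sqrt (Var Z) \<le> sqrt 72 * s * sqrt M"
    using real_sqrt_le_mono[OF Var_Z_le] by (simp add: s_def real_sqrt_mult mult_ac)
  define D where "D = (sqrt 2 + sqrt 32 * L) * M + 6 * M"
  have D: "0 \<le> D" unfolding D_def using L_nonneg M_nonneg by simp
  have MM: "sqrt M * sqrt M = M" using M_nonneg by simp
  have N: "(sqrt (Var Tminus) + sqrt (Var Tplus)) * (real n * sqrt M) + 6 * real n * M \<le> s ^ 3 * D"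
  proof -
    have "(sqrt (Var Tminus) + sqrt (Var Tplus)) * (real n * sqrt M) \<le>
        (sqrt 2 * s * sqrt M + sqrt 32 * L * s * sqrt M) * (s\<^sup>2 * sqrt M)"
      unfolding s(3) using V1 V2 M_nonneg by (intro mult_right_mono add_mono) auto
    also have "\<dots> = s ^ 3 * ((sqrt 2 + sqrt 32 * L) * (sqrt M * sqrt M))"
      by (simp only: power2_eq_square power3_eq_cube) (simp only: algebra_simps)
    finally have 1: "(sqrt (Var Tminus) + sqrt (Var Tplus)) * (real n * sqrt M)
        \<le> s ^ 3 * ((sqrt 2 + sqrt 32 * L) * M)" unfolding MM .
    have "s\<^sup>2 * (6 * M) \<le> s ^ 3 * (6 * M)"
      using M_nonneg s by (intro mult_right_mono power_increasing) auto
    then have "6 * real n * M \<le> s ^ 3 * (6 * M)" unfolding s(3) by simp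
    with 1 show ?thesis by (simp only: D_def distrib_left)
  qed
  have N0: "0 \<le> s ^ 3 * D" using s D by simp
  have "2 / \<sigma>\<^sup>2 * ((sqrt (Var Tminus) + sqrt (Var Tplus)) * (real n * sqrt M) + 6 * real n * M) / q
      \<le> 2 / (s\<^sup>2 * c) * (s ^ 3 * D) / (s\<^sup>2 * c)"
  proof (rule frac_le)
    show "2 / \<sigma>\<^sup>2 * ((sqrt (Var Tminus) + sqrt (Var Tplus)) * (real n * sqrt M) + 6 * real n * M)
        \<le> 2 / (s\<^sup>2 * c) * (s ^ 3 * D)"
      using B N N0 s c
      by (intro mult_mono) (auto intro!: add_nonneg_nonneg mult_nonneg_nonneg
          real_sqrt_ge_zero subset_var_nonneg p_bounds(1,2) M_nonneg)
    show "s\<^sup>2 * c \<le> q" unfolding s(3) by (rule c(4))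
  qed (use s c D in auto)
  also have "\<dots> = 2 / c\<^sup>2 * D / s"
    using s(1) c(1) by (simp add: field_simps power2_eq_square power3_eq_cube)
  finally have 1: "2 / \<sigma>\<^sup>2 * ((sqrt (Var Tminus) + sqrt (Var Tplus)) * (real n * sqrt M) + 6 * real n * M) / q
      \<le> 2 / c\<^sup>2 * D / s" .
  have "4 * (2 / \<sigma> ^ 3) * (real n * sqrt M) \<le> 4 * (2 / (s ^ 3 * (c * sqrt c))) * (s\<^sup>2 * sqrt M)"
    unfolding s(3) using b M_nonneg by (intro mult_right_mono mult_left_mono) auto
  also have "\<dots> = 8 * sqrt M / (c * sqrt c) / s"
    using s(1) c(1) by (simp add: field_simps power2_eq_square power3_eq_cube)
  finally have 2: "4 * (2 / \<sigma> ^ 3) * (real n * sqrt M) \<le> 8 * sqrt M / (c * sqrt c) / s" .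
  have "2 / \<sigma>\<^sup>2 * sqrt (Var Z) \<le> 2 / (s\<^sup>2 * c) * (sqrt 72 * s * sqrt M)"
    using B V3 s c by (intro mult_mono) (auto intro!: real_sqrt_ge_zero subset_var_nonneg p_bounds(1,2))
  also have "\<dots> = 2 * sqrt 72 * sqrt M / c / s"
    using s(1) c(1) by (simp add: field_simps power2_eq_square)
  finally have 3: "2 / \<sigma>\<^sup>2 * sqrt (Var Z) \<le> 2 * sqrt 72 * sqrt M / c / s" .
  have "tv_const M L c / sqrt (real n) = 2 / c\<^sup>2 * D / s + 8 * sqrt M / (c * sqrt c) / s + 2 * sqrt 72 * sqrt M / c / s"
    by (simp only: tv_const_def D_def s_def add_divide_distrib)
  then show ?thesis using bound 1 2 3 by linarith
qed

end

lemma erdos_renyi_expectation: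
  assumes "0 < p" "p < 1"
  shows "measure_pmf.expectation (erdos_renyi n p) F = subset_expect p (vertex_pairs n) F"
  unfolding erdos_renyi_def by (rule expectation_random_subset) (use assms in auto)

lemma (in er_graph) tv_dist_num_of_degree:
  assumes c: "0 < c" "1 \<le> real n * c" "real n * c \<le> Var (\<lambda>G. of_int (W G))" "real n * c \<le> q"
  shows "let G = erdos_renyi n p; S = (\<lambda>E. real (num_of_degree d n E));
      m = measure_pmf.expectation G S; v = measure_pmf.variance G S
    in tv_dist (law G S) (law (discretized_normal m v) real_of_int) \<le> tv_const M L c / sqrt (real n)"
proof -
  note ex = erdos_renyi_expectation[OF p_pos p_bounds(3), of n]
  have S: "real (num_of_degree d n G) = of_int (W G)" for G by (simp add: W_def)
  let ?S = "\<lambda>E. real (num_of_degree d n E)"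
  have "tv_dist (law (erdos_renyi n p) ?S)
      (law (discretized_normal \<mu> (Var (\<lambda>G. of_int (W G)))) real_of_int) \<le> tv_const M L c / sqrt (real n)"
  proof (rule tv_dist_le)
    fix B :: "real set" assume B: "B \<in> sets borel"
    let ?A = "real_of_int -` B"
    have "measure (law (erdos_renyi n p) ?S) B = measure_pmf.expectation (erdos_renyi n p) (indicator (?S -` B))"
      using B by (simp add: law_pmf_measure)
    also have "\<dots> = Mean (\<lambda>G. indicator ?A (W G))"
      unfolding ex by (rule subset_expect_cong) (auto simp: indicator_def S)
    finally show "\<bar>measure (law (erdos_renyi n p) ?S) B
        - measure (law (discretized_normal \<mu> (Var (\<lambda>G. of_int (W G)))) real_of_int) B\<bar>
        \<le> tv_const M L c / sqrt (real n)"
      using normal_approximation[OF c, of ?A] B by (simp only: law_pmf_measure)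
  qed
  then show ?thesis unfolding Let_def ex S subset_var_def .
qed

theorem proposition2p7:
  fixes d n0 :: nat and \<theta>' \<theta>'' :: real
  assumes "0 < \<theta>'" and "\<theta>' \<le> \<theta>''" and "n0 > 0"
  shows "\<exists>c>0. \<forall>(p :: nat \<Rightarrow> real) (\<theta> :: nat \<Rightarrow> real).
    (\<forall>n\<ge>2. 0 < p n \<and> p n < 1) \<longrightarrow>
    (\<forall>n\<ge>2. n \<ge> n0 \<longrightarrow> \<theta>' \<le> \<theta> n \<and> \<theta> n \<le> \<theta>'' \<and> p n = \<theta> n / (real n - 1)) \<longrightarrow>
    (\<forall>n\<ge>2.
      let G = erdos_renyi n (p n);
          S = (\<lambda>E. real (num_of_degree d n E));
          \<mu> = measure_pmf.expectation G S;
          v = measure_pmf.variance G S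
      in tv_dist (law G S) (law (discretized_normal \<mu> v) real_of_int) \<le> c / sqrt (real n))"
proof -
  \<comment> \<open>\<open>L\<close> bounds \<open>n * p = \<theta> * n / (n - 1)\<close> with
    \<open>n / (n - 1) \<le> 2\<close>. \<open>\<tau>\<close> is a lower bound of
    \<open>m * p\<close> for \<open>m\<close> equal to \<open>n - 1\<close> or \<open>n - 2\<close>,
    as \<open>n - 1 \<le> 2 * m\<close> for large \<open>n\<close>.\<close>
  define L where "L = 2 * \<theta>''"
  define \<tau> where "\<tau> = \<theta>' / 2"
  define b where "b k = (\<tau> / real k) ^ k * exp (- 2 * L)" for k :: nat
  define c0 where "c0 = min (b d) (b (d + 1))"
  \<comment> \<open>One constant for two lower bounds: the first entry serves the variance, the
    second serves \<open>q\<close>, where the number of pairs times \<open>p\<close> contributes at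
    least \<open>n * \<theta>' / 2\<close>.\<close>
  define c where "c = min (c0\<^sup>2) (\<theta>' / 2 * c0\<^sup>2)"
  define C where "C = tv_const (256 * exp (1 + 2 * L)) L c"
  \<comment> \<open>From \<open>n1\<close> on: \<open>n0\<close> makes the formula for
    \<open>p\<close> available, \<open>d + 3\<close> makes degree \<open>d + 1\<close> possible with
    \<open>n - 2\<close> trials, \<open>2 * \<theta>''\<close> forces \<open>p \<le> 1 / 2\<close>,
    and \<open>1 / c\<close> gives \<open>1 \<le> n * c\<close>.\<close>
  obtain n1 :: nat where n1: "real n0 + real d + 3 + 2 * \<theta>'' + 1 / c \<le> real n1"
    using real_arch_simple by blast
  have "0 < \<theta>''" using assms by linarith
  have b: "0 < b k" for k
    using assms by (cases k) (auto simp: b_def \<tau>_def)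
  then have c0: "0 < c0" by (simp add: c0_def)
  then have c: "0 < c" using assms by (simp add: c_def)
  have "0 \<le> C" unfolding C_def tv_const_def using c \<open>0 < \<theta>''\<close> by (simp add: L_def)
  show ?thesis
  \<comment> \<open>\<open>C\<close> serves the large \<open>n\<close>; \<open>sqrt n1\<close> makes
    the bound exceed 1 for \<open>n < n1\<close>, where the distance is at most 1 anyway; the last
    \<open>1\<close> keeps the constant positive.\<close>
  proof (intro exI[of _ "C + sqrt (real n1) + 1"] conjI allI impI)
    show "0 < C + sqrt (real n1) + 1" using \<open>0 \<le> C\<close> real_sqrt_ge_zero[of "real n1"] by linarith
    fix p \<theta> :: "nat \<Rightarrow> real" and n :: nat
    assume p: "\<forall>n\<ge>2. 0 < p n \<and> p n < 1" and n: "2 \<le> n"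
      and \<theta>: "\<forall>n\<ge>2. n \<ge> n0 \<longrightarrow> \<theta>' \<le> \<theta> n \<and> \<theta> n \<le> \<theta>'' \<and> p n = \<theta> n / (real n - 1)"
    have sn: "0 < sqrt (real n)" using n by simp
    show "let G = erdos_renyi n (p n);
          S = (\<lambda>E. real (num_of_degree d n E));
          \<mu> = measure_pmf.expectation G S;
          v = measure_pmf.variance G S
      in tv_dist (law G S) (law (discretized_normal \<mu> v) real_of_int) \<le> (C + sqrt (real n1) + 1) / sqrt (real n)"
    proof (cases "n < n1")
      case True
      then have "sqrt (real n) \<le> C + sqrt (real n1) + 1"
        using \<open>0 \<le> C\<close> real_sqrt_le_mono[of "real n" "real n1"] by linarith
      then have "1 \<le> (C + sqrt (real n1) + 1) / sqrt (real n)" using sn by simp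
      then show ?thesis unfolding Let_def by (rule order_trans[OF tv_dist_law_le_1])
    next
      case False
      then have nn: "real n0 + real d + 3 + 2 * \<theta>'' + 1 / c \<le> real n" using n1 by linarith
      moreover have "0 < 1 / c" using c by simp
      ultimately have n': "n0 \<le> n" "d + 3 \<le> n" "2 * \<theta>'' + 3 \<le> real n" "1 / c \<le> real n"
        using \<open>0 < \<theta>''\<close> by linarith+
      have th: "\<theta>' \<le> \<theta> n" "\<theta> n \<le> \<theta>''" "p n = \<theta> n / (real n - 1)" using \<theta> n n'(1) by auto
      have n1': "0 < real n - 1" using n by simp
      have pn: "(real n - 1) * p n = \<theta> n" using th(3) n1' by simp
      have p0: "0 < p n" using p n by blast
      have "p n * (real n - 1) \<le> 1 / 2 * (real n - 1)" using pn th n' by (simp add: mult.commute)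
      then have p_half: "p n \<le> 1 / 2" using n1' by (rule mult_right_le_imp_le)
      have np: "real n * p n \<le> L"
      proof -
        have "real n * p n \<le> (2 * (real n - 1)) * p n" using n p0 by (intro mult_right_mono) auto
        also have "\<dots> = 2 * \<theta> n" by (simp only: mult.assoc pn)
        finally show ?thesis using th(2) by (simp add: L_def)
      qed
      interpret er_graph n d "p n" L by unfold_locales (fact p0 p_half np)+
      have lower: "c0 \<le> binom_prob (p n) m k" if "m = n - 1 \<or> m = n - 2" "k = d \<or> k = d + 1" for m k
      proof -
        have m: "real m \<le> real n" "real n - 2 \<le> real m" "k \<le> m" using that n n' by auto
        have "\<tau> \<le> real m * p n"
        proof -
          have "\<theta>' \<le> (real n - 1) * p n" using pn th by simp
          also have "\<dots> \<le> (2 * real m) * p n" using m n' p0 \<open>0 < \<theta>''\<close> by (intro mult_right_mono) auto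
          finally show ?thesis by (simp add: \<tau>_def)
        qed
        moreover have "real m * p n \<le> L"
          using mult_right_mono[OF m(1), of "p n"] p0 np by linarith
        ultimately have "b k \<le> binom_prob (p n) m k"
          unfolding b_def using p0 p_half m(3) assms(1) by (intro binom_prob_lower) (auto simp: \<tau>_def)
        moreover have "c0 \<le> b k" using that by (auto simp: c0_def)
        ultimately show ?thesis by linarith
      qed
      have v: "real n * c \<le> Var (\<lambda>G. of_int (W G))"
      proof -
        have "real n * c \<le> real n * c0\<^sup>2" by (intro mult_left_mono) (auto simp: c_def)
        also have "\<dots> \<le> Var (\<lambda>G. of_int (W G))"
          by (rule Var_W_lower) (use c0 lower in auto)
        finally show ?thesis .
      qed
      have q: "real n * c \<le> q"
      proof -
        have "real n * c \<le> real n * (\<theta>' / 2 * c0\<^sup>2)" by (intro mult_left_mono) (auto simp: c_def)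
        also have "\<dots> \<le> real n * (((real n - 1) * p n) / 2 * c0\<^sup>2)"
          unfolding pn using th by (intro mult_left_mono mult_right_mono divide_right_mono) auto
        also have "\<dots> = p n * real (n - 1) * real n / 2 * c0\<^sup>2" using n by (simp add: of_nat_diff)
        also have "\<dots> \<le> q" by (rule q_lower) (use c0 lower in auto)
        finally show ?thesis .
      qed
      have nc: "1 \<le> real n * c" using n'(4) c by (simp add: pos_divide_le_eq)
      have "tv_const M L c / sqrt (real n) \<le> (C + sqrt (real n1) + 1) / sqrt (real n)"
        unfolding C_def M_def using sn real_sqrt_ge_zero[of "real n1"] by (intro divide_right_mono) auto
      then show ?thesis
        using tv_dist_num_of_degree[OF c nc v q] unfolding Let_def by linarith
    qed
  qed
qed

end
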